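(* There is a polynomial-time reduction from $\textsc{Monotone}$-$\mathsf{NC}^0_3$-$\textsc{Avoid}$ to $\textsc{Maj}_3$-$\textsc{Avoid}$.
   Context: $\mathcal C$-$\textsc{Avoid}$: given a circuit $C:\{0,1\}^n\to\{0,1\}^m$ from class $\mathcal C$ with $m>n$, find $y\in\{0,1\}^m$ not in $\mathrm{Range}(C)=\{C(x):x\in\{0,1\}^n\}$. $\textsc{Monotone}$-$\mathsf{NC}^0_3$-$\textsc{Avoid}$: the instances are monotone (only $\wedge,\vee$ gates) constant-depth bounded fan-in circuits in which each output bit depends on at most $3$ input bits. $\textsc{Maj}_3$-$\textsc{Avoid}$: the instances are circuits $C:\{0,1\}^n\to\{0,1\}^m$, $m>n$, in which every output bit is the majority of exactly three input variables. A polynomial-time reduction here means a polynomial-time procedure that, from an instance $C$ of the first problem, produces an instance $C'$ of the second problem and a polynomial-time way to convert any solution for $C'$ into a solution for $C$. *)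

theory Defs
  imports Main "HOL-Computational_Algebra.Polynomial"
begin

section \<open>Polynomial time: deterministic multi-tape Turing machines\<close>

text \<open>
  Symbols and states are natural numbers, bounded by \<open>nsyms\<close> and \<open>nstates\<close>; symbol \<open>0\<close> is the
  blank. Tapes are infinite in both directions. The transition function is only ever applied to
  states and symbols below these bounds, so it amounts to a finite table.
\<close>

datatype move = Go_Left | Stay | Go_Right

record machine =
  ntapes :: nat
  nstates :: nat
  nsyms :: nat
  start :: nat
  halt :: nat
  delta :: "nat \<Rightarrow> nat list \<Rightarrow> nat \<times> (nat \<times> move) list"

definition valid_machine :: "machine \<Rightarrow> bool" where
  "valid_machine M \<longleftrightarrow>
     0 < ntapes M \<and> 0 < nsyms M \<and> start M < nstates M \<and> halt M < nstates M \<and>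
     (\<forall>q ss. q < nstates M \<and> length ss = ntapes M \<and> (\<forall>s\<in>set ss. s < nsyms M) \<longrightarrow>
        fst (delta M q ss) < nstates M \<and>
        length (snd (delta M q ss)) = ntapes M \<and>
        (\<forall>a\<in>set (snd (delta M q ss)). fst a < nsyms M))"

type_synonym tape = "(int \<Rightarrow> nat) \<times> int"  \<comment> \<open>cell contents and head position\<close>

fun read_tape :: "tape \<Rightarrow> nat" where
  "read_tape (c, h) = c h"

fun move_head :: "move \<Rightarrow> int \<Rightarrow> int" where
  "move_head Go_Left h = h - 1"
| "move_head Stay h = h"
| "move_head Go_Right h = h + 1"

fun act_tape :: "nat \<times> move \<Rightarrow> tape \<Rightarrow> tape" where
  "act_tape (s, d) (c, h) = (c(h := s), move_head d h)"

type_synonym config = "nat \<times> tape list"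

fun step :: "machine \<Rightarrow> config \<Rightarrow> config" where
  "step M (q, ts) =
     (if q = halt M then (q, ts)
      else let (q', as) = delta M q (map read_tape ts) in (q', map2 act_tape as ts))"

definition word_tape :: "nat list \<Rightarrow> tape" where
  "word_tape w = ((\<lambda>i. if 0 \<le> i \<and> i < int (length w) then w ! nat i else 0), 0)"

definition init_config :: "machine \<Rightarrow> nat list list \<Rightarrow> config" where
  "init_config M ws =
     (start M, map word_tape ws @ replicate (ntapes M - length ws) (word_tape []))"

definition tape_holds :: "tape \<Rightarrow> nat list \<Rightarrow> bool" where
  "tape_holds t w \<longleftrightarrow>
     0 \<notin> set w \<and> (\<forall>i<length w. fst t (int i) = w ! i) \<and> fst t (int (length w)) = 0"

text \<open>
  Each input word is given on a tape of its own. The output is read off the last tape, which is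
  not an input tape.
\<close>

definition computes_within :: "machine \<Rightarrow> nat list list \<Rightarrow> nat \<Rightarrow> nat list \<Rightarrow> bool" where
  "computes_within M ws T v \<longleftrightarrow>
     length ws < ntapes M \<and> (\<forall>w\<in>set ws. \<forall>s\<in>set w. 0 < s \<and> s < nsyms M) \<and>
     (\<exists>t\<le>T. \<exists>ts. (step M ^^ t) (init_config M ws) = (halt M, ts) \<and> tape_holds (last ts) v)"

definition poly_time_on ::
    "'a set \<Rightarrow> ('a \<Rightarrow> nat list list) \<Rightarrow> ('b \<Rightarrow> nat list) \<Rightarrow> ('a \<Rightarrow> 'b) \<Rightarrow> bool" where
  "poly_time_on D enc enc' f \<longleftrightarrow>
     (\<exists>M (p :: nat poly). valid_machine M \<and>
        (\<forall>x\<in>D. computes_within M (enc x) (poly p (sum_list (map length (enc x)))) (enc' (f x))))"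

section \<open>Search problems and reductions\<close>

record ('i, 's) search_problem =
  instances :: "'i set"
  solutions :: "'i \<Rightarrow> 's set"
  enc_inst :: "'i \<Rightarrow> nat list"
  enc_sol :: "'s \<Rightarrow> nat list"

definition poly_time_reducible ::
    "('i, 's) search_problem \<Rightarrow> ('j, 't) search_problem \<Rightarrow> bool" where
  "poly_time_reducible P Q \<longleftrightarrow>
     (\<exists>(f :: 'i \<Rightarrow> 'j) (g :: 'i \<times> 't \<Rightarrow> 's).
        poly_time_on (instances P) (\<lambda>x. [enc_inst P x]) (enc_inst Q) f \<and>
        poly_time_on {(x, y). x \<in> instances P \<and> y \<in> solutions Q (f x)}
          (\<lambda>(x, y). [enc_inst P x, enc_sol Q y]) (enc_sol P) g \<and>
        (\<forall>x\<in>instances P. f x \<in> instances Q \<and>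
           (\<forall>y\<in>solutions Q (f x). g (x, y) \<in> solutions P x)))"

section \<open>Boolean circuits\<close>

text \<open>
  A circuit with \<open>n\<close> inputs is a list of gates in topological order. Wires \<open>0, \<dots>, n - 1\<close> carry
  the inputs, and wire \<open>n + k\<close> carries the value of the gate at position \<open>k\<close>.
\<close>

datatype gate = And nat nat | Or nat nat | Maj nat nat nat

datatype circuit = Circuit (num_inputs: nat) (gates: "gate list") (outputs: "nat list")

abbreviation num_outputs :: "circuit \<Rightarrow> nat" where
  "num_outputs C \<equiv> length (outputs C)"

fun gate_wires :: "gate \<Rightarrow> nat set" where
  "gate_wires (And i j) = {i, j}"
| "gate_wires (Or i j) = {i, j}"
| "gate_wires (Maj i j k) = {i, j, k}"

definition wf_circuit :: "circuit \<Rightarrow> bool" where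
  "wf_circuit C \<longleftrightarrow>
     (\<forall>k<length (gates C). \<forall>w\<in>gate_wires (gates C ! k). w < num_inputs C + k) \<and>
     (\<forall>w\<in>set (outputs C). w < num_inputs C + length (gates C))"

fun gate_value :: "bool list \<Rightarrow> gate \<Rightarrow> bool" where
  "gate_value vs (And i j) \<longleftrightarrow> vs ! i \<and> vs ! j"
| "gate_value vs (Or i j) \<longleftrightarrow> vs ! i \<or> vs ! j"
| "gate_value vs (Maj i j k) \<longleftrightarrow>
     (vs ! i \<and> vs ! j) \<or> (vs ! i \<and> vs ! k) \<or> (vs ! j \<and> vs ! k)"

definition wire_values :: "circuit \<Rightarrow> bool list \<Rightarrow> bool list" where
  "wire_values C x = foldl (\<lambda>vs g. vs @ [gate_value vs g]) x (gates C)"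

definition eval_circuit :: "circuit \<Rightarrow> bool list \<Rightarrow> bool list" where
  "eval_circuit C x = map (\<lambda>w. wire_values C x ! w) (outputs C)"

definition circuit_range :: "circuit \<Rightarrow> bool list set" where
  "circuit_range C = eval_circuit C ` {x. length x = num_inputs C}"

definition gate_depth :: "nat list \<Rightarrow> gate \<Rightarrow> nat" where
  "gate_depth ds g = Suc (Max ((\<lambda>w. ds ! w) ` gate_wires g))"

definition wire_depths :: "circuit \<Rightarrow> nat list" where
  "wire_depths C =
     foldl (\<lambda>ds g. ds @ [gate_depth ds g]) (replicate (num_inputs C) 0) (gates C)"

definition depth_le :: "circuit \<Rightarrow> nat \<Rightarrow> bool" where
  "depth_le C d \<longleftrightarrow> (\<forall>w\<in>set (outputs C). wire_depths C ! w \<le> d)"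

definition depends_on :: "circuit \<Rightarrow> nat \<Rightarrow> nat \<Rightarrow> bool" where
  "depends_on C i j \<longleftrightarrow>
     (\<exists>x. length x = num_inputs C \<and>
        eval_circuit C x ! i \<noteq> eval_circuit C (x[j := \<not> x ! j]) ! i)"

fun monotone_gate :: "gate \<Rightarrow> bool" where
  "monotone_gate (And i j) \<longleftrightarrow> True"
| "monotone_gate (Or i j) \<longleftrightarrow> True"
| "monotone_gate (Maj i j k) \<longleftrightarrow> False"

text \<open>The constant bounding the depth of the circuits is the parameter \<open>d\<close>.\<close>

definition monotone_NC0_3 :: "nat \<Rightarrow> circuit set" where
  "monotone_NC0_3 d =
     {C. wf_circuit C \<and> (\<forall>g\<in>set (gates C). monotone_gate g) \<and> depth_le C d \<and>
         (\<forall>i<num_outputs C. card {j. j < num_inputs C \<and> depends_on C i j} \<le> 3)}"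

definition maj3_circuits :: "circuit set" where
  "maj3_circuits =
     {C. wf_circuit C \<and>
         (\<forall>g\<in>set (gates C). \<exists>i j k. g = Maj i j k \<and> distinct [i, j, k] \<and>
            i < num_inputs C \<and> j < num_inputs C \<and> k < num_inputs C) \<and>
         (\<forall>w\<in>set (outputs C). num_inputs C \<le> w)}"

section \<open>Encodings and the range avoidance problem\<close>

text \<open>
  Wire numbers are written in unary. In an instance of range avoidance every wire number is below
  \<open>n + s < m + s\<close>, where \<open>s\<close> is the number of gates, and any encoding lists all \<open>s\<close> gates and all
  \<open>m\<close> outputs; so the length of this encoding is polynomially related to that of the encoding
  with binary numbers.
\<close>

definition enc_nat :: "nat \<Rightarrow> nat list" where
  "enc_nat n = replicate n 1 @ [2]"

fun enc_gate :: "gate \<Rightarrow> nat list" where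
  "enc_gate (And i j) = 3 # enc_nat i @ enc_nat j"
| "enc_gate (Or i j) = 4 # enc_nat i @ enc_nat j"
| "enc_gate (Maj i j k) = 5 # enc_nat i @ enc_nat j @ enc_nat k"

definition enc_circuit :: "circuit \<Rightarrow> nat list" where
  "enc_circuit C =
     enc_nat (num_inputs C) @ concat (map enc_gate (gates C)) @
     concat (map (\<lambda>w. 6 # enc_nat w) (outputs C))"

definition enc_bits :: "bool list \<Rightarrow> nat list" where
  "enc_bits = map (\<lambda>b. if b then 2 else 1)"

definition avoid :: "circuit set \<Rightarrow> (circuit, bool list) search_problem" where
  "avoid K =
     \<lparr>instances = {C \<in> K. num_inputs C < num_outputs C},
      solutions = (\<lambda>C. {y. length y = num_outputs C \<and> y \<notin> circuit_range C}),
      enc_inst = enc_circuit,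
      enc_sol = enc_bits\<rparr>"

lemma enc_nat_inject: "enc_nat m @ u = enc_nat n @ v \<longleftrightarrow> m = n \<and> u = v"
proof (induction m arbitrary: n)
  case 0
  then show ?case by (cases n) (auto simp: enc_nat_def)
next
  case (Suc m)
  then show ?case by (cases n) (auto simp: enc_nat_def)
qed

lemma enc_outputs_inject:
  "concat (map (\<lambda>w. 6 # enc_nat w) os) = concat (map (\<lambda>w. 6 # enc_nat w) os') \<Longrightarrow> os = os'"
proof (induction os arbitrary: os')
  case Nil
  then show ?case by (cases os') auto
next
  case (Cons a os)
  then show ?case by (cases os') (auto simp: enc_nat_inject)
qed

lemma enc_gates_inject:
  assumes "concat (map enc_gate gs) @ concat (map (\<lambda>w. 6 # enc_nat w) os) =
    concat (map enc_gate gs') @ concat (map (\<lambda>w. 6 # enc_nat w) os')"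
  shows "gs = gs' \<and> os = os'"
  using assms
proof (induction gs arbitrary: gs')
  case Nil
  show ?case
  proof (cases gs')
    case Nil
    then show ?thesis using Nil.prems enc_outputs_inject by auto
  next
    case (Cons g hs)
    then show ?thesis using Nil.prems by (cases g; cases os) auto
  qed
next
  case (Cons g gs)
  show ?case
  proof (cases gs')
    case Nil
    then show ?thesis using Cons.prems by (cases g; cases os') auto
  next
    case (Cons h hs)
    then show ?thesis using Cons.prems Cons.IH[of hs]
      by (cases g; cases h) (auto simp: enc_nat_inject)
  qed
qed

lemma inj_enc_circuit: "inj enc_circuit"
proof (rule injI)
  fix C C' assume "enc_circuit C = enc_circuit C'"
  then show "C = C'"
    unfolding enc_circuit_def enc_nat_inject
    by (auto intro: circuit.expand dest: enc_gates_inject)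
qed

end

theory Submission
  imports Defs
begin

text \<open>
  A monotone function of at most three variables, unless it is the majority, has an output value that
  forces the value of one of its variables. As long as some output has such a value, prescribe it
  and substitute the forced variable: one output and one variable disappear together, so there
  remain more outputs than variables. If no variable is left, an unprescribed output is constant and
  its negation completes a solution; otherwise the remaining outputs are majorities of exactly three
  remaining variables. Monotonicity makes forcing testable by evaluating the circuit: the value true
  of an output forces \<open>a\<close> to true if the output is false when \<open>a\<close> is false and all other
  undetermined variables are true, and dually. A constant output passes one of the two tests for
  every variable, so it needs no separate treatment while variables are left.

  Polynomial time comes for free from a loop language on tapes in which every loop runs once per
  input cell and counters grow only by increments.
\<close>

section \<open>Structured tape programs\<close>

text \<open>Why only majorities survive: an output that forces nothing is true when all undetermined
  variables but one are true, and false when just one is true. With at most two relevant variables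
  these conditions clash, since dropping one leaves at most one; with three they say that two true
  variables are necessary and sufficient.

  Prescribing an output can make the restriction unattainable. This is harmless: the invariant only
  says that every preimage of the prescribed values obeys the restriction.

  Substituted circuits are never built. A restriction of inputs and outputs is the whole state, and
  every question about the restricted circuit, including which three variables a majority depends
  on, is settled by evaluating the original circuit at suitable points, in one left-to-right pass
  over its encoding. If all variables disappear, a fixed majority instance is still handed over and
  its solution is ignored.

  Nested loops let counters grow, but only by a polynomial in the loop length, so time bounds can be
  computed as polynomials along the syntax of a program.\<close>

datatype tprog =
    Nop
  | Do nat "nat option" move
  | TSeq tprog tprog (infixr "\<triangleright>" 60)
  | Branch nat nat tprog tprog
  | Until nat nat tprog

definition act :: "nat \<Rightarrow> nat option \<Rightarrow> move \<Rightarrow> (nat \<Rightarrow> tape) \<Rightarrow> nat \<Rightarrow> tape" where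
  "act t w m T =
     T(t := act_tape (case w of None \<Rightarrow> read_tape (T t) | Some s \<Rightarrow> s, m) (T t))"

text \<open>The step counts are those of the assembled code. The second alternative of a branch is
  placed first and ends with a jump over the other one, hence the extra step in
  \<open>Branch_neq\<close>; a round of \<open>Until\<close> pays one step for the test and one for
  jumping back.\<close>

inductive exec :: "tprog \<Rightarrow> (nat \<Rightarrow> tape) \<Rightarrow> nat \<Rightarrow> (nat \<Rightarrow> tape) \<Rightarrow> bool" where
  Nop: "exec Nop T 0 T"
| Do: "exec (Do t w m) T 1 (act t w m T)"
| Seq: "exec p T m T' \<Longrightarrow> exec q T' n T'' \<Longrightarrow> exec (p \<triangleright> q) T (m + n) T''"
| Branch_eq: "read_tape (T t) = s \<Longrightarrow> exec p T n T' \<Longrightarrow> exec (Branch t s p q) T (1 + n) T'"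
| Branch_neq: "read_tape (T t) \<noteq> s \<Longrightarrow> exec q T n T' \<Longrightarrow> exec (Branch t s p q) T (1 + n + 1) T'"
| Until_stop: "read_tape (T t) = s \<Longrightarrow> exec (Until t s p) T 1 T"
| Until_loop: "read_tape (T t) \<noteq> s \<Longrightarrow> exec p T m T' \<Longrightarrow> exec (Until t s p) T' n T'' \<Longrightarrow>
    exec (Until t s p) T (1 + m + 1 + n) T''"

fun tprog_ok :: "nat \<Rightarrow> nat \<Rightarrow> tprog \<Rightarrow> bool" where
  "tprog_ok k b Nop \<longleftrightarrow> True"
| "tprog_ok k b (Do t w m) \<longleftrightarrow> t < k \<and> (\<forall>s\<in>set_option w. s < b)"
| "tprog_ok k b (p \<triangleright> q) \<longleftrightarrow> tprog_ok k b p \<and> tprog_ok k b q"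
| "tprog_ok k b (Branch t s p q) \<longleftrightarrow> t < k \<and> tprog_ok k b p \<and> tprog_ok k b q"
| "tprog_ok k b (Until t s p) \<longleftrightarrow> t < k \<and> tprog_ok k b p"

section \<open>Assembling tape programs into Turing machines\<close>

datatype instr = IDo nat "nat option" move | IBranch nat nat nat | IJump nat

fun code_size :: "tprog \<Rightarrow> nat" where
  "code_size Nop = 0"
| "code_size (Do t w m) = 1"
| "code_size (p \<triangleright> q) = code_size p + code_size q"
| "code_size (Branch t s p q) = 1 + code_size q + 1 + code_size p"
| "code_size (Until t s p) = 1 + code_size p + 1"

text \<open>Jump targets are absolute, so the address \<open>a\<close> at which the code will be
  placed is a parameter.\<close>

fun assemble :: "nat \<Rightarrow> tprog \<Rightarrow> instr list" where
  "assemble a Nop = []"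
| "assemble a (Do t w m) = [IDo t w m]"
| "assemble a (p \<triangleright> q) = assemble a p @ assemble (a + code_size p) q"
| "assemble a (Branch t s p q) =
     IBranch t s (a + 1 + code_size q + 1) # assemble (a + 1) q @
     IJump (a + 1 + code_size q + 1 + code_size p) # assemble (a + 1 + code_size q + 1) p"
| "assemble a (Until t s p) =
     IBranch t s (a + 1 + code_size p + 1) # assemble (a + 1) p @ [IJump a]"

lemma length_assemble [simp]: "length (assemble a p) = code_size p"
  by (induction p arbitrary: a) auto

abbreviation stay_all :: "nat list \<Rightarrow> (nat \<times> move) list" where
  "stay_all ss \<equiv> map (\<lambda>s. (s, Stay)) ss"

fun instr_delta :: "nat \<Rightarrow> instr \<Rightarrow> nat list \<Rightarrow> nat \<times> (nat \<times> move) list" where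
  "instr_delta q (IDo t w m) ss =
     (Suc q, (stay_all ss)[t := (case w of None \<Rightarrow> ss ! t | Some s \<Rightarrow> s, m)])"
| "instr_delta q (IBranch t s l) ss = (if ss ! t = s then l else Suc q, stay_all ss)"
| "instr_delta q (IJump l) ss = (l, stay_all ss)"

text \<open>The state is the program counter. The address just behind the last instruction is the
  halting state, which is why \<open>instr_ok\<close> admits jumps to it.\<close>

definition code_machine :: "nat \<Rightarrow> nat \<Rightarrow> instr list \<Rightarrow> machine" where
  "code_machine k b is =
     \<lparr>ntapes = k, nstates = Suc (length is), nsyms = b, start = 0, halt = length is,
      delta = (\<lambda>q ss. if q < length is then instr_delta q (is ! q) ss else (q, stay_all ss))\<rparr>"

lemma code_machine_sel [simp]:
  "ntapes (code_machine k b is) = k" "nstates (code_machine k b is) = Suc (length is)"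
  "nsyms (code_machine k b is) = b" "start (code_machine k b is) = 0"
  "halt (code_machine k b is) = length is"
  by (simp_all add: code_machine_def)

fun instr_ok :: "nat \<Rightarrow> nat \<Rightarrow> nat \<Rightarrow> instr \<Rightarrow> bool" where
  "instr_ok k b l (IDo t w m) \<longleftrightarrow> t < k \<and> (\<forall>s\<in>set_option w. s < b)"
| "instr_ok k b l (IBranch t s l') \<longleftrightarrow> l' \<le> l"
| "instr_ok k b l (IJump l') \<longleftrightarrow> l' \<le> l"

lemma instr_ok_mono: "instr_ok k b l i \<Longrightarrow> l \<le> l' \<Longrightarrow> instr_ok k b l' i"
  by (cases i) auto

lemma assemble_ok:
  "tprog_ok k b p \<Longrightarrow> i \<in> set (assemble a p) \<Longrightarrow> instr_ok k b (a + code_size p) i"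
proof (induction p arbitrary: a i)
  case (TSeq p q)
  from TSeq.prems(2) consider "i \<in> set (assemble a p)" | "i \<in> set (assemble (a + code_size p) q)"
    by auto
  then show ?case
  proof cases
    case 1
    then show ?thesis using TSeq.IH(1)[of i a] TSeq.prems(1)
      by (auto intro: instr_ok_mono)
  next
    case 2
    then show ?thesis using TSeq.IH(2)[of i "a + code_size p"] TSeq.prems(1)
      by (auto simp: add.assoc)
  qed
next
  case (Branch t s p q)
  from Branch.prems(2) consider "i = IBranch t s (a + 1 + code_size q + 1)"
    | "i \<in> set (assemble (a + 1) q)" | "i = IJump (a + 1 + code_size q + 1 + code_size p)"
    | "i \<in> set (assemble (a + 1 + code_size q + 1) p)"
    by auto
  then show ?case
  proof cases
    case 2
    then have "instr_ok k b (a + 1 + code_size q) i"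
      using Branch.IH(2)[of i "a + 1"] Branch.prems(1) by auto
    then show ?thesis by (rule instr_ok_mono) auto
  next
    case 4
    then have "instr_ok k b (a + 1 + code_size q + 1 + code_size p) i"
      using Branch.IH(1)[of i "a + 1 + code_size q + 1"] Branch.prems(1) by auto
    then show ?thesis by (rule instr_ok_mono) auto
  qed auto
next
  case (Until t s p)
  from Until.prems(2) consider "i = IBranch t s (a + 1 + code_size p + 1)"
    | "i \<in> set (assemble (a + 1) p)" | "i = IJump a"
    by auto
  then show ?case
  proof cases
    case 2
    then have "instr_ok k b (a + 1 + code_size p) i"
      using Until.IH[of i "a + 1"] Until.prems(1) by auto
    then show ?thesis by (rule instr_ok_mono) auto
  qed auto
qed auto

lemma valid_code_machine:
  assumes "0 < k" "0 < b" and ok: "\<forall>i\<in>set is. instr_ok k b (length is) i"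
  shows "valid_machine (code_machine k b is)"
proof -
  have "fst (delta (code_machine k b is) q ss) < Suc (length is) \<and>
      length (snd (delta (code_machine k b is) q ss)) = k \<and>
      (\<forall>a\<in>set (snd (delta (code_machine k b is) q ss)). fst a < b)"
    if q: "q < Suc (length is)" and ss: "length ss = k" "\<forall>s\<in>set ss. s < b" for q ss
  proof (cases "q < length is")
    case True
    then have "instr_ok k b (length is) (is ! q)" using ok by auto
    then show ?thesis using True ss
      by (cases "is ! q")
        (auto simp: code_machine_def split: option.splits dest!: set_update_subset_insert[THEN subsetD])
  next
    case False
    then show ?thesis using q ss by (auto simp: code_machine_def)
  qed
  then show ?thesis using assms by (auto simp: valid_machine_def)
qed

lemma map2_stay: "map2 act_tape (stay_all (map read_tape ts)) ts = ts"
proof -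
  have "act_tape (read_tape t, Stay) t = t" for t :: tape
    by (cases t) auto
  then show ?thesis by (induction ts) auto
qed

lemma step_IDo:
  assumes "q < length is" "is ! q = IDo t w m" "t < k"
  shows "step (code_machine k b is) (q, map T [0..<k]) = (Suc q, map (act t w m T) [0..<k])"
proof -
  have stay: "act_tape (read_tape u, Stay) u = u" for u :: tape
    by (cases u) auto
  have "map2 act_tape
     ((stay_all (map read_tape (map T [0..<k])))
        [t := (case w of None \<Rightarrow> map read_tape (map T [0..<k]) ! t | Some s \<Rightarrow> s, m)])
     (map T [0..<k]) = map (act t w m T) [0..<k]"
    (is "map2 act_tape (_[t := ?a]) _ = _")
  proof (rule nth_equalityI)
    fix i assume "i < length (map2 act_tape
     ((stay_all (map read_tape (map T [0..<k])))[t := ?a]) (map T [0..<k]))"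
    then have i: "i < k" by auto
    show "map2 act_tape ((stay_all (map read_tape (map T [0..<k])))[t := ?a]) (map T [0..<k]) ! i
      = map (act t w m T) [0..<k] ! i"
      using i assms(3) by (auto simp: nth_list_update act_def stay split: option.splits)
  qed auto
  then show ?thesis using assms by (simp add: code_machine_def del: map_map)
qed

lemma step_IBranch:
  assumes "q < length is" "is ! q = IBranch t s l" "t < k"
  shows "step (code_machine k b is) (q, map T [0..<k]) =
    (if read_tape (T t) = s then l else Suc q, map T [0..<k])"
  using assms map2_stay[of "map T [0..<k]"] by (simp add: code_machine_def)

lemma step_IJump:
  assumes "q < length is" "is ! q = IJump l"
  shows "step (code_machine k b is) (q, map T [0..<k]) = (l, map T [0..<k])"
  using assms map2_stay[of "map T [0..<k]"] by (simp add: code_machine_def)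

definition steps_to :: "machine \<Rightarrow> config \<Rightarrow> nat \<Rightarrow> config \<Rightarrow> bool" where
  "steps_to M c n c' \<longleftrightarrow> (step M ^^ n) c = c'"

lemma steps_to_add: "steps_to M c m c' \<Longrightarrow> steps_to M c' n c'' \<Longrightarrow> steps_to M c (m + n) c''"
  unfolding steps_to_def add.commute[of m n] funpow_add by simp

lemma steps_to_1: "step M c = c' \<Longrightarrow> steps_to M c 1 c'"
  unfolding steps_to_def by simp

text \<open>Induction on the execution. The code of \<open>p\<close> sits between arbitrary
  \<open>us\<close> and \<open>vs\<close>, so that the code of a subprogram is again such an
  occurrence, with its surroundings absorbed into the context.\<close>

lemma exec_assemble:
  assumes "exec p T n T'" "tprog_ok k b p" "is = us @ assemble (length us) p @ vs"
  shows "steps_to (code_machine k b is) (length us, map T [0..<k]) n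
    (length us + code_size p, map T' [0..<k])"
  using assms
proof (induction arbitrary: us vs)
  case (Nop T)
  then show ?case by (simp add: steps_to_def)
next
  case (Do t w m T)
  then show ?case
    by (intro steps_to_1) (simp add: step_IDo del: step.simps)
next
  case (Seq p T m T' q n T'')
  have "steps_to (code_machine k b is) (length us, map T [0..<k]) m
      (length us + code_size p, map T' [0..<k])"
    using Seq by (intro Seq.IH(1)) auto
  moreover have "steps_to (code_machine k b is) (length (us @ assemble (length us) p), map T' [0..<k]) n
      (length (us @ assemble (length us) p) + code_size q, map T'' [0..<k])"
    using Seq by (intro Seq.IH(2)) auto
  ultimately show ?case using steps_to_add by (fastforce simp: add.assoc)
next
  case (Branch_eq T t s p n T' q)
  let ?us = "us @ IBranch t s (length us + 1 + code_size q + 1) # assemble (length us + 1) q @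
     [IJump (length us + 1 + code_size q + 1 + code_size p)]"
  have "steps_to (code_machine k b is) (length us, map T [0..<k]) 1 (length ?us, map T [0..<k])"
    using Branch_eq.prems Branch_eq.hyps by (intro steps_to_1) (simp add: step_IBranch del: step.simps)
  moreover have "steps_to (code_machine k b is) (length ?us, map T [0..<k]) n
      (length ?us + code_size p, map T' [0..<k])"
    using Branch_eq.prems by (intro Branch_eq.IH) auto
  ultimately show ?case using steps_to_add by (fastforce simp: add_ac)
next
  case (Branch_neq T t s q n T' p)
  let ?us = "us @ [IBranch t s (length us + 1 + code_size q + 1)]"
  have "steps_to (code_machine k b is) (length us, map T [0..<k]) 1 (length ?us, map T [0..<k])"
    using Branch_neq.prems Branch_neq.hyps by (intro steps_to_1) (simp add: step_IBranch del: step.simps)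
  moreover have "steps_to (code_machine k b is) (length ?us, map T [0..<k]) n
      (length ?us + code_size q, map T' [0..<k])"
    using Branch_neq.prems by (intro Branch_neq.IH) auto
  moreover have "steps_to (code_machine k b is) (length ?us + code_size q, map T' [0..<k]) 1
      (length us + code_size (Branch t s p q), map T' [0..<k])"
    using Branch_neq.prems
    by (intro steps_to_1) (simp add: step_IJump nth_append del: step.simps)
  ultimately show ?case using steps_to_add by blast
next
  case (Until_stop T t s p)
  then show ?case
    by (intro steps_to_1) (simp add: step_IBranch del: step.simps)
next
  case (Until_loop T t s p m T' n T'')
  let ?us = "us @ [IBranch t s (length us + 1 + code_size p + 1)]"
  have "steps_to (code_machine k b is) (length us, map T [0..<k]) 1 (length ?us, map T [0..<k])"
    using Until_loop.prems Until_loop.hyps by (intro steps_to_1) (simp add: step_IBranch del: step.simps)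
  moreover have "steps_to (code_machine k b is) (length ?us, map T [0..<k]) m
      (length ?us + code_size p, map T' [0..<k])"
    using Until_loop.prems by (intro Until_loop.IH(1)) auto
  moreover have "steps_to (code_machine k b is) (length ?us + code_size p, map T' [0..<k]) 1
      (length us, map T' [0..<k])"
    using Until_loop.prems
    by (intro steps_to_1) (simp add: step_IJump nth_append del: step.simps)
  moreover have "steps_to (code_machine k b is) (length us, map T' [0..<k]) n
      (length us + code_size (Until t s p), map T'' [0..<k])"
    using Until_loop.prems by (intro Until_loop.IH(2)) auto
  ultimately show ?case using steps_to_add by blast
qed

section \<open>Runs with an upper bound on the number of steps\<close>

definition runs :: "tprog \<Rightarrow> (nat \<Rightarrow> tape) \<Rightarrow> nat \<Rightarrow> (nat \<Rightarrow> tape) \<Rightarrow> bool" where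
  "runs p T n T' \<longleftrightarrow> (\<exists>m\<le>n. exec p T m T')"

lemma runs_code_machine:
  assumes "runs p T n T'" "tprog_ok k b p"
  shows "\<exists>m\<le>n. (step (code_machine k b (assemble 0 p)) ^^ m) (0, map T [0..<k]) =
    (code_size p, map T' [0..<k])"
  using assms exec_assemble[of p T _ T' k b "assemble 0 p" "[]" "[]"]
  unfolding runs_def steps_to_def by auto

lemma runs_mono: "runs p T m T' \<Longrightarrow> m \<le> n \<Longrightarrow> runs p T n T'"
  unfolding runs_def by (meson le_trans)

lemma runs_Nop: "runs Nop T 0 T"
  unfolding runs_def by (auto intro: exec.Nop)

lemma runs_Do: "act t w m T = T' \<Longrightarrow> runs (Do t w m) T 1 T'"
  unfolding runs_def using exec.Do[of t w m T] by (intro exI[of _ 1]) simp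

lemma runs_Seq: "runs p T m T' \<Longrightarrow> runs q T' n T'' \<Longrightarrow> runs (p \<triangleright> q) T (m + n) T''"
  unfolding runs_def by (meson add_mono exec.Seq)

lemma runs_Branch:
  assumes "read_tape (T t) = s \<Longrightarrow> runs p T n T'" "read_tape (T t) \<noteq> s \<Longrightarrow> runs q T n T'"
  shows "runs (Branch t s p q) T (n + 2) T'"
proof (cases "read_tape (T t) = s")
  case True
  then obtain m where "m \<le> n" "exec p T m T'" using assms unfolding runs_def by auto
  then show ?thesis unfolding runs_def using True
    by (intro exI[of _ "1 + m"]) (use exec.Branch_eq[of T t s p m T' q] in auto)
next
  case False
  then obtain m where "m \<le> n" "exec q T m T'" using assms unfolding runs_def by auto
  then show ?thesis unfolding runs_def using False
    by (intro exI[of _ "1 + m + 1"]) (use exec.Branch_neq[of T t s q m T' p] in auto)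
qed

text \<open>The tapes after each round are given in advance as a sequence \<open>T\<close>; in the
  applications it is a closed form in the round number and plays the role of a loop
  invariant.\<close>

lemma runs_Until:
  assumes "\<And>j. j < n \<Longrightarrow> read_tape (T j t) \<noteq> s" "\<And>j. j < n \<Longrightarrow> runs p (T j) c (T (Suc j))"
    and "read_tape (T n t) = s"
  shows "runs (Until t s p) (T 0) (n * (c + 2) + 1) (T n)"
  using assms
proof (induction n arbitrary: T)
  case 0
  then show ?case unfolding runs_def using exec.Until_stop[of "T 0" t s p]
    by (intro exI[of _ 1]) auto
next
  case (Suc n)
  have "runs (Until t s p) (T (Suc 0)) (n * (c + 2) + 1) (T (Suc n))"
    using Suc.IH[of "\<lambda>j. T (Suc j)"] Suc.prems by simp
  then obtain m' where m': "m' \<le> n * (c + 2) + 1" "exec (Until t s p) (T (Suc 0)) m' (T (Suc n))"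
    unfolding runs_def by auto
  obtain m where m: "m \<le> c" "exec p (T 0) m (T (Suc 0))"
    using Suc.prems(2)[of 0] unfolding runs_def by auto
  have "exec (Until t s p) (T 0) (1 + m + 1 + m') (T (Suc n))"
    using exec.Until_loop[OF _ m(2) m'(2)] Suc.prems(1) by simp
  then show ?case unfolding runs_def using m(1) m'(1)
    by (intro exI[of _ "1 + m + 1 + m'"]) auto
qed

section \<open>A loop language on tapes\<close>

text \<open>Counters and arrays share one set of indices, the tape numbers; which tapes hold
  counters is fixed by a set \<open>V\<close>.\<close>

record store =
  nv :: "nat \<Rightarrow> nat"
  ar :: "nat \<Rightarrow> nat \<Rightarrow> nat"

definition set_nv :: "nat \<Rightarrow> nat \<Rightarrow> store \<Rightarrow> store" where
  "set_nv x i s = s\<lparr>nv := (nv s)(x := i)\<rparr>"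

definition set_ar :: "nat \<Rightarrow> nat \<Rightarrow> nat \<Rightarrow> store \<Rightarrow> store" where
  "set_ar A i c s = s\<lparr>ar := (ar s)(A := (ar s A)(i := c))\<rparr>"

lemma nv_set_nv [simp]: "nv (set_nv x i s) y = (if y = x then i else nv s y)"
  and ar_set_nv [simp]: "ar (set_nv x i s) = ar s"
  and nv_set_ar [simp]: "nv (set_ar A j c s) = nv s"
  and ar_set_ar [simp]: "ar (set_ar A j c s) B = (if B = A then (ar s A)(j := c) else ar s B)"
  by (simp_all add: set_nv_def set_ar_def)

lemma set_nv_same [simp]: "set_nv x (nv s x) s = s" "set_nv x i (set_nv x j s) = set_nv x i s"
  by (simp_all add: set_nv_def)

datatype cond = Less nat nat | Cell nat nat nat

datatype prog =
    Skip
  | Zero nat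
  | Inc nat
  | Write nat nat nat
  | Seq prog prog (infixr ";;" 60)
  | Ite cond prog prog
  | For nat prog

fun holds :: "cond \<Rightarrow> store \<Rightarrow> bool" where
  "holds (Less x y) s \<longleftrightarrow> nv s x < nv s y"
| "holds (Cell A x c) s \<longleftrightarrow> ar s A (nv s x) = c"

text \<open>\<open>N\<close> will be the length of the word on tape \<open>0\<close>. A loop leaves
  its counter at \<open>N\<close>, where the compiled loop stops.\<close>

fun sem :: "nat \<Rightarrow> prog \<Rightarrow> store \<Rightarrow> store" where
  "sem N Skip s = s"
| "sem N (Zero x) s = set_nv x 0 s"
| "sem N (Inc x) s = set_nv x (Suc (nv s x)) s"
| "sem N (Write A x c) s = set_ar A (nv s x) c s"
| "sem N (p ;; q) s = sem N q (sem N p s)"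
| "sem N (Ite b p q) s = (if holds b s then sem N p s else sem N q s)"
| "sem N (For x p) s = set_nv x N (fold (\<lambda>i s. sem N p (set_nv x i s)) [0..<N] s)"

fun mods :: "prog \<Rightarrow> nat set" where
  "mods Skip = {}"
| "mods (Zero x) = {x}"
| "mods (Inc x) = {x}"
| "mods (Write A x c) = {A}"
| "mods (p ;; q) = mods p \<union> mods q"
| "mods (Ite b p q) = mods p \<union> mods q"
| "mods (For x p) = insert x (mods p)"

fun cond_ok :: "nat set \<Rightarrow> nat \<Rightarrow> cond \<Rightarrow> bool" where
  "cond_ok V k (Less x y) \<longleftrightarrow> x \<in> V \<and> y \<in> V \<and> x < k \<and> y < k \<and> x \<noteq> y"
| "cond_ok V k (Cell A x c) \<longleftrightarrow> A \<notin> V \<and> x \<in> V \<and> A < k \<and> x < k"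

text \<open>Tape \<open>0\<close> holds the input whose length bounds every loop, so it must not be written.\<close>

fun prog_ok :: "nat set \<Rightarrow> nat \<Rightarrow> nat \<Rightarrow> prog \<Rightarrow> bool" where
  "prog_ok V k b Skip \<longleftrightarrow> True"
| "prog_ok V k b (Zero x) \<longleftrightarrow> x \<in> V \<and> x < k"
| "prog_ok V k b (Inc x) \<longleftrightarrow> x \<in> V \<and> x < k"
| "prog_ok V k b (Write A x c) \<longleftrightarrow> A \<noteq> 0 \<and> A \<notin> V \<and> x \<in> V \<and> A < k \<and> x < k \<and> c < b"
| "prog_ok V k b (p ;; q) \<longleftrightarrow> prog_ok V k b p \<and> prog_ok V k b q"
| "prog_ok V k b (Ite c p q) \<longleftrightarrow> cond_ok V k c \<and> prog_ok V k b p \<and> prog_ok V k b q"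
| "prog_ok V k b (For x p) \<longleftrightarrow> x \<in> V \<and> x < k \<and> x \<notin> mods p \<and> prog_ok V k b p"

lemma sem_frame: "t \<notin> mods p \<Longrightarrow> nv (sem N p s) t = nv s t \<and> ar (sem N p s) t = ar s t"
proof (induction p arbitrary: s)
  case (For x p)
  have "nv (fold (\<lambda>i s. sem N p (set_nv x i s)) js s) t = nv s t \<and>
      ar (fold (\<lambda>i s. sem N p (set_nv x i s)) js s) t = ar s t" for js
    by (induction js arbitrary: s) (use For in auto)
  then show ?case using For.prems by auto
qed auto

lemma nv_frame: "t \<notin> mods p \<Longrightarrow> nv (sem N p s) t = nv s t"
  and ar_frame: "t \<notin> mods p \<Longrightarrow> ar (sem N p s) t = ar s t"
  by (simp_all add: sem_frame)

lemma zero_notin_mods: "prog_ok V k b p \<Longrightarrow> 0 \<notin> V \<Longrightarrow> 0 \<notin> mods p"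
  by (induction p) (auto intro!: gr0I)

section \<open>Compilation to tape programs\<close>

definition cells :: "nat set \<Rightarrow> store \<Rightarrow> nat \<Rightarrow> nat \<Rightarrow> nat" where
  "cells V s t j = (if t \<in> V then (if j < nv s t then 1 else 0) else ar s t j)"

text \<open>The blank at cell \<open>-1\<close> stops a head that walks back.\<close>

definition tape_of :: "nat set \<Rightarrow> store \<Rightarrow> nat \<Rightarrow> tape" where
  "tape_of V s t = ((\<lambda>i. if i < 0 then 0 else cells V s t (nat i)), 0)"

definition heads :: "nat set \<Rightarrow> int \<Rightarrow> (nat \<Rightarrow> tape) \<Rightarrow> nat \<Rightarrow> tape" where
  "heads S h T = (\<lambda>t. if t \<in> S then (fst (T t), h) else T t)"

text \<open>Array access without addresses: while one head walks over the unary counter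
  \<open>x\<close>, the head on \<open>A\<close> walks along and stops at the cell with that
  index.\<close>

definition fwd :: "nat \<Rightarrow> nat \<Rightarrow> tprog" where
  "fwd x A = Until x 0 (Do x None Go_Right \<triangleright> Do A None Go_Right)"

text \<open>After \<open>fwd\<close> the head on \<open>x\<close> already stands on a blank, so one
  step left precedes the loop; the loop runs on to cell \<open>-1\<close>, which the final step
  right corrects.\<close>

definition rewind :: "nat \<Rightarrow> nat \<Rightarrow> tprog" where
  "rewind x A = (Do x None Go_Left \<triangleright> Do A None Go_Left) \<triangleright>
     Until x 0 (Do x None Go_Left \<triangleright> Do A None Go_Left) \<triangleright>
     Do x None Go_Right \<triangleright> Do A None Go_Right"

text \<open>A comparison is a lookup: in unary, cell \<open>nv s x\<close> of the counter
  \<open>y\<close> holds \<open>1\<close> exactly when \<open>x\<close> is smaller. The heads are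
  rewound inside both alternatives because the branch has to read the cell first.\<close>

fun compile_branch :: "cond \<Rightarrow> tprog \<Rightarrow> tprog \<Rightarrow> tprog" where
  "compile_branch (Less x y) p q = fwd x y \<triangleright> Branch y 1 (rewind x y \<triangleright> p) (rewind x y \<triangleright> q)"
| "compile_branch (Cell A x c) p q = fwd x A \<triangleright> Branch A c (rewind x A \<triangleright> p) (rewind x A \<triangleright> q)"

definition compile_Zero :: "nat \<Rightarrow> tprog" where
  "compile_Zero x = Until x 0 (Do x None Go_Right) \<triangleright> Do x None Go_Left \<triangleright>
     Until x 0 (Do x (Some 0) Go_Left) \<triangleright> Do x None Go_Right"

definition compile_Inc :: "nat \<Rightarrow> tprog" where
  "compile_Inc x = Until x 0 (Do x None Go_Right) \<triangleright> Do x (Some 1) Go_Left \<triangleright>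
     Until x 0 (Do x None Go_Left) \<triangleright> Do x None Go_Right"

text \<open>A loop keeps no bound of its own: it stops when the cell of tape \<open>0\<close> with
  index \<open>x\<close> is blank, that is, after one round for every input symbol.\<close>

fun compile :: "prog \<Rightarrow> tprog" where
  "compile Skip = Nop"
| "compile (Zero x) = compile_Zero x"
| "compile (Inc x) = compile_Inc x"
| "compile (Write A x c) = fwd x A \<triangleright> Do A (Some c) Stay \<triangleright> rewind x A"
| "compile (p ;; q) = compile p \<triangleright> compile q"
| "compile (Ite b p q) = compile_branch b (compile p) (compile q)"
| "compile (For x p) = compile_Zero x \<triangleright> fwd x 0 \<triangleright>
     Until 0 0 (rewind x 0 \<triangleright> compile p \<triangleright> compile_Inc x \<triangleright> fwd x 0) \<triangleright> rewind x 0"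

lemma compile_ok: "prog_ok V k b p \<Longrightarrow> 0 < k \<Longrightarrow> 1 < b \<Longrightarrow> tprog_ok k b (compile p)"
proof (induction p)
  case (Ite c p q)
  then show ?case by (cases c) (auto simp: fwd_def rewind_def)
qed (auto simp: fwd_def rewind_def compile_Zero_def compile_Inc_def)

lemma heads_0 [simp]: "heads S 0 (tape_of V s) = tape_of V s"
  by (auto simp: heads_def tape_of_def)

lemma act_heads1: "act x None m (heads {x} h T) = heads {x} (move_head m h) T"
  by (auto simp: act_def heads_def fun_eq_iff)

lemma act_heads2:
  "x \<noteq> A \<Longrightarrow> act A None m (act x None m (heads {x, A} h T)) = heads {x, A} (move_head m h) T"
  by (auto simp: act_def heads_def fun_eq_iff)

lemma read_heads: "t \<in> S \<Longrightarrow> read_tape (heads S h T t) = fst (T t) h"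
  by (simp add: heads_def)

lemma fst_tape_of: "fst (tape_of V s t) i = (if i < 0 then 0 else cells V s t (nat i))"
  by (simp add: tape_of_def)

lemma cells_var: "x \<in> V \<Longrightarrow> cells V s x j = (if j < nv s x then 1 else 0)"
  by (simp add: cells_def)

lemma runs_SeqI:
  "runs p T m T' \<Longrightarrow> runs q T' n T'' \<Longrightarrow> m + n \<le> l \<Longrightarrow> runs (p \<triangleright> q) T l T''"
  by (rule runs_mono[OF runs_Seq])

lemma runs_move1: "runs (Do x None m) (heads {x} h T) 1 (heads {x} (move_head m h) T)"
  by (rule runs_Do) (rule act_heads1)

lemma runs_move2:
  assumes "x \<noteq> A"
  shows "runs (Do x None m \<triangleright> Do A None m) (heads {x, A} h T) 2 (heads {x, A} (move_head m h) T)"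
  by (rule runs_SeqI[OF runs_Do[OF refl] runs_Do[OF act_heads2[OF assms]]]) simp

lemma runs_fwd:
  assumes "x \<in> V" "x \<noteq> A"
  shows "runs (fwd x A) (tape_of V s) (4 * nv s x + 1) (heads {x, A} (int (nv s x)) (tape_of V s))"
proof -
  have "runs (fwd x A) (heads {x, A} (int 0) (tape_of V s)) (nv s x * (2 + 2) + 1)
      (heads {x, A} (int (nv s x)) (tape_of V s))"
    unfolding fwd_def
  proof (rule runs_Until[where T = "\<lambda>j. heads {x, A} (int j) (tape_of V s)"])
    fix j
    show "runs (Do x None Go_Right \<triangleright> Do A None Go_Right) (heads {x, A} (int j) (tape_of V s)) 2
        (heads {x, A} (int (Suc j)) (tape_of V s))"
      using runs_move2[OF assms(2), of Go_Right "int j" "tape_of V s"] by (simp add: add.commute)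
  qed (use assms(1) in \<open>auto simp: read_heads fst_tape_of cells_var\<close>)
  then show ?thesis by (simp add: mult.commute)
qed

lemma runs_rewind:
  assumes "x \<in> V" "x \<noteq> A"
  shows "runs (rewind x A) (heads {x, A} (int (nv s x)) (tape_of V s)) (4 * nv s x + 5) (tape_of V s)"
proof -
  let ?n = "nv s x" and ?T = "tape_of V s"
  let ?H = "\<lambda>h. heads {x, A} h ?T"
  note mv = runs_move2[OF assms(2), of _ _ ?T]
  have "runs (Until x 0 (Do x None Go_Left \<triangleright> Do A None Go_Left)) (?H (int ?n - 1 - int 0))
      (?n * (2 + 2) + 1) (?H (int ?n - 1 - int ?n))"
  proof (rule runs_Until[where T = "\<lambda>j. ?H (int ?n - 1 - int j)"])
    fix j
    show "runs (Do x None Go_Left \<triangleright> Do A None Go_Left) (?H (int ?n - 1 - int j)) 2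
        (?H (int ?n - 1 - int (Suc j)))"
      using mv[of Go_Left "int ?n - 1 - int j"] by (simp add: algebra_simps)
  qed (use assms(1) in \<open>auto simp: read_heads fst_tape_of cells_var\<close>)
  then have "runs (Until x 0 (Do x None Go_Left \<triangleright> Do A None Go_Left)) (?H (int ?n - 1))
      (4 * ?n + 1) (?H (- 1))"
    by (simp add: mult.commute)
  moreover have "runs (Do x None Go_Left \<triangleright> Do A None Go_Left) (?H (int ?n)) 2 (?H (int ?n - 1))"
    using mv[of Go_Left "int ?n"] by simp
  moreover have "runs (Do x None Go_Right \<triangleright> Do A None Go_Right) (?H (- 1)) 2 ?T"
    using mv[of Go_Right "- 1"] by simp
  ultimately show ?thesis unfolding rewind_def
    by (intro runs_SeqI[OF _ runs_SeqI]) auto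
qed

lemma runs_Zero:
  assumes "x \<in> V"
  shows "runs (compile_Zero x) (tape_of V s) (6 * nv s x + 4) (tape_of V (set_nv x 0 s))"
proof -
  let ?n = "nv s x" and ?H = "\<lambda>h s. heads {x} h (tape_of V s)"
  have 1: "runs (Until x 0 (Do x None Go_Right)) (?H (int 0) s) (?n * (1 + 2) + 1) (?H (int ?n) s)"
  proof (rule runs_Until[where T = "\<lambda>j. ?H (int j) s"])
    fix j
    show "runs (Do x None Go_Right) (?H (int j) s) 1 (?H (int (Suc j)) s)"
      using runs_move1[of x Go_Right "int j" "tape_of V s"] by (simp add: add.commute)
  qed (use assms in \<open>auto simp: read_heads fst_tape_of cells_var\<close>)
  have 2: "runs (Do x None Go_Left) (?H (int ?n) s) 1 (?H (int ?n - 1) s)"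
    using runs_move1[of x Go_Left "int ?n" "tape_of V s"] by simp
  \<comment> \<open>Erasing from the right keeps the tape a unary counter, so the situation after
    \<open>j\<close> rounds is described by the store with counter \<open>?n - j\<close>.\<close>
  have 3: "runs (Until x 0 (Do x (Some 0) Go_Left)) (?H (int ?n - 1 - int 0) (set_nv x (?n - 0) s))
      (?n * (1 + 2) + 1) (?H (int ?n - 1 - int ?n) (set_nv x (?n - ?n) s))"
  proof (rule runs_Until[where T = "\<lambda>j. ?H (int ?n - 1 - int j) (set_nv x (?n - j) s)"])
    fix j assume j: "j < ?n"
    show "runs (Do x (Some 0) Go_Left) (?H (int ?n - 1 - int j) (set_nv x (?n - j) s)) 1
        (?H (int ?n - 1 - int (Suc j)) (set_nv x (?n - Suc j) s))"
      by (rule runs_Do)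
        (use j assms in \<open>auto simp: act_def heads_def tape_of_def cells_def fun_eq_iff\<close>)
  qed (use assms in \<open>auto simp: read_heads fst_tape_of cells_var\<close>)
  have 4: "runs (Do x None Go_Right) (?H (- 1) (set_nv x 0 s)) 1 (tape_of V (set_nv x 0 s))"
    using runs_move1[of x Go_Right "- 1" "tape_of V (set_nv x 0 s)"] by simp
  from 3 have 3: "runs (Until x 0 (Do x (Some 0) Go_Left)) (?H (int ?n - 1) s) (3 * ?n + 1)
      (?H (- 1) (set_nv x 0 s))"
    by (auto elim: runs_mono)
  from 1 have 1: "runs (Until x 0 (Do x None Go_Right)) (tape_of V s) (3 * ?n + 1) (?H (int ?n) s)"
    by (auto elim: runs_mono)
  show ?thesis unfolding compile_Zero_def
    by (rule runs_SeqI[OF 1 runs_SeqI[OF 2 runs_SeqI[OF 3 4 order.refl] order.refl]]) simp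
qed

lemma runs_Inc:
  assumes "x \<in> V"
  shows "runs (compile_Inc x) (tape_of V s) (6 * nv s x + 4) (tape_of V (set_nv x (Suc (nv s x)) s))"
proof -
  let ?n = "nv s x" and ?H = "\<lambda>h s. heads {x} h (tape_of V s)"
  let ?s = "set_nv x (Suc (nv s x)) s"
  have 1: "runs (Until x 0 (Do x None Go_Right)) (?H (int 0) s) (?n * (1 + 2) + 1) (?H (int ?n) s)"
  proof (rule runs_Until[where T = "\<lambda>j. ?H (int j) s"])
    fix j
    show "runs (Do x None Go_Right) (?H (int j) s) 1 (?H (int (Suc j)) s)"
      using runs_move1[of x Go_Right "int j" "tape_of V s"] by (simp add: add.commute)
  qed (use assms in \<open>auto simp: read_heads fst_tape_of cells_var\<close>)
  have 2: "runs (Do x (Some 1) Go_Left) (?H (int ?n) s) 1 (?H (int ?n - 1) ?s)"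
    by (rule runs_Do) (use assms in \<open>auto simp: act_def heads_def tape_of_def cells_def fun_eq_iff\<close>)
  have 3: "runs (Until x 0 (Do x None Go_Left)) (?H (int ?n - 1 - int 0) ?s)
      (?n * (1 + 2) + 1) (?H (int ?n - 1 - int ?n) ?s)"
  proof (rule runs_Until[where T = "\<lambda>j. ?H (int ?n - 1 - int j) ?s"])
    fix j
    show "runs (Do x None Go_Left) (?H (int ?n - 1 - int j) ?s) 1 (?H (int ?n - 1 - int (Suc j)) ?s)"
      using runs_move1[of x Go_Left "int ?n - 1 - int j" "tape_of V ?s"] by (simp add: algebra_simps)
  qed (use assms in \<open>auto simp: read_heads fst_tape_of cells_var\<close>)
  have 4: "runs (Do x None Go_Right) (?H (int ?n - 1 - int ?n) ?s) 1 (tape_of V ?s)"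
    using runs_move1[of x Go_Right "- 1" "tape_of V ?s"] by simp
  from 3 have 3: "runs (Until x 0 (Do x None Go_Left)) (?H (int ?n - 1) ?s) (3 * ?n + 1)
      (?H (int ?n - 1 - int ?n) ?s)"
    by (auto elim: runs_mono)
  from 1 have 1: "runs (Until x 0 (Do x None Go_Right)) (tape_of V s) (3 * ?n + 1) (?H (int ?n) s)"
    by (auto elim: runs_mono)
  show ?thesis unfolding compile_Inc_def
    by (rule runs_SeqI[OF 1 runs_SeqI[OF 2 runs_SeqI[OF 3 4 order.refl] order.refl]]) simp
qed

lemma runs_Write:
  assumes "x \<in> V" "A \<notin> V"
  shows "runs (Do A (Some c) Stay) (heads {x, A} (int (nv s x)) (tape_of V s)) 1
    (heads {x, A} (int (nv s x)) (tape_of V (set_ar A (nv s x) c s)))"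
  by (rule runs_Do) (use assms in \<open>auto simp: act_def heads_def tape_of_def cells_def fun_eq_iff\<close>)

text \<open>Both tests get a common form, so that conditionals are treated once; a comparison looks
  for the symbol \<open>1\<close>.\<close>

lemma cell_conds:
  assumes "cond_ok V k b"
  obtains x A c where "x \<in> V" "x \<noteq> A" "compile_branch b = (\<lambda>p q. fwd x A \<triangleright> Branch A c (rewind x A \<triangleright> p) (rewind x A \<triangleright> q))"
    "\<And>s. holds b s \<longleftrightarrow> cells V s A (nv s x) = c"
proof (cases b)
  case (Less x y)
  then show ?thesis using assms that[of x y 1] by (auto simp: cells_def fun_eq_iff)
next
  case (Cell A x c)
  then show ?thesis using assms that[of x A c] by (auto simp: cells_def fun_eq_iff)
qed

section \<open>Polynomial bounds on counters and running times\<close>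

fun incs :: "prog \<Rightarrow> nat poly" where
  "incs Skip = 0"
| "incs (Zero x) = 0"
| "incs (Inc x) = 1"
| "incs (Write A x c) = 0"
| "incs (p ;; q) = incs p + incs q"
| "incs (Ite b p q) = incs p + incs q"
| "incs (For x p) = monom 1 1 * (incs p + 1)"

definition bounded :: "nat \<Rightarrow> store \<Rightarrow> bool" where
  "bounded B s \<longleftrightarrow> (\<forall>x. nv s x \<le> B)"

lemma bounded_mono: "bounded B s \<Longrightarrow> B \<le> B' \<Longrightarrow> bounded B' s"
  unfolding bounded_def using le_trans by blast

lemma bounded_set_nv: "bounded B s \<Longrightarrow> i \<le> B \<Longrightarrow> bounded B (set_nv x i s)"
  unfolding bounded_def by simp

text \<open>Counters grow by \<open>Inc\<close> and by loops, whose own counter ends at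
  \<open>N\<close>. The latter is the summand \<open>1\<close> in \<open>incs (For x p)\<close>; the
  other summand counts the body \<open>N\<close> times.\<close>

lemma bounded_sem: "bounded B s \<Longrightarrow> bounded (B + poly (incs p) N) (sem N p s)"
proof (induction p arbitrary: B s)
  case (Seq p q)
  then show ?case by (fastforce simp: add.assoc)
next
  case (Ite b p q)
  then have "bounded (B + poly (incs p) N) (sem N p s)" "bounded (B + poly (incs q) N) (sem N q s)"
    by auto
  then show ?case by (auto elim: bounded_mono)
next
  case (For x p)
  have "bounded (B + N + m * poly (incs p) N)
      (fold (\<lambda>i s. sem N p (set_nv x i s)) [0..<m] s)" if "m \<le> N" for m
    using that
  proof (induction m)
    case 0
    then show ?case using For.prems by (auto intro: bounded_mono)
  next
    case (Suc m)
    have "bounded (B + N + m * poly (incs p) N)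
        (set_nv x m (fold (\<lambda>i s. sem N p (set_nv x i s)) [0..<m] s))"
      using Suc.prems by (intro bounded_set_nv Suc.IH) auto
    from For.IH[OF this] show ?case by (simp add: algebra_simps)
  qed
  from bounded_set_nv[OF this[of N], of N x] show ?case
    by (simp add: poly_monom algebra_simps)
qed (auto simp: bounded_def le_SucI)

text \<open>A factor per unit of \<open>B + 1\<close>, where \<open>B\<close> bounds the counters at
  the start, because walking over a counter takes time linear in \<open>B\<close>. The second part
  of a sequence starts with the bound \<open>B + incs p\<close>, hence its factor
  \<open>incs p + 1\<close>. The constants are generous.\<close>

fun time :: "prog \<Rightarrow> nat poly" where
  "time Skip = 0"
| "time (Zero x) = 6"
| "time (Inc x) = 6"
| "time (Write A x c) = 10"
| "time (p ;; q) = time p + (incs p + 1) * time q"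
| "time (Ite b p q) = 12 + time p + time q"
| "time (For x p) = 13 + monom 4 1 + monom 1 1 * (time p + 17) * (incs (For x p) + 1)"

lemma runs_compile:
  assumes "prog_ok V k b p" "0 \<notin> V" "\<And>j. ar s 0 j \<noteq> 0 \<longleftrightarrow> j < N" "bounded B s"
  shows "runs (compile p) (tape_of V s) (poly (time p) N * (B + 1)) (tape_of V (sem N p s))"
  using assms
proof (induction p arbitrary: s B)
  case Skip
  then show ?case using runs_Nop by simp
next
  case (Zero x)
  then have "nv s x \<le> B" by (simp add: bounded_def)
  then show ?case using runs_mono[OF runs_Zero[of x V s], of "6 * (B + 1)"] Zero by simp
next
  case (Inc x)
  then have "nv s x \<le> B" by (simp add: bounded_def)
  then show ?case using runs_mono[OF runs_Inc[of x V s], of "6 * (B + 1)"] Inc by simp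
next
  case (Write A x c)
  let ?s = "set_ar A (nv s x) c s"
  have B: "nv s x \<le> B" using Write by (simp add: bounded_def)
  have xA: "x \<in> V" "x \<noteq> A" "A \<notin> V" using Write.prems by auto
  have "runs (rewind x A) (heads {x, A} (int (nv s x)) (tape_of V ?s)) (4 * nv s x + 5) (tape_of V ?s)"
    using runs_rewind[OF xA(1,2), of ?s] by simp
  from runs_SeqI[OF runs_fwd[OF xA(1,2)] runs_SeqI[OF runs_Write[OF xA(1,3)] this order.refl]]
  show ?case using B by simp
next
  case (Seq p q)
  have "runs (compile q) (tape_of V (sem N p s)) (poly (time q) N * (B + poly (incs p) N + 1))
      (tape_of V (sem N q (sem N p s)))"
    using Seq.prems zero_notin_mods[of V k b p]
    by (intro Seq.IH(2)) (auto simp: ar_frame bounded_sem)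
  moreover have "runs (compile p) (tape_of V s) (poly (time p) N * (B + 1)) (tape_of V (sem N p s))"
    using Seq.prems by (intro Seq.IH(1)) auto
  ultimately have "runs (compile (p ;; q)) (tape_of V s) (poly (time p) N * (B + 1) +
      poly (time q) N * (B + poly (incs p) N + 1)) (tape_of V (sem N (p ;; q) s))"
    using runs_Seq by simp
  then show ?case by (rule runs_mono) (simp add: algebra_simps)
next
  case (Ite c p q)
  have "cond_ok V k c" using Ite.prems by simp
  then obtain x A a where c: "x \<in> V" "x \<noteq> A"
      "compile_branch c = (\<lambda>p q. fwd x A \<triangleright> Branch A a (rewind x A \<triangleright> p) (rewind x A \<triangleright> q))"
      "\<And>s. holds c s \<longleftrightarrow> cells V s A (nv s x) = a"
    by (rule cell_conds) blast
  have B: "nv s x \<le> B" using Ite by (simp add: bounded_def)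
  let ?H = "heads {x, A} (int (nv s x)) (tape_of V s)"
  have rd: "read_tape (?H A) = a \<longleftrightarrow> holds c s"
    by (simp add: read_heads fst_tape_of c)
  have p: "runs (compile p) (tape_of V s) (poly (time p) N * (B + 1)) (tape_of V (sem N p s))"
    using Ite.prems by (intro Ite.IH(1)) auto
  have q: "runs (compile q) (tape_of V s) (poly (time q) N * (B + 1)) (tape_of V (sem N q s))"
    using Ite.prems by (intro Ite.IH(2)) auto
  have "runs (Branch A a (rewind x A \<triangleright> compile p) (rewind x A \<triangleright> compile q)) ?H
     (4 * nv s x + 5 + (poly (time p) N + poly (time q) N) * (B + 1) + 2) (tape_of V (sem N (Ite c p q) s))"
  proof (rule runs_Branch; unfold rd)
    assume "holds c s"
    then show "runs (rewind x A \<triangleright> compile p) ?H (4 * nv s x + 5 + (poly (time p) N + poly (time q) N) * (B + 1))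
        (tape_of V (sem N (Ite c p q) s))"
      using runs_SeqI[OF runs_rewind[OF c(1,2)] p] by (simp add: add_mult_distrib)
  next
    assume "\<not> holds c s"
    then show "runs (rewind x A \<triangleright> compile q) ?H (4 * nv s x + 5 + (poly (time p) N + poly (time q) N) * (B + 1))
        (tape_of V (sem N (Ite c p q) s))"
      using runs_SeqI[OF runs_rewind[OF c(1,2)] q] by (simp add: add_mult_distrib)
  qed
  from runs_SeqI[OF runs_fwd[OF c(1,2)] this]
  show ?case using B by (simp add: c(3) algebra_simps)
next
  case (For x p)
  have x: "x \<in> V" "x \<noteq> 0" "x \<notin> mods p" and p: "prog_ok V k b p" using For.prems(1,2) by (auto intro!: gr0I)
  have m0: "0 \<notin> mods p" using zero_notin_mods[OF p For.prems(2)] .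
  \<comment> \<open>\<open>S m\<close> below is the store at the beginning of round
    \<open>m\<close>. The semantics sets the counter anew in each round, whereas the compiled code
    increments it at the end; both agree since the body does not modify \<open>x\<close>.\<close>
  define G where "G m = fold (\<lambda>i s. sem N p (set_nv x i s)) [0..<m] s" for m
  define S where "S m = set_nv x m (G m)" for m
  have S_Suc: "S (Suc m) = set_nv x (Suc m) (sem N p (S m))" for m
    by (simp add: S_def G_def)
  have S_ar: "ar (S m) 0 = ar s 0" for m
    by (induction m) (simp_all add: S_Suc ar_frame[OF m0], simp add: S_def G_def)
  define I where "I = poly (incs p) N"
  have S_bd': "bounded (B + N + m * I) (S m)" if "m \<le> N" for m
    using that
  proof (induction m)
    case 0
    have "bounded (B + N) s" using For.prems(4) by (auto elim: bounded_mono)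
    then show ?case by (auto simp: S_def G_def intro!: bounded_set_nv)
  next
    case (Suc m)
    then have "bounded (B + N + m * I + I) (sem N p (S m))"
      unfolding I_def by (intro bounded_sem) auto
    then have "bounded (B + N + Suc m * I) (sem N p (S m))" by (simp add: algebra_simps)
    then show ?case unfolding S_Suc using Suc.prems by (intro bounded_set_nv) auto
  qed
  \<comment> \<open>Covers the start bound, the loop counter and the growth in all \<open>N\<close>
    rounds.\<close>
  define B' where "B' = B + N * (I + 1)"
  have S_bd: "bounded B' (S m)" "bounded B' (sem N p (S m))" if "m < N" for m
  proof -
    have "(m + 1) * I \<le> N * I" using that by (intro mult_right_mono) auto
    then have *: "B + N + m * I + I \<le> B'" by (simp add: B'_def algebra_simps)
    then show "bounded B' (S m)" using S_bd'[of m] that by (auto intro: bounded_mono)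
    show "bounded B' (sem N p (S m))"
      using bounded_sem[OF S_bd'[of m], of p N] that * bounded_mono by (fastforce simp: I_def)
  qed
  have S_nv: "nv (S m) x = m" for m by (simp add: S_def)
  let ?H = "\<lambda>m. heads {x, 0} (int m) (tape_of V (S m))"
  \<comment> \<open>Rewinding, incrementing and walking forward in round \<open>j\<close> take
    \<open>14 * j + 14\<close> steps together, which \<open>15 * (B' + 1)\<close> absorbs. Two
    further steps per round for test and jump give the \<open>17\<close> in
    \<open>time\<close>.\<close>
  define c where "c = (poly (time p) N + 15) * (B' + 1)"
  have loop: "runs (Until 0 0 (rewind x 0 \<triangleright> compile p \<triangleright> compile_Inc x \<triangleright> fwd x 0)) (?H 0)
      (N * (c + 2) + 1) (?H N)"
  proof (rule runs_Until[where T = ?H])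
    fix j assume j: "j < N"
    have r1: "runs (rewind x 0) (?H j) (4 * j + 5) (tape_of V (S j))"
      using runs_rewind[OF x(1,2), of "S j"] by (simp add: S_nv)
    have r2: "runs (compile p) (tape_of V (S j)) (poly (time p) N * (B' + 1)) (tape_of V (sem N p (S j)))"
      using p For.prems(2) S_ar For.prems(3) S_bd(1)[OF j] by (intro For.IH) auto
    have "nv (sem N p (S j)) x = j" using nv_frame[OF x(3)] by (simp add: S_nv)
    then have r3: "runs (compile_Inc x) (tape_of V (sem N p (S j))) (6 * j + 4) (tape_of V (S (Suc j)))"
      using runs_Inc[OF x(1), of "sem N p (S j)"] by (simp add: S_Suc)
    have r4: "runs (fwd x 0) (tape_of V (S (Suc j))) (4 * Suc j + 1) (?H (Suc j))"
      using runs_fwd[OF x(1,2), of "S (Suc j)"] by (simp add: S_nv)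
    have "j + 1 \<le> B'" using j by (simp add: B'_def)
    then have "4 * j + 5 + (W + (6 * j + 4 + (4 * Suc j + 1))) \<le> W + 15 * (B' + 1)" for W
      by simp
    from this[of "poly (time p) N * (B' + 1)"]
    show "runs (rewind x 0 \<triangleright> compile p \<triangleright> compile_Inc x \<triangleright> fwd x 0) (?H j) c (?H (Suc j))"
      by (intro runs_SeqI[OF r1 runs_SeqI[OF r2 runs_SeqI[OF r3 r4 order.refl] order.refl]])
        (simp only: c_def add_mult_distrib[of _ 15])
    show "read_tape (?H j 0) \<noteq> 0"
      using j For.prems(2,3) by (simp add: read_heads fst_tape_of cells_def S_ar)
  next
    show "read_tape (?H N 0) = 0"
      using For.prems(2) For.prems(3)[of N] by (simp add: read_heads fst_tape_of cells_def S_ar)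
  qed
  have S0: "S 0 = set_nv x 0 s" by (simp add: S_def G_def)
  have r1: "runs (compile_Zero x) (tape_of V s) (6 * nv s x + 4) (tape_of V (S 0))"
    using runs_Zero[OF x(1)] by (simp add: S0)
  have r2: "runs (fwd x 0) (tape_of V (S 0)) 1 (?H 0)"
    using runs_fwd[OF x(1,2), of "S 0"] by (simp add: S_nv)
  have r3: "runs (rewind x 0) (?H N) (4 * N + 5) (tape_of V (S N))"
    using runs_rewind[OF x(1,2), of "S N"] by (simp add: S_nv)
  have SN: "S N = sem N (For x p) s" by (simp add: S_def G_def)
  have nvB: "nv s x \<le> B" using For.prems by (simp add: bounded_def)
  have "N * (c + 2) \<le> N * ((poly (time p) N + 17) * (B' + 1))"
    by (intro mult_left_mono) (simp_all add: c_def algebra_simps)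
  also have "\<dots> \<le> N * ((poly (time p) N + 17) * ((N * (I + 1) + 1) * (B + 1)))"
    by (intro mult_left_mono) (simp_all add: B'_def algebra_simps)
  finally have *: "N * (c + 2) \<le> N * (poly (time p) N + 17) * (N * (I + 1) + 1) * (B + 1)"
    by (simp only: mult.assoc)
  have tm: "poly (time (For x p)) N = 13 + 4 * N + N * (poly (time p) N + 17) * (N * (I + 1) + 1)"
    by (simp add: poly_monom I_def)
  have "runs (compile (For x p)) (tape_of V s)
      (6 * nv s x + 4 + (1 + (N * (c + 2) + 1 + (4 * N + 5)))) (tape_of V (S N))"
    unfolding compile.simps
    by (rule runs_SeqI[OF r1 runs_SeqI[OF r2 runs_SeqI[OF loop r3 order.refl] order.refl] order.refl])
  moreover have "6 * nv s x + 4 + (1 + (N * (c + 2) + 1 + (4 * N + 5))) \<le> poly (time (For x p)) N * (B + 1)"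
  proof -
    have "6 * nv s x + 4 + (1 + (K + 1 + (4 * N + 5))) \<le> 13 * (B + 1) + 4 * N * (B + 1) + L"
      if "K \<le> L" for K L
      using that nvB by simp
    from this[OF *] show ?thesis by (simp only: tm add_mult_distrib)
  qed
  ultimately show ?case unfolding SN by (rule runs_mono)
qed

section \<open>From loop programs to polynomial-time computability\<close>

definition input_store :: "nat list list \<Rightarrow> store" where
  "input_store ws =
     \<lparr>nv = (\<lambda>x. 0), ar = (\<lambda>A j. if A < length ws \<and> j < length (ws ! A) then ws ! A ! j else 0)\<rparr>"

definition word_at :: "(nat \<Rightarrow> nat) \<Rightarrow> nat list \<Rightarrow> bool" where
  "word_at a w \<longleftrightarrow> (\<forall>j<length w. a j = w ! j) \<and> a (length w) = 0"

lemma poly_nat_mono: "m \<le> n \<Longrightarrow> poly p m \<le> poly p (n :: nat)" for p :: "nat poly"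
  by (induction p) (auto intro: mult_mono)

lemma tape_of_input:
  assumes "length ws \<le> k" "V \<inter> {..<length ws} = {}"
  shows "map (tape_of V (input_store ws)) [0..<k] =
    map word_tape ws @ replicate (k - length ws) (word_tape [])"
proof (rule nth_equalityI)
  fix i assume "i < length (map (tape_of V (input_store ws)) [0..<k])"
  then have i: "i < k" by simp
  show "map (tape_of V (input_store ws)) [0..<k] ! i =
      (map word_tape ws @ replicate (k - length ws) (word_tape [])) ! i"
  proof (cases "i < length ws")
    case True
    then have "i \<notin> V" using assms by auto
    then show ?thesis using True i
      by (auto simp: nth_append tape_of_def cells_def input_store_def word_tape_def fun_eq_iff)
  next
    case False
    then show ?thesis using i
      by (auto simp: nth_append tape_of_def cells_def input_store_def word_tape_def fun_eq_iff)
  qed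
qed (use assms in simp)

text \<open>All counters start at \<open>0\<close>, so \<open>time p\<close> at the length of the
  first word bounds the run, and this length is at most the total input length. The last tape has to
  be an array because the output is read off it.\<close>

theorem poly_time_on_prog:
  assumes p: "prog_ok V k b p" and V: "0 \<notin> V" "k - 1 \<notin> V" and b: "1 < b"
    and nonempty: "\<And>x. x \<in> D \<Longrightarrow> enc x \<noteq> []"
    and len: "\<And>x. x \<in> D \<Longrightarrow> length (enc x) < k \<and> V \<inter> {..<length (enc x)} = {}"
    and syms: "\<And>x w s. x \<in> D \<Longrightarrow> w \<in> set (enc x) \<Longrightarrow> s \<in> set w \<Longrightarrow> 0 < s \<and> s < b"
    and out: "\<And>x. x \<in> D \<Longrightarrow> 0 \<notin> set (enc' (f x)) \<and>
      word_at (ar (sem (length (hd (enc x))) p (input_store (enc x))) (k - 1)) (enc' (f x))"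
  shows "poly_time_on D enc enc' f"
proof (cases "D = {}")
  case False
  then have k: "0 < k" using len by fastforce
  let ?M = "code_machine k b (assemble 0 (compile p))"
  have ok: "tprog_ok k b (compile p)" using compile_ok[OF p k b] .
  have "valid_machine ?M"
    using assemble_ok[OF ok, of _ 0] k b by (intro valid_code_machine) auto
  moreover have "computes_within ?M (enc x) (poly (time p) (sum_list (map length (enc x)))) (enc' (f x))"
    if x: "x \<in> D" for x
  proof -
    let ?ws = "enc x" and ?N = "length (hd (enc x))"
    let ?s = "input_store ?ws"
    have hd: "hd ?ws = ?ws ! 0" using nonempty[OF x] by (simp add: hd_conv_nth)
    have "runs (compile p) (tape_of V ?s) (poly (time p) ?N * (0 + 1)) (tape_of V (sem ?N p ?s))"
    proof (rule runs_compile[OF p V(1)])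
      show "ar ?s 0 j \<noteq> 0 \<longleftrightarrow> j < ?N" for j
        using syms[OF x, of "?ws ! 0" "?ws ! 0 ! j"] nonempty[OF x]
        by (auto simp: input_store_def hd)
    qed (simp add: bounded_def input_store_def)
    from runs_code_machine[OF this ok] obtain t where t: "t \<le> poly (time p) ?N"
      "(step ?M ^^ t) (0, map (tape_of V ?s) [0..<k]) =
        (code_size (compile p), map (tape_of V (sem ?N p ?s)) [0..<k])"
      by auto
    have "?N \<le> sum_list (map length ?ws)"
      using nonempty[OF x] by (cases ?ws) auto
    then have "t \<le> poly (time p) (sum_list (map length ?ws))"
      using t(1) poly_nat_mono le_trans by blast
    moreover have "init_config ?M ?ws = (0, map (tape_of V ?s) [0..<k])"
      using len[OF x] by (simp add: init_config_def tape_of_input)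
    moreover have "tape_holds (last (map (tape_of V (sem ?N p ?s)) [0..<k])) (enc' (f x))"
      using out[OF x] k V(2)
      by (simp add: last_map tape_holds_def tape_of_def word_at_def cells_def)
    ultimately show ?thesis
      unfolding computes_within_def using len[OF x] syms[OF x] t(2) by auto
  qed
  ultimately show ?thesis unfolding poly_time_on_def by blast
next
  case True
  \<comment> \<open>Without an element of \<open>D\<close> nothing bounds \<open>k\<close> from
    below, so some valid machine is taken.\<close>
  have "valid_machine (code_machine 1 1 [])"
    by (rule valid_code_machine) auto
  then show ?thesis unfolding poly_time_on_def using True by blast
qed

section \<open>Monotone circuits\<close>

text \<open>Wires and outputs in one list, matching the consecutive numbering of inputs, gates and
  outputs in the forcing algorithm.\<close>

definition trace :: "circuit \<Rightarrow> bool list \<Rightarrow> bool list" where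
  "trace C x = wire_values C x @ eval_circuit C x"

lemma length_foldl_snoc: "length (foldl (\<lambda>vs g. vs @ [F vs g]) x gs) = length x + length gs"
  by (induction gs arbitrary: x) auto

lemma length_wire_values: "length (wire_values C x) = length x + length (gates C)"
  by (simp add: wire_values_def length_foldl_snoc)

lemma length_eval_circuit [simp]: "length (eval_circuit C x) = num_outputs C"
  by (simp add: eval_circuit_def)

lemma length_trace: "length (trace C x) = length x + length (gates C) + num_outputs C"
  by (simp add: trace_def length_wire_values)

lemma gate_value_mono:
  assumes "list_all2 (\<le>) vs us" "\<forall>w\<in>gate_wires g. w < length vs" "gate_value vs g"
  shows "gate_value us g"
  using assms by (cases g) (auto simp: list_all2_conv_all_nth)

lemma foldl_gates_mono:
  assumes "list_all2 (\<le>) vs us" "\<forall>k<length gs. \<forall>w\<in>gate_wires (gs ! k). w < length vs + k"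
  shows "list_all2 (\<le>) (foldl (\<lambda>vs g. vs @ [gate_value vs g]) vs gs)
    (foldl (\<lambda>vs g. vs @ [gate_value vs g]) us gs)"
  using assms
proof (induction gs arbitrary: vs us)
  case (Cons g gs)
  have "\<forall>k<length gs. \<forall>w\<in>gate_wires (gs ! k). w < length (vs @ [gate_value vs g]) + k"
  proof (intro allI impI ballI)
    fix k w assume "k < length gs" "w \<in> gate_wires (gs ! k)"
    then show "w < length (vs @ [gate_value vs g]) + k"
      using Cons.prems(2)[rule_format, of "Suc k" w] by simp
  qed
  moreover have "gate_value vs g \<le> gate_value us g"
    using gate_value_mono[OF Cons.prems(1)] Cons.prems(2) by (auto dest!: spec[of _ 0])
  ultimately show ?case unfolding foldl_Cons using Cons.prems(1)
    by (intro Cons.IH list_all2_appendI) simp_all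
qed auto

lemma trace_mono:
  assumes "wf_circuit C" "length x = num_inputs C" "list_all2 (\<le>) x y"
  shows "list_all2 (\<le>) (trace C x) (trace C y)"
proof -
  have w: "list_all2 (\<le>) (wire_values C x) (wire_values C y)"
    unfolding wire_values_def using assms
    by (intro foldl_gates_mono) (auto simp: wf_circuit_def)
  moreover have "list_all2 (\<le>) (eval_circuit C x) (eval_circuit C y)"
    using w assms by (auto simp: eval_circuit_def list_all2_conv_all_nth wf_circuit_def length_wire_values)
  ultimately show ?thesis unfolding trace_def by (rule list_all2_appendI)
qed

text \<open>A hybrid argument: \<open>x\<close> is turned into \<open>y\<close> one coordinate at a
  time, and each change is either void or a flip of a coordinate without influence.\<close>

lemma eval_circuit_cong:
  assumes len: "length x = num_inputs C" "length y = num_inputs C"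
    and agree: "\<And>j. j < num_inputs C \<Longrightarrow> depends_on C t j \<Longrightarrow> x ! j = y ! j"
  shows "eval_circuit C x ! t = eval_circuit C y ! t"
proof -
  define h where "h k = take k y @ drop k x" for k
  have "eval_circuit C (h k) ! t = eval_circuit C x ! t" if "k \<le> num_inputs C" for k
    using that
  proof (induction k)
    case 0
    then show ?case by (simp add: h_def)
  next
    case (Suc k)
    then have k: "k < length x" "k < length y" using len by auto
    have lh: "length (h k) = num_inputs C" using Suc.prems len by (simp add: h_def)
    have hS: "h (Suc k) = (h k)[k := y ! k]"
      using k by (simp add: h_def take_Suc_conv_app_nth list_update_append flip: Cons_nth_drop_Suc)
    have hk: "h k ! k = x ! k" using k by (simp add: h_def nth_append)
    show ?case
    proof (cases "x ! k = y ! k")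
      case True
      then have "h (Suc k) = h k" using hS hk list_update_id[of "h k" k] by simp
      then show ?thesis using Suc by simp
    next
      case False
      then have "\<not> depends_on C t k" using agree[of k] Suc.prems by auto
      then have "eval_circuit C (h k) ! t = eval_circuit C ((h k)[k := \<not> h k ! k]) ! t"
        unfolding depends_on_def using lh by blast
      moreover have "(\<not> h k ! k) = y ! k" using False hk by auto
      ultimately show ?thesis using Suc hS by simp
    qed
  qed
  from this[of "num_inputs C"] show ?thesis using len by (simp add: h_def)
qed

text \<open>\<open>G A\<close> stands for the value of an output when exactly the undetermined
  inputs in \<open>A\<close> are true, \<open>S\<close> for the inputs it depends on;
  \<open>hi\<close> and \<open>lo\<close> express that neither forcing test succeeds. Dropping one
  element of \<open>S\<close> keeps \<open>G\<close> true while at most one element leaves it false,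
  which bounds \<open>card S\<close> from below and fixes the threshold.\<close>

lemma majority_of_undecided:
  fixes G :: "'a set \<Rightarrow> bool"
  assumes mono: "\<And>A B. A \<subseteq> B \<Longrightarrow> G A \<Longrightarrow> G B"
    and S: "\<And>A. G A \<longleftrightarrow> G (A \<inter> S)" "S \<subseteq> F" "finite S" "card S \<le> 3"
    and F: "F \<noteq> {}" and hi: "\<And>a. a \<in> F \<Longrightarrow> G (F - {a})" and lo: "\<And>a. a \<in> F \<Longrightarrow> \<not> G {a}"
  shows "card S = 3" "G A \<longleftrightarrow> 2 \<le> card (A \<inter> S)"
proof -
  have hi': "G (S - {a})" if "a \<in> F" for a
  proof -
    have "(F - {a}) \<inter> S = S - {a}" using S(2) by auto
    then show ?thesis using S(1)[of "F - {a}"] hi[OF that] by simp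
  qed
  have lo': "\<not> G B" if "B \<subseteq> S" "card B \<le> 1" for B
  proof -
    have "finite B" using that S(3) finite_subset by blast
    have "\<exists>b\<in>F. B \<subseteq> {b}"
    proof (cases "B = {}")
      case False
      then obtain b where b: "b \<in> B" by blast
      then have "B \<subseteq> {b}" using that(2) \<open>finite B\<close> by (auto simp: card_le_Suc0_iff_eq)
      then show ?thesis using that(1) b S(2) by blast
    qed (use F in blast)
    then obtain b where "b \<in> F" "B \<subseteq> {b}" by blast
    then show ?thesis using mono[of B "{b}"] lo[of b] by auto
  qed
  show c3: "card S = 3"
  proof (rule ccontr)
    assume "card S \<noteq> 3"
    then have c: "card S \<le> 2" using S(4) by simp
    \<comment> \<open>If \<open>S\<close> is empty, the function is constant and any element of
      \<open>F\<close> gives the contradiction.\<close>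
    obtain a where a: "a \<in> F" "S \<noteq> {} \<longrightarrow> a \<in> S" using F S(2) by blast
    have "card (S - {a}) \<le> 1" using a(2) c S(3) by (cases "S = {}") auto
    then show False using lo'[of "S - {a}"] hi'[OF a(1)] by blast
  qed
  show "G A \<longleftrightarrow> 2 \<le> card (A \<inter> S)"
  proof
    show "2 \<le> card (A \<inter> S)" if "G A"
      using lo'[of "A \<inter> S"] that S(1)[of A] by (auto intro: ccontr)
  next
    assume c: "2 \<le> card (A \<inter> S)"
    \<comment> \<open>At most one element of \<open>S\<close> lies outside \<open>A\<close>, so
      \<open>A\<close> contains some \<open>S - {a}\<close>.\<close>
    have "card (S - A) = card S - card (A \<inter> S)"
      using S(3) by (metis card_Diff_subset_Int Int_commute finite_Int)
    then have "card (S - A) \<le> Suc 0" using c c3 by simp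
    moreover have "S \<noteq> {}" using c3 by auto
    ultimately obtain a where "a \<in> S" "S - A \<subseteq> {a}"
      using S(3) by (cases "S - A = {}") (auto simp: card_le_Suc0_iff_eq)
    then have "G (S - {a})" "S - {a} \<subseteq> A" using hi' S(2) by auto
    then show "G A" using mono by blast
  qed
qed

section \<open>The forcing algorithm\<close>

text \<open>
  Inputs, gates and outputs are numbered consecutively from \<open>1\<close>. Their kinds are the opcodes of
  the encoding, and \<open>7\<close> for inputs; the kind \<open>0\<close> marks numbers out of range. A restriction assigns
  to inputs and outputs \<open>0\<close> (undetermined), \<open>1\<close> (false) or \<open>2\<close> (true).
\<close>

fun opcode :: "gate \<Rightarrow> nat" where
  "opcode (And i j) = 3"
| "opcode (Or i j) = 4"
| "opcode (Maj i j k) = 5"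

definition kinds :: "circuit \<Rightarrow> nat list" where
  "kinds C = replicate (num_inputs C) 7 @ map opcode (gates C) @ replicate (num_outputs C) 6"

text \<open>Counting from \<open>1\<close> keeps item \<open>0\<close> free: its kind
  \<open>0\<close> is the parser state before any item has been read.\<close>

definition kind :: "circuit \<Rightarrow> nat \<Rightarrow> nat" where
  "kind C j = (if 0 < j \<and> j \<le> length (kinds C) then kinds C ! (j - 1) else 0)"

definition assignment :: "circuit \<Rightarrow> (nat \<Rightarrow> nat) \<Rightarrow> bool list" where
  "assignment C X = map (\<lambda>j. X (Suc j) = 2) [0..<num_inputs C]"

definition val :: "circuit \<Rightarrow> (nat \<Rightarrow> nat) \<Rightarrow> nat \<Rightarrow> bool" where
  "val C X j = trace C (assignment C X) ! (j - 1)"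

definition fill :: "nat \<Rightarrow> (nat \<Rightarrow> nat) \<Rightarrow> nat \<Rightarrow> nat" where
  "fill d R j = (if R j = 0 then d else R j)"

definition unfixed :: "circuit \<Rightarrow> (nat \<Rightarrow> nat) \<Rightarrow> nat \<Rightarrow> bool" where
  "unfixed C R a \<longleftrightarrow> kind C a = 7 \<and> R a = 0"

definition unset :: "circuit \<Rightarrow> (nat \<Rightarrow> nat) \<Rightarrow> nat \<Rightarrow> bool" where
  "unset C R i \<longleftrightarrow> kind C i = 6 \<and> R i = 0"

definition force :: "circuit \<Rightarrow> nat \<Rightarrow> nat \<Rightarrow> (nat \<Rightarrow> nat) \<Rightarrow> nat \<Rightarrow> nat" where
  "force C i a R =
     (if unset C R i \<and> unfixed C R a then
        if \<not> val C ((fill 2 R)(a := 1)) i then R(i := 2, a := 2)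
        else if val C ((fill 1 R)(a := 2)) i then R(i := 1, a := 1) else R
      else R)"

abbreviation size_enc :: "circuit \<Rightarrow> nat" where
  "size_enc C \<equiv> length (enc_circuit C)"

text \<open>All ranges end at \<open>size_enc C\<close>, the only loop length available to the
  programs; numbers that are no candidates are left alone by \<open>force\<close>.\<close>

definition force_round :: "circuit \<Rightarrow> (nat \<Rightarrow> nat) \<Rightarrow> nat \<Rightarrow> nat" where
  "force_round C R = fold (\<lambda>i. fold (force C i) [0..<size_enc C]) [0..<size_enc C] R"

definition forced :: "circuit \<Rightarrow> nat \<Rightarrow> nat" where
  "forced C = (force_round C ^^ size_enc C) (\<lambda>j. 0)"

lemma length_kinds: "length (kinds C) = num_inputs C + length (gates C) + num_outputs C"
  by (simp add: kinds_def)

text \<open>Every input, gate and output contributes a symbol, and the terminator after the number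
  of inputs one more. Strictness matters because items are numbered from \<open>1\<close>.\<close>

lemma kinds_le_size: "length (kinds C) < size_enc C"
proof -
  have "length gs \<le> length (concat (map enc_gate gs))" for gs
  proof (induction gs)
    case (Cons g gs)
    then show ?case by (cases g) auto
  qed auto
  moreover have "length os \<le> length (concat (map (\<lambda>w. 6 # enc_nat w) os))" for os
    by (induction os) auto
  ultimately have "length (gates C) + num_outputs C \<le>
      length (concat (map enc_gate (gates C))) + length (concat (map (\<lambda>w. 6 # enc_nat w) (outputs C)))"
    by (meson add_mono)
  then show ?thesis by (simp add: length_kinds enc_circuit_def enc_nat_def)
qed

lemma kind_eq_7: "kind C a = 7 \<longleftrightarrow> 0 < a \<and> a \<le> num_inputs C"
proof -
  have "opcode g \<noteq> 7" for g by (cases g) auto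
  then show ?thesis by (auto simp: kind_def kinds_def nth_append split: if_splits)
qed

lemma kind_eq_6: "kind C i = 6 \<longleftrightarrow>
  num_inputs C + length (gates C) < i \<and> i \<le> num_inputs C + length (gates C) + num_outputs C"
proof -
  have "opcode g \<noteq> 6" for g by (cases g) auto
  then show ?thesis by (auto simp: kind_def kinds_def nth_append split: if_splits)
qed

lemma kind_less_size: "kind C i \<noteq> 0 \<Longrightarrow> i < size_enc C"
  using kinds_le_size[of C] by (auto simp: kind_def split: if_splits)

lemma length_assignment [simp]: "length (assignment C X) = num_inputs C"
  by (simp add: assignment_def)

lemma nth_assignment: "kind C a = 7 \<Longrightarrow> assignment C X ! (a - 1) \<longleftrightarrow> X a = 2"
  by (auto simp: kind_eq_7 assignment_def)

lemma list_all2_le_inputs: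
  assumes "length x = num_inputs C" "length y = num_inputs C"
    "\<And>a. kind C a = 7 \<Longrightarrow> x ! (a - 1) \<le> y ! (a - 1)"
  shows "list_all2 (\<le>) x y"
  unfolding list_all2_conv_all_nth
proof (intro conjI allI impI)
  fix j assume "j < length x"
  then show "x ! j \<le> y ! j" using assms(3)[of "Suc j"] assms(1) by (simp add: kind_eq_7)
qed (use assms in simp)

lemma trace_mono_at:
  assumes "wf_circuit C" "length x = num_inputs C" "length y = num_inputs C"
    "\<And>a. kind C a = 7 \<Longrightarrow> x ! (a - 1) \<le> y ! (a - 1)" "kind C i = 6" "trace C x ! (i - 1)"
  shows "trace C y ! (i - 1)"
proof -
  have "list_all2 (\<le>) (trace C x) (trace C y)"
    using assms by (intro trace_mono list_all2_le_inputs) auto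
  moreover have "i - 1 < length (trace C x)" using assms by (auto simp: length_trace kind_eq_6)
  ultimately show ?thesis using assms(6) by (auto simp: list_all2_conv_all_nth)
qed

text \<open>Soundness of a restriction: preimages of the prescribed output values agree with the
  determined inputs. A prescription without preimages satisfies this vacuously, as happens once a
  constant output has been prescribed.\<close>

definition forcing :: "circuit \<Rightarrow> (nat \<Rightarrow> nat) \<Rightarrow> bool" where
  "forcing C R \<longleftrightarrow>
     (\<forall>x. length x = num_inputs C \<longrightarrow>
        (\<forall>i. kind C i = 6 \<and> R i \<noteq> 0 \<longrightarrow> trace C x ! (i - 1) = (R i = 2)) \<longrightarrow>
        (\<forall>a. kind C a = 7 \<and> R a \<noteq> 0 \<longrightarrow> x ! (a - 1) = (R a = 2)))"

definition set_outputs :: "circuit \<Rightarrow> (nat \<Rightarrow> nat) \<Rightarrow> nat set" where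
  "set_outputs C R = {i. kind C i = 6 \<and> R i \<noteq> 0}"

definition fixed_inputs :: "circuit \<Rightarrow> (nat \<Rightarrow> nat) \<Rightarrow> nat set" where
  "fixed_inputs C R = {a. kind C a = 7 \<and> R a \<noteq> 0}"

lemma finite_kind: "finite {i. kind C i = c \<and> P i}" if "c \<noteq> 0"
  by (rule finite_subset[of _ "{..<size_enc C}"]) (use that kind_less_size in auto)

lemma finite_set_outputs: "finite (set_outputs C R)" and finite_fixed_inputs: "finite (fixed_inputs C R)"
  by (simp_all add: set_outputs_def fixed_inputs_def finite_kind)

lemma force_cases:
  assumes "force C i a R \<noteq> R"
  obtains c where "c = 1 \<or> c = 2" "kind C i = 6" "R i = 0" "kind C a = 7" "R a = 0"
    "force C i a R = R(i := c, a := c)"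
proof -
  have "unset C R i" "unfixed C R a" using assms by (auto simp: force_def split: if_splits)
  moreover have "force C i a R = R(i := 1, a := 1) \<or> force C i a R = R(i := 2, a := 2)"
    using assms by (auto simp: force_def split: if_splits)
  ultimately show ?thesis using that[of 1] that[of 2] unfolding unset_def unfixed_def by blast
qed

text \<open>By the old invariant a preimage \<open>x\<close> agrees with \<open>R\<close> on the
  determined inputs. If it set \<open>a\<close> to false, it would lie below the point used by the
  first test, where the output is false although it was prescribed to be true; the second test is
  dual.\<close>

lemma forcing_force:
  assumes wf: "wf_circuit C" and R: "forcing C R"
  shows "forcing C (force C i a R)"
proof (cases "unset C R i \<and> unfixed C R a")
  case True
  then have i: "kind C i = 6" "R i = 0" and a: "kind C a = 7" "R a = 0"
    by (auto simp: unset_def unfixed_def)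
  have ia: "i \<noteq> a" using i(1) a(1) by auto
  have main: "forcing C (R(i := c, a := c))"
    if "\<And>x. length x = num_inputs C \<Longrightarrow> trace C x ! (i - 1) = (c = 2) \<Longrightarrow>
      (\<And>a'. kind C a' = 7 \<Longrightarrow> R a' \<noteq> 0 \<Longrightarrow> x ! (a' - 1) = (R a' = 2)) \<Longrightarrow> x ! (a - 1) = (c = 2)"
      "c \<noteq> 0" for c
    unfolding forcing_def
  proof (intro allI impI)
    fix x a'
    assume x: "length x = num_inputs C"
      "\<forall>i'. kind C i' = 6 \<and> (R(i := c, a := c)) i' \<noteq> 0 \<longrightarrow>
         trace C x ! (i' - 1) = ((R(i := c, a := c)) i' = 2)"
      and a': "kind C a' = 7 \<and> (R(i := c, a := c)) a' \<noteq> 0"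
    have "trace C x ! (i' - 1) = (R i' = 2)" if "kind C i' = 6" "R i' \<noteq> 0" for i'
    proof -
      have "i' \<noteq> i" "i' \<noteq> a" using that i a by auto
      then show ?thesis using x(2)[rule_format, of i'] that by simp
    qed
    then have old: "x ! (a' - 1) = (R a' = 2)" if "kind C a' = 7" "R a' \<noteq> 0" for a'
      using R x(1) that unfolding forcing_def by blast
    have "trace C x ! (i - 1) = (c = 2)" using x(2)[rule_format, of i] i ia \<open>c \<noteq> 0\<close> by simp
    then have "x ! (a - 1) = (c = 2)" using that(1)[OF x(1)] old by blast
    then show "x ! (a' - 1) = ((R(i := c, a := c)) a' = 2)"
      using old a' i(1) by (auto split: if_splits)
  qed
  have up: "x ! (a - 1)" if "\<not> val C ((fill 2 R)(a := 1)) i" "length x = num_inputs C"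
    "trace C x ! (i - 1)" "\<And>a'. kind C a' = 7 \<Longrightarrow> R a' \<noteq> 0 \<Longrightarrow> x ! (a' - 1) = (R a' = 2)" for x
  proof (rule ccontr)
    assume "\<not> x ! (a - 1)"
    have "trace C (assignment C ((fill 2 R)(a := 1))) ! (i - 1)"
    proof (rule trace_mono_at[OF wf that(2) length_assignment _ i(1) that(3)])
      fix a' assume "kind C a' = 7"
      then show "x ! (a' - 1) \<le> assignment C ((fill 2 R)(a := 1)) ! (a' - 1)"
        using that(4)[of a'] \<open>\<not> x ! (a - 1)\<close>
        by (cases "a' = a"; cases "R a' = 0") (simp_all add: nth_assignment[unfolded One_nat_def] fill_def)
    qed
    then show False using that(1) by (simp add: val_def)
  qed
  have down: "\<not> x ! (a - 1)" if "val C ((fill 1 R)(a := 2)) i" "length x = num_inputs C"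
    "\<not> trace C x ! (i - 1)" "\<And>a'. kind C a' = 7 \<Longrightarrow> R a' \<noteq> 0 \<Longrightarrow> x ! (a' - 1) = (R a' = 2)" for x
  proof
    assume "x ! (a - 1)"
    have "trace C x ! (i - 1)"
    proof (rule trace_mono_at[OF wf length_assignment that(2) _ i(1) that(1)[unfolded val_def]])
      fix a' assume "kind C a' = 7"
      then show "assignment C ((fill 1 R)(a := 2)) ! (a' - 1) \<le> x ! (a' - 1)"
        using that(4)[of a'] \<open>x ! (a - 1)\<close>
        by (cases "a' = a"; cases "R a' = 0") (simp_all add: nth_assignment[unfolded One_nat_def] fill_def)
    qed
    then show False using that(3) by simp
  qed
  have "forcing C (R(i := 2, a := 2))" if "\<not> val C ((fill 2 R)(a := 1)) i"
    using up[OF that] by (intro main) auto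
  moreover have "forcing C (R(i := 1, a := 1))" if "val C ((fill 1 R)(a := 2)) i"
    using down[OF that] by (intro main) auto
  ultimately show ?thesis using True R by (simp add: force_def)
next
  case False
  then show ?thesis using R by (auto simp: force_def)
qed

section \<open>Invariant, progress and fixed point of the forcing rounds\<close>

definition restriction_inv :: "circuit \<Rightarrow> (nat \<Rightarrow> nat) \<Rightarrow> bool" where
  "restriction_inv C R \<longleftrightarrow>
     forcing C R \<and> (\<forall>j. R j \<le> 2) \<and> card (set_outputs C R) = card (fixed_inputs C R)"

lemma restriction_inv_0: "restriction_inv C (\<lambda>j. 0)"
  by (simp add: restriction_inv_def forcing_def set_outputs_def fixed_inputs_def)

lemma force_sets:
  assumes "force C i a R \<noteq> R"
  shows "card (set_outputs C (force C i a R)) = Suc (card (set_outputs C R))"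
    "card (fixed_inputs C (force C i a R)) = Suc (card (fixed_inputs C R))"
proof -
  obtain c where c: "c = 1 \<or> c = 2" "kind C i = 6" "R i = 0" "kind C a = 7" "R a = 0"
    "force C i a R = R(i := c, a := c)" using assms by (rule force_cases)
  have "set_outputs C (force C i a R) = insert i (set_outputs C R)"
    using c by (auto simp: set_outputs_def)
  moreover have "i \<notin> set_outputs C R" using c by (simp add: set_outputs_def)
  ultimately show "card (set_outputs C (force C i a R)) = Suc (card (set_outputs C R))"
    by (simp add: finite_set_outputs)
  have "fixed_inputs C (force C i a R) = insert a (fixed_inputs C R)"
    using c by (auto simp: fixed_inputs_def)
  moreover have "a \<notin> fixed_inputs C R" using c by (simp add: fixed_inputs_def)
  ultimately show "card (fixed_inputs C (force C i a R)) = Suc (card (fixed_inputs C R))"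
    by (simp add: finite_fixed_inputs)
qed

lemma restriction_inv_force:
  assumes "wf_circuit C" "restriction_inv C R"
  shows "restriction_inv C (force C i a R)"
proof (cases "force C i a R = R")
  case False
  have "\<forall>j. force C i a R j \<le> 2"
    using assms(2) by (rule_tac force_cases[OF False]) (auto simp: restriction_inv_def)
  then show ?thesis using assms force_sets[OF False] forcing_force[OF assms(1)]
    by (auto simp: restriction_inv_def)
qed (use assms in simp)

lemma fold_preserves: "P R \<Longrightarrow> (\<And>x R. P R \<Longrightarrow> P (f x R)) \<Longrightarrow> P (fold f xs R)"
  by (induction xs arbitrary: R) auto

lemma restriction_inv_forced: "wf_circuit C \<Longrightarrow> restriction_inv C (forced C)"
proof -
  assume "wf_circuit C"
  then have "restriction_inv C (force_round C R)" if "restriction_inv C R" for R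
    unfolding force_round_def using that
    by (intro fold_preserves[where P = "restriction_inv C"]) (auto intro: restriction_inv_force)
  then have "restriction_inv C ((force_round C ^^ k) (\<lambda>j. 0))" for k
    by (induction k) (auto simp: restriction_inv_0)
  then show ?thesis by (simp add: forced_def)
qed

text \<open>The measure never decreases along the list, so a single effective step still shows at
  the end; without one, every element leaves the start value fixed.\<close>

lemma fold_force_progress:
  fixes m :: "'a \<Rightarrow> nat"
  assumes "\<And>x R. f x R = R \<or> m R < m (f x R)"
  shows "(fold f xs R = R \<and> (\<forall>x\<in>set xs. f x R = R)) \<or> m R < m (fold f xs R)"
proof (induction xs arbitrary: R)
  case (Cons x xs)
  show ?case
  proof (cases "f x R = R")
    case True
    then show ?thesis using Cons[of R] by auto
  next
    case False
    then have "m R < m (f x R)" using assms by blast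
    then show ?thesis using Cons[of "f x R"] by auto
  qed
qed auto

lemma force_round_progress:
  "(force_round C R = R \<and> (\<forall>i<size_enc C. \<forall>a<size_enc C. force C i a R = R)) \<or>
    card (set_outputs C R) < card (set_outputs C (force_round C R))"
proof -
  let ?m = "\<lambda>R. card (set_outputs C R)"
  have "force C i a R = R \<or> ?m R < ?m (force C i a R)" for i a R
    using force_sets(1)[of C i a R] by (cases "force C i a R = R") simp_all
  from fold_force_progress[of "force C _" ?m, OF this]
  have in1: "(fold (force C i) xs R = R \<and> (\<forall>a\<in>set xs. force C i a R = R)) \<or>
      ?m R < ?m (fold (force C i) xs R)" for i R xs .
  then have "fold (force C i) xs R = R \<or> ?m R < ?m (fold (force C i) xs R)" for i R xs by blast
  from fold_force_progress[of "\<lambda>i. fold (force C i) [0..<size_enc C]" ?m "[0..<size_enc C]" R, OF this]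
  show ?thesis unfolding force_round_def using in1[of _ "[0..<size_enc C]" R] by fastforce
qed

text \<open>Until a fixed point is reached, each round prescribes a further output, and there are
  fewer than \<open>size_enc C\<close> outputs; so \<open>size_enc C\<close> rounds suffice.\<close>

lemma force_forced: "force C i a (forced C) = forced C"
proof -
  let ?N = "size_enc C" and ?R = "\<lambda>k. (force_round C ^^ k) (\<lambda>j. 0)"
  have "k \<le> card (set_outputs C (?R k)) \<or> (\<exists>R. ?R k = R \<and> force_round C R = R)" for k
  proof (induction k)
    case (Suc k)
    then show ?case using force_round_progress[of C "?R k"] by (auto simp: less_eq_Suc_le)
  qed auto
  moreover have "card (set_outputs C R) < ?N" for R
  proof -
    have "set_outputs C R \<subseteq> {1..length (kinds C)}"
      by (auto simp: set_outputs_def kind_def split: if_splits)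
    from card_mono[OF _ this] show ?thesis using kinds_le_size[of C] by auto
  qed
  ultimately have "force_round C (forced C) = forced C"
    unfolding forced_def by (metis leD)
  then have "\<forall>i<?N. \<forall>a<?N. force C i a (forced C) = forced C"
    using force_round_progress[of C "forced C"] by auto
  moreover have "i < ?N \<and> a < ?N" if "unset C (forced C) i \<and> unfixed C (forced C) a"
    using that kind_less_size[of C i] kind_less_size[of C a] by (simp add: unset_def unfixed_def)
  moreover have "force C i a R = R" if "\<not> (unset C R i \<and> unfixed C R a)" for R
    using that by (auto simp: force_def)
  ultimately show ?thesis by blast
qed

section \<open>The majority circuit\<close>

definition has_unfixed :: "circuit \<Rightarrow> bool" where
  "has_unfixed C \<longleftrightarrow> (\<exists>a<size_enc C. unfixed C (forced C) a)"

text \<open>Finds the three variables of a majority by evaluation alone: with just two variables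
  true, the output is true exactly when both belong to the majority. The choice \<open>b = a\<close>
  is harmless, since one true variable does not suffice.\<close>

definition relevant :: "circuit \<Rightarrow> nat \<Rightarrow> nat \<Rightarrow> bool" where
  "relevant C i a \<longleftrightarrow> unfixed C (forced C) a \<and>
     (\<exists>b<size_enc C. unfixed C (forced C) b \<and> val C ((fill 1 (forced C))(a := 2, b := 2)) i)"

definition input_rank :: "circuit \<Rightarrow> nat \<Rightarrow> nat" where
  "input_rank C a = length (filter (unfixed C (forced C)) [0..<a])"

definition output_rank :: "circuit \<Rightarrow> nat \<Rightarrow> nat" where
  "output_rank C i = length (filter (unset C (forced C)) [0..<i])"

text \<open>By \<open>maj_gate_spec\<close> the default is never reached for an unprescribed output
  while undetermined inputs remain.\<close>

definition maj_gate :: "circuit \<Rightarrow> nat \<Rightarrow> gate" where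
  "maj_gate C i =
     (case map (input_rank C) (filter (relevant C i) [0..<size_enc C]) of
        [a, b, c] \<Rightarrow> Maj a b c | _ \<Rightarrow> Maj 0 0 0)"

text \<open>Without undetermined inputs an instance is still owed; the constant one, with three
  inputs and four outputs, serves only this purpose.\<close>

definition reduced :: "circuit \<Rightarrow> circuit" where
  "reduced C =
     (if has_unfixed C then
        Circuit (input_rank C (size_enc C))
          (map (maj_gate C) (filter (unset C (forced C)) [0..<size_enc C]))
          (map (\<lambda>i. input_rank C (size_enc C) + output_rank C i)
             (filter (unset C (forced C)) [0..<size_enc C]))
      else Circuit 3 [Maj 0 1 2] [3, 3, 3, 3])"

text \<open>In the last case all inputs are determined, so \<open>fill\<close> does not affect them
  and the output has a known value under the restriction.\<close>

definition lift_bit :: "circuit \<Rightarrow> bool list \<Rightarrow> nat \<Rightarrow> bool" where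
  "lift_bit C y i =
     (if forced C i \<noteq> 0 then forced C i = 2
      else if has_unfixed C then y ! output_rank C i
      else \<not> val C (fill 1 (forced C)) i)"

definition lift :: "circuit \<Rightarrow> bool list \<Rightarrow> bool list" where
  "lift C y = map (lift_bit C y) (filter (\<lambda>i. kind C i = 6) [0..<size_enc C])"

section \<open>Values, ranks and the lifted string\<close>

lemma val_cong:
  "(\<And>a. kind C a = 7 \<Longrightarrow> X a = 2 \<longleftrightarrow> Y a = 2) \<Longrightarrow> val C X i = val C Y i"
proof -
  assume "\<And>a. kind C a = 7 \<Longrightarrow> X a = 2 \<longleftrightarrow> Y a = 2"
  then have "assignment C X = assignment C Y"
    by (auto simp: assignment_def kind_eq_7)
  then show ?thesis by (simp add: val_def)
qed

lemma filter_nth_rank: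
  assumes "P a" "a < N"
  shows "filter P [0..<N] ! length (filter P [0..<a]) = a"
    "length (filter P [0..<a]) < length (filter P [0..<N])"
proof -
  have "[0..<N] = [0..<a] @ a # [Suc a..<N]"
    using assms(2) upt_add_eq_append[of 0 a "N - a"] upt_conv_Cons[of a N] by simp
  then show "filter P [0..<N] ! length (filter P [0..<a]) = a"
    "length (filter P [0..<a]) < length (filter P [0..<N])"
    using assms(1) by (simp_all add: nth_append)
qed

lemma rank_filter_nth:
  assumes "k < length (filter P [0..<N])"
  shows "length (filter P [0..<filter P [0..<N] ! k]) = k"
proof -
  let ?i = "filter P [0..<N] ! k"
  have "?i \<in> set (filter P [0..<N])" using assms nth_mem by blast
  then have "P ?i" "?i < N" by auto
  note r = filter_nth_rank[of P ?i, OF this]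
  have "distinct (filter P [0..<N])" by simp
  from nth_eq_iff_index_eq[OF this r(2) assms] show ?thesis using r(1) by blast
qed

lemma rank_inject:
  assumes "P a" "P b" "length (filter P [0..<a]) = length (filter P [0..<b])"
  shows "a = (b :: nat)"
  using filter_nth_rank(1)[of P a "Suc (max a b)"] filter_nth_rank(1)[of P b "Suc (max a b)"] assms
  by simp

text \<open>For majority circuits, whose gates read inputs only: the earlier gate values
  \<open>zs\<close> are never consulted.\<close>

lemma wire_values_shallow:
  assumes "\<forall>g\<in>set gs. \<forall>w\<in>gate_wires g. w < length x"
  shows "foldl (\<lambda>vs g. vs @ [gate_value vs g]) (x @ zs) gs = x @ zs @ map (gate_value x) gs"
  using assms
proof (induction gs arbitrary: zs)
  case (Cons g gs)
  have "gate_value (x @ zs) g = gate_value x g"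
    using Cons.prems by (cases g) (auto simp: nth_append)
  then show ?case using Cons.IH[of "zs @ [gate_value x g]"] Cons.prems by simp
qed auto

lemma filter_output_kinds:
  "filter (\<lambda>i. kind C i = 6) [0..<size_enc C] =
    map (\<lambda>t. num_inputs C + length (gates C) + 1 + t) [0..<num_outputs C]"
proof (rule sorted_distinct_set_unique)
  show "set (filter (\<lambda>i. kind C i = 6) [0..<size_enc C]) =
    set (map (\<lambda>t. num_inputs C + length (gates C) + 1 + t) [0..<num_outputs C])"
  proof -
    have "i \<in> (\<lambda>t. num_inputs C + length (gates C) + 1 + t) ` {0..<num_outputs C}"
      if "kind C i = 6" for i
      using that unfolding kind_eq_6
      by (intro image_eqI[of _ _ "i - (num_inputs C + length (gates C) + 1)"]) auto
    moreover have "kind C i = 6 \<and> i < size_enc C"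
      if "i \<in> (\<lambda>t. num_inputs C + length (gates C) + 1 + t) ` {0..<num_outputs C}" for i
    proof -
      have "kind C i = 6" using that by (auto simp: kind_eq_6)
      then show ?thesis using kind_less_size[of C i] by simp
    qed
    ultimately show ?thesis by auto
  qed
next
  show "sorted (map (\<lambda>t. num_inputs C + length (gates C) + 1 + t) [0..<num_outputs C])"
    by (simp add: sorted_iff_nth_mono)
qed (auto simp: distinct_map inj_on_def intro: sorted_wrt_filter)

lemma length_lift [simp]: "length (lift C y) = num_outputs C"
  by (simp add: lift_def filter_output_kinds)

lemma lift_nth:
  "t < num_outputs C \<Longrightarrow> lift C y ! t = lift_bit C y (num_inputs C + length (gates C) + 1 + t)"
  by (simp add: lift_def filter_output_kinds)

lemma trace_output:
  assumes "length x = num_inputs C"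
  shows "trace C x ! (num_inputs C + length (gates C) + t) = eval_circuit C x ! t"
  using assms by (simp add: trace_def nth_append length_wire_values)

lemma lift_eq_trace:
  assumes "lift C y = eval_circuit C x" "length x = num_inputs C" "kind C i = 6"
  shows "lift_bit C y i = trace C x ! (i - 1)"
proof -
  define t where "t = i - (num_inputs C + length (gates C) + 1)"
  have t: "t < num_outputs C" "i = num_inputs C + length (gates C) + 1 + t"
    using assms(3) by (auto simp: kind_eq_6 t_def)
  show ?thesis using lift_nth[OF t(1), of y] trace_output[OF assms(2), of t] assms(1) t(2) by simp
qed

section \<open>Correctness of the majority instance\<close>

locale monotone_instance =
  fixes C :: circuit
  assumes wf: "wf_circuit C"
    and few: "\<And>i. i < num_outputs C \<Longrightarrow> card {j. j < num_inputs C \<and> depends_on C i j} \<le> 3"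
    and stretch: "num_inputs C < num_outputs C"
begin

abbreviation "R \<equiv> forced C"
abbreviation "N \<equiv> size_enc C"

lemma inv: "forcing C R" "R j \<le> 2" "card (set_outputs C R) = card (fixed_inputs C R)"
  using restriction_inv_forced[OF wf] by (auto simp: restriction_inv_def)

text \<open>\<open>lift\<close> repeats the prescribed values, so its preimages are subject to the
  invariant \<open>forcing\<close>, whatever \<open>y\<close> is.\<close>

lemma fixed_by_lift:
  assumes "lift C y = eval_circuit C x" "length x = num_inputs C" "kind C a = 7" "R a \<noteq> 0"
  shows "x ! (a - 1) = (R a = 2)"
proof -
  have "trace C x ! (i - 1) = (R i = 2)" if "kind C i = 6" "R i \<noteq> 0" for i
    using lift_eq_trace[OF assms(1,2) that(1)] that(2) by (simp add: lift_bit_def)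
  then show ?thesis using inv(1) assms(2-4) unfolding forcing_def by blast
qed

lemma card_unfixed: "card {a. unfixed C R a} + card (fixed_inputs C R) = num_inputs C"
proof -
  have "{a. kind C a = 7} = {1..num_inputs C}" by (auto simp: kind_eq_7)
  then have "card {a. kind C a = 7} = num_inputs C" by simp
  moreover have "{a. kind C a = 7} = {a. unfixed C R a} \<union> fixed_inputs C R"
    "{a. unfixed C R a} \<inter> fixed_inputs C R = {}"
    by (auto simp: unfixed_def fixed_inputs_def)
  ultimately show ?thesis
    using card_Un_disjoint[of "{a. unfixed C R a}" "fixed_inputs C R"] finite_kind[of 7 C "\<lambda>a. R a = 0"]
    by (simp add: finite_fixed_inputs unfixed_def)
qed

lemma card_unset: "card {i. unset C R i} + card (set_outputs C R) = num_outputs C"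
proof -
  have "{i. kind C i = 6} =
      {Suc (num_inputs C + length (gates C))..num_inputs C + length (gates C) + num_outputs C}"
    by (auto simp: kind_eq_6)
  then have "card {i. kind C i = 6} = num_outputs C" by simp
  moreover have "{i. kind C i = 6} = {i. unset C R i} \<union> set_outputs C R"
    "{i. unset C R i} \<inter> set_outputs C R = {}"
    by (auto simp: unset_def set_outputs_def)
  ultimately show ?thesis
    using card_Un_disjoint[of "{i. unset C R i}" "set_outputs C R"] finite_kind[of 6 C "\<lambda>a. R a = 0"]
    by (simp add: finite_set_outputs unset_def)
qed

lemma unfixed_less: "unfixed C R a \<Longrightarrow> a < N" and unset_less: "unset C R i \<Longrightarrow> i < N"
  using kind_less_size by (auto simp: unfixed_def unset_def)

lemma length_filter_card: "(\<And>a. P a \<Longrightarrow> a < M) \<Longrightarrow> length (filter P [0..<M]) = card {a. P a}"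
proof -
  assume "\<And>a. P a \<Longrightarrow> a < M"
  then have "set (filter P [0..<M]) = {a. P a}" by auto
  then show ?thesis by (metis distinct_card distinct_filter distinct_upt)
qed

text \<open>The equal cardinalities in the invariant reduce this to the stretch of the original
  instance.\<close>

lemma rank_less: "input_rank C N < output_rank C N"
  using card_unfixed card_unset inv(3) stretch
  unfolding input_rank_def output_rank_def
  by (simp add: length_filter_card unfixed_less unset_less)

text \<open>The assignments extending the restriction, indexed by the set of undetermined inputs
  made true; this turns an output into a set function as in
  \<open>majority_of_undecided\<close>.\<close>

definition completion :: "nat set \<Rightarrow> nat \<Rightarrow> nat" where
  "completion A j = (if R j \<noteq> 0 then R j else if j \<in> A then 2 else 1)"

lemma majority:
  assumes i: "unset C R i" and ex: "has_unfixed C"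
  obtains S where "card S = 3" "finite S" "S \<subseteq> {a. unfixed C R a}"
    "\<And>A. val C (completion A) i \<longleftrightarrow> 2 \<le> card (A \<inter> S)"
proof -
  define t where "t = i - (num_inputs C + length (gates C) + 1)"
  have t: "t < num_outputs C" "i = num_inputs C + length (gates C) + 1 + t"
    using i by (auto simp: kind_eq_6 t_def unset_def)
  have eval: "val C X i = eval_circuit C (assignment C X) ! t" for X
    using trace_output[of "assignment C X" C t] t(2) by (simp add: val_def)
  let ?F = "{a. unfixed C R a}"
  define S where "S = {a. unfixed C R a \<and> depends_on C t (a - 1)}"
  let ?G = "\<lambda>A. val C (completion A) i"
  have fin: "finite S"
    unfolding S_def unfixed_def
    using finite_kind[of 7 C "\<lambda>a. R a = 0 \<and> depends_on C t (a - 1)"] by (simp add: conj_assoc)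
  have "inj_on (\<lambda>a. a - 1) S"
    by (auto simp: S_def inj_on_def unfixed_def kind_eq_7)
  then have "card S = card ((\<lambda>a. a - 1) ` S)" by (simp add: card_image)
  also have "\<dots> \<le> card {j. j < num_inputs C \<and> depends_on C t j}"
    by (rule card_mono) (auto simp: S_def unfixed_def kind_eq_7)
  finally have card: "card S \<le> 3" using few[OF t(1)] by simp
  have mono: "?G B" if "A \<subseteq> B" "?G A" for A B
    unfolding val_def
  proof (rule trace_mono_at[OF wf length_assignment length_assignment _ _ that(2)[unfolded val_def]])
    fix a assume "kind C a = 7"
    then show "assignment C (completion A) ! (a - 1) \<le> assignment C (completion B) ! (a - 1)"
      using that(1) by (auto simp: nth_assignment[unfolded One_nat_def] completion_def)
  qed (use i in \<open>simp add: unset_def\<close>)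
  have rel: "?G A \<longleftrightarrow> ?G (A \<inter> S)" for A
    unfolding eval
  proof (rule arg_cong[of _ _ "\<lambda>b. b"], rule eval_circuit_cong)
    fix j assume j: "j < num_inputs C" "depends_on C t j"
    then have "kind C (Suc j) = 7" by (simp add: kind_eq_7)
    then show "assignment C (completion A) ! j = assignment C (completion (A \<inter> S)) ! j"
      using nth_assignment[of C "Suc j"] j by (auto simp: completion_def S_def unfixed_def)
  qed simp_all
  have forc: "force C i a R = R" for a by (rule force_forced)
  have hi: "?G (?F - {a})" and lo: "\<not> ?G {a}" if "a \<in> ?F" for a
  proof -
    have a: "kind C a = 7" "R a = 0" and i': "kind C i = 6" "R i = 0"
      using that i by (auto simp: unfixed_def unset_def)
    \<comment> \<open>A successful test would change \<open>R\<close> at \<open>a\<close>; at the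
      fixed point both tests therefore fail.\<close>
    have "R(i := 2, a := 2) \<noteq> R" "R(i := 1, a := 1) \<noteq> R"
      using a(2) by (auto dest: fun_cong[of _ _ a])
    then have *: "val C ((fill 2 R)(a := 1)) i" "\<not> val C ((fill 1 R)(a := 2)) i"
      using forc[of a] that i by (auto simp: force_def split: if_splits)
    have "val C ((fill 2 R)(a := 1)) i = ?G (?F - {a})"
      using a by (intro val_cong) (auto simp: fill_def completion_def unfixed_def)
    then show "?G (?F - {a})" using * by simp
    have "val C ((fill 1 R)(a := 2)) i = ?G {a}"
      using a by (intro val_cong) (auto simp: fill_def completion_def)
    then show "\<not> ?G {a}" using * by simp
  qed
  have "?F \<noteq> {}" using ex by (auto simp: has_unfixed_def)
  have SF: "S \<subseteq> ?F" by (auto simp: S_def)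
  have "card S = 3"
    by (rule majority_of_undecided(1)[of ?G S ?F]) (use mono rel SF fin card \<open>?F \<noteq> {}\<close> hi lo in auto)
  moreover have "?G A \<longleftrightarrow> 2 \<le> card (A \<inter> S)" for A
    by (rule majority_of_undecided(2)[of ?G S ?F]) (use mono rel SF fin card \<open>?F \<noteq> {}\<close> hi lo in auto)
  ultimately show ?thesis using that[of S] SF fin by blast
qed

lemma maj_gate_spec:
  assumes i: "unset C R i" and ex: "has_unfixed C"
  obtains a b c where "distinct [a, b, c]" "\<forall>e\<in>{a, b, c}. unfixed C R e"
    "filter (relevant C i) [0..<N] = [a, b, c]"
    "\<forall>A. val C (completion A) i \<longleftrightarrow> (a \<in> A \<and> b \<in> A) \<or> (a \<in> A \<and> c \<in> A) \<or> (b \<in> A \<and> c \<in> A)"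
proof -
  obtain S where S: "card S = 3" "finite S" "S \<subseteq> {a. unfixed C R a}"
    "\<And>A. val C (completion A) i \<longleftrightarrow> 2 \<le> card (A \<inter> S)"
    using majority[OF assms] by blast
  have "relevant C i a \<longleftrightarrow> a \<in> S" for a
  proof -
    have v: "val C ((fill 1 R)(a := 2, b := 2)) i \<longleftrightarrow> a \<in> S \<and> b \<in> S \<and> a \<noteq> b"
      if "unfixed C R a" "unfixed C R b" for b
    proof -
      have "val C ((fill 1 R)(a := 2, b := 2)) i = val C (completion {a, b}) i"
        using that by (intro val_cong) (auto simp: fill_def completion_def unfixed_def)
      then show ?thesis using S(4)[of "{a, b}"]
        by (cases "a \<in> S"; cases "b \<in> S"; cases "a = b") (auto simp: Int_insert_left)
    qed
    have "\<exists>b\<in>S. a \<noteq> b" if "a \<in> S"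
    proof -
      have "card (S - {a}) = 2" using that S(1,2) by simp
      then have "S - {a} \<noteq> {}" by (metis card.empty zero_neq_numeral)
      then show ?thesis by auto
    qed
    then show ?thesis using v S(3) unfixed_less unfolding relevant_def by blast
  qed
  then have set: "set (filter (relevant C i) [0..<N]) = S"
    using S(3) unfixed_less by auto
  moreover have dist: "distinct (filter (relevant C i) [0..<N])" by simp
  ultimately have "length (filter (relevant C i) [0..<N]) = 3"
    using S(1) by (metis distinct_card)
  then obtain a b c where abc: "filter (relevant C i) [0..<N] = [a, b, c]"
    by (auto simp: numeral_3_eq_3 length_Suc_conv)
  have Sabc: "S = {a, b, c}" and d: "distinct [a, b, c]"
    using set dist unfolding abc by auto
  have "val C (completion A) i \<longleftrightarrow> (a \<in> A \<and> b \<in> A) \<or> (a \<in> A \<and> c \<in> A) \<or> (b \<in> A \<and> c \<in> A)" for A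
  proof -
    have "A \<inter> S = (if a \<in> A then {a} else {}) \<union> (if b \<in> A then {b} else {}) \<union> (if c \<in> A then {c} else {})"
      using Sabc by auto
    then show ?thesis unfolding S(4) using d by (cases "a \<in> A"; cases "b \<in> A"; cases "c \<in> A") auto
  qed
  then show ?thesis using that[OF d _ abc] S(3) Sabc by auto
qed

lemma maj_gate_wires:
  assumes "unset C R i" "has_unfixed C"
  shows "\<exists>a b c. maj_gate C i = Maj a b c \<and> distinct [a, b, c] \<and>
    a < input_rank C N \<and> b < input_rank C N \<and> c < input_rank C N"
proof -
  obtain a b c where abc: "distinct [a, b, c]" "\<forall>e\<in>{a, b, c}. unfixed C R e"
    "filter (relevant C i) [0..<N] = [a, b, c]"
    "\<forall>A. val C (completion A) i \<longleftrightarrow> (a \<in> A \<and> b \<in> A) \<or> (a \<in> A \<and> c \<in> A) \<or> (b \<in> A \<and> c \<in> A)"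
    by (rule maj_gate_spec[OF assms])
  have "input_rank C e < input_rank C N" if "e \<in> {a, b, c}" for e
    unfolding input_rank_def using that abc(2) unfixed_less by (intro filter_nth_rank(2)) auto
  moreover have "input_rank C e \<noteq> input_rank C e'" if "e \<in> {a, b, c}" "e' \<in> {a, b, c}" "e \<noteq> e'" for e e'
    unfolding input_rank_def using that abc(2) rank_inject[of "unfixed C R" e e'] by blast
  ultimately show ?thesis using abc by (simp add: maj_gate_def)
qed

lemma reduced_instance: "reduced C \<in> maj3_circuits" "num_inputs (reduced C) < num_outputs (reduced C)"
proof -
  let ?is = "filter (unset C R) [0..<N]"
  have "reduced C \<in> maj3_circuits" if ex: "has_unfixed C"
  proof -
    have g: "\<exists>a b c. maj_gate C i = Maj a b c \<and> distinct [a, b, c] \<and>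
        a < input_rank C N \<and> b < input_rank C N \<and> c < input_rank C N" if "i \<in> set ?is" for i
      using maj_gate_wires[OF _ ex] that by auto
    have "w < input_rank C N + k" if "k < length ?is" "w \<in> gate_wires (maj_gate C (?is ! k))" for w k
      using g[of "?is ! k"] nth_mem[OF that(1)] that(2) by fastforce
    moreover have "output_rank C i < length ?is" if "unset C R i" "i < N" for i
      unfolding output_rank_def using that by (intro filter_nth_rank(2)) auto
    ultimately have "wf_circuit (reduced C)"
      using ex by (auto simp: wf_circuit_def reduced_def)
    then show ?thesis using ex g by (auto simp: maj3_circuits_def reduced_def)
  qed
  moreover have "reduced C \<in> maj3_circuits" if "\<not> has_unfixed C"
    using that by (auto simp: reduced_def maj3_circuits_def wf_circuit_def)
  ultimately show "reduced C \<in> maj3_circuits" by blast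
  show "num_inputs (reduced C) < num_outputs (reduced C)"
    using rank_less by (simp add: reduced_def output_rank_def)
qed

text \<open>A preimage \<open>x\<close> of the lifted string would agree with the restriction, hence
  be a completion. Its undetermined inputs would then form a preimage of \<open>y\<close> under the
  majority circuit; if there are none, some unprescribed output would equal its own
  negation.\<close>

lemma lift_solution:
  assumes y: "length y = num_outputs (reduced C)" "y \<notin> circuit_range (reduced C)"
  shows "lift C y \<notin> circuit_range C"
proof
  assume "lift C y \<in> circuit_range C"
  then obtain x where x: "lift C y = eval_circuit C x" "length x = num_inputs C"
    by (auto simp: circuit_range_def)
  note fixed = fixed_by_lift[OF x]
  define A where "A = {a. unfixed C R a \<and> x ! (a - 1)}"
  have "assignment C (completion A) = x"
  proof (rule nth_equalityI)
    fix j assume "j < length (assignment C (completion A))"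
    then have "kind C (Suc j) = 7" by (simp add: kind_eq_7)
    then show "assignment C (completion A) ! j = x ! j"
      using nth_assignment[of C "Suc j" "completion A"] fixed[of "Suc j"]
      by (auto simp: completion_def A_def unfixed_def)
  qed (simp add: x)
  then have vx: "val C (completion A) i = lift_bit C y i" if "kind C i = 6" for i
    using lift_eq_trace[OF x that] by (simp add: val_def)
  let ?is = "filter (unset C R) [0..<N]" and ?as = "filter (unfixed C R) [0..<N]"
  show False
  proof (cases "has_unfixed C")
    case True
    define z where "z = map (\<lambda>a. x ! (a - 1)) ?as"
    have z: "length z = input_rank C N" by (simp add: z_def input_rank_def)
    have zr: "z ! input_rank C a \<longleftrightarrow> a \<in> A" if "unfixed C R a" for a
    proof -
      note r = filter_nth_rank[of "unfixed C R" a N, OF that unfixed_less[OF that]]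
      show ?thesis using r that unfolding z_def input_rank_def A_def by simp
    qed
    have gv: "gate_value z (maj_gate C i) = y ! output_rank C i" if i: "unset C R i" for i
    proof -
      obtain a b c where abc: "distinct [a, b, c]" "\<forall>e\<in>{a, b, c}. unfixed C R e"
        "filter (relevant C i) [0..<N] = [a, b, c]"
        "\<forall>A. val C (completion A) i \<longleftrightarrow> (a \<in> A \<and> b \<in> A) \<or> (a \<in> A \<and> c \<in> A) \<or> (b \<in> A \<and> c \<in> A)"
        by (rule maj_gate_spec[OF i True])
      have "gate_value z (maj_gate C i) = val C (completion A) i"
        using abc(2) zr unfolding maj_gate_def abc(3) by (simp add: abc(4))
      also have "\<dots> = y ! output_rank C i"
        using vx[of i] i True by (simp add: lift_bit_def unset_def)
      finally show ?thesis .
    qed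
    have "\<forall>g\<in>set (map (maj_gate C) ?is). \<forall>w\<in>gate_wires g. w < length z"
    proof (intro ballI)
      fix g w assume "g \<in> set (map (maj_gate C) ?is)" and w: "w \<in> gate_wires g"
      then obtain i where "unset C R i" "g = maj_gate C i" by auto
      then show "w < length z" using maj_gate_wires[of i] True w z by fastforce
    qed
    from wire_values_shallow[OF this, of "[]"]
    have wv: "wire_values (reduced C) z = z @ map (gate_value z \<circ> maj_gate C) ?is"
      using True by (simp add: wire_values_def reduced_def)
    have "eval_circuit (reduced C) z = y"
    proof (rule nth_equalityI)
      show "length (eval_circuit (reduced C) z) = length y" by (simp add: y)
      fix k assume k': "k < length (eval_circuit (reduced C) z)"
      then have k: "k < length ?is" using True by (simp add: reduced_def)
      have out: "outputs (reduced C) ! k = input_rank C N + k"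
        using True k rank_filter_nth[OF k] by (simp add: reduced_def output_rank_def)
      have "unset C R (?is ! k)" using nth_mem[OF k] by simp
      moreover have "eval_circuit (reduced C) z ! k = wire_values (reduced C) z ! (input_rank C N + k)"
        using k' by (simp add: eval_circuit_def out)
      ultimately show "eval_circuit (reduced C) z ! k = y ! k"
        using k gv[of "?is ! k"] rank_filter_nth[OF k] z
        by (simp add: wv nth_append output_rank_def)
    qed
    moreover have "length z = num_inputs (reduced C)" using True z by (simp add: reduced_def)
    ultimately show False using y(2) by (auto simp: circuit_range_def)
  next
    case False
    \<comment> \<open>The surviving stretch guarantees an unprescribed output even when no input is
      left.\<close>
    have "0 < output_rank C N" using rank_less by simp
    then have "?is ! 0 \<in> set ?is" unfolding output_rank_def by (intro nth_mem)
    then obtain i where i: "unset C R i" by auto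
    have "R a \<noteq> 0" if "kind C a = 7" for a
      using False unfixed_less[of a] that unfolding has_unfixed_def unfixed_def by auto
    then have "val C (fill 1 R) i = val C (completion A) i"
      by (intro val_cong) (auto simp: fill_def completion_def)
    then show False using vx[of i] i False by (simp add: lift_bit_def unset_def)
  qed
qed

end

section \<open>Evaluating circuits by a loop program\<close>

text \<open>Tape layout: tapes \<open>0\<close> and \<open>1\<close> receive the input words,
  \<open>2\<close> to \<open>7\<close> are working arrays, \<open>8\<close> to \<open>18\<close>
  counters, and \<open>19\<close>, the last of 20 tapes, receives the output. The programs never
  change \<open>zero_nv\<close>; it addresses cell \<open>0\<close>, where \<open>mark_ar\<close>
  and \<open>flag_ar\<close> keep single bits.\<close>

abbreviation (input) "in_ar \<equiv> 0 :: nat"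
abbreviation (input) "sol_ar \<equiv> 1 :: nat"
abbreviation (input) "kind_ar \<equiv> 2 :: nat"
abbreviation (input) "val_ar \<equiv> 3 :: nat"
abbreviation (input) "asg_ar \<equiv> 4 :: nat"
abbreviation (input) "res_ar \<equiv> 5 :: nat"
abbreviation (input) "mark_ar \<equiv> 6 :: nat"
abbreviation (input) "flag_ar \<equiv> 7 :: nat"
abbreviation (input) "pos_nv \<equiv> 8 :: nat"
abbreviation (input) "wire_nv \<equiv> 9 :: nat"
abbreviation (input) "top_nv \<equiv> 10 :: nat"
abbreviation (input) "round_nv \<equiv> 11 :: nat"
abbreviation (input) "i_nv \<equiv> 12 :: nat"
abbreviation (input) "a_nv \<equiv> 13 :: nat"
abbreviation (input) "b_nv \<equiv> 14 :: nat"
abbreviation (input) "out_nv \<equiv> 15 :: nat"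
abbreviation (input) "fill_nv \<equiv> 16 :: nat"
abbreviation (input) "sol_nv \<equiv> 17 :: nat"
abbreviation (input) "zero_nv \<equiv> 18 :: nat"
abbreviation (input) "out_ar \<equiv> 19 :: nat"

abbreviation (input) "nv_tapes \<equiv> {8..<19} :: nat set"

text \<open>
  One pass over the encoding appends the kind and value of every item. The kind of the last item
  serves as the parser state, and an output is treated as a conjunction with one operand. Operands
  are counted from \<open>1\<close> since items are.
\<close>

definition new_item :: "nat \<Rightarrow> nat \<Rightarrow> prog" where
  "new_item k v = Inc top_nv ;; Write kind_ar top_nv k ;; Write val_ar top_nv v ;;
     Zero wire_nv ;; Inc wire_nv"

text \<open>An item starts with a neutral value, \<open>2\<close> for conjunctions and outputs and
  \<open>1\<close> for disjunctions, and each terminated operand is folded in, so operands of an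
  item need not be counted. A symbol \<open>1\<close> belongs to an operand after a gate or output
  and is an input of its own otherwise.\<close>

definition scan_char :: prog where
  "scan_char =
     Ite (Cell in_ar pos_nv 1)
       (Ite (Cell kind_ar top_nv 3) (Inc wire_nv) (Ite (Cell kind_ar top_nv 4) (Inc wire_nv)
         (Ite (Cell kind_ar top_nv 6) (Inc wire_nv)
           (Inc top_nv ;; Write kind_ar top_nv 7 ;;
            Ite (Cell asg_ar top_nv 2) (Write val_ar top_nv 2) (Write val_ar top_nv 1)))))
     (Ite (Cell in_ar pos_nv 2)
       (Ite (Cell kind_ar top_nv 4)
          (Ite (Cell val_ar wire_nv 2) (Write val_ar top_nv 2) Skip)
          (Ite (Cell kind_ar top_nv 3) (Ite (Cell val_ar wire_nv 2) Skip (Write val_ar top_nv 1))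
            (Ite (Cell kind_ar top_nv 6) (Ite (Cell val_ar wire_nv 2) Skip (Write val_ar top_nv 1))
               Skip)) ;;
        Zero wire_nv ;; Inc wire_nv)
     (Ite (Cell in_ar pos_nv 4) (new_item 4 1)
     (Ite (Cell in_ar pos_nv 3) (new_item 3 2) (new_item 6 2))))"

definition eval_prog :: prog where
  "eval_prog = Zero top_nv ;; Zero wire_nv ;; Inc wire_nv ;; For pos_nv scan_char"

type_synonym scan_state = "nat \<times> nat \<times> (nat \<Rightarrow> nat) \<times> (nat \<Rightarrow> nat)"

text \<open>\<open>scan_char\<close> as a function on the four components it changes; the assignment
  \<open>X\<close> and the symbol \<open>c\<close> are parameters.\<close>

fun scan :: "(nat \<Rightarrow> nat) \<Rightarrow> nat \<Rightarrow> scan_state \<Rightarrow> scan_state" where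
  "scan X c (g, w, K, V) =
     (if c = 1 then
        if K g \<in> {3, 4, 6} then (g, Suc w, K, V)
        else (Suc g, w, K(Suc g := 7), V(Suc g := if X (Suc g) = 2 then 2 else 1))
      else if c = 2 then
        (g, 1, K, if K g = 4 then if V w = 2 then V(g := 2) else V
                  else if K g \<in> {3, 6} then if V w = 2 then V else V(g := 1) else V)
      else if c = 4 then (Suc g, 1, K(Suc g := 4), V(Suc g := 1))
      else if c = 3 then (Suc g, 1, K(Suc g := 3), V(Suc g := 2))
      else (Suc g, 1, K(Suc g := 6), V(Suc g := 2)))"

definition scan_view :: "store \<Rightarrow> scan_state" where
  "scan_view s = (nv s top_nv, nv s wire_nv, ar s kind_ar, ar s val_ar)"

lemma scan_view_scan_char:
  "scan_view (sem N scan_char s) = scan (ar s asg_ar) (ar s in_ar (nv s pos_nv)) (scan_view s)"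
  by (simp add: scan_view_def scan_char_def new_item_def)

lemma sem_For_invariant:
  assumes "I 0 s" "\<And>i s. i < N \<Longrightarrow> I i s \<Longrightarrow> I (Suc i) (sem N p (set_nv x i s))"
  obtains s' where "sem N (For x p) s = set_nv x N s'" "I N s'"
proof -
  let ?G = "\<lambda>n. fold (\<lambda>i s. sem N p (set_nv x i s)) [0..<n] s"
  have "I n (?G n)" if "n \<le> N" for n
    using that
  proof (induction n)
    case (Suc n)
    then show ?case using assms(2)[of n "?G n"] by simp
  qed (use assms(1) in simp)
  then show ?thesis using that[of "?G N"] by simp
qed

lemma sem_For_fold:
  assumes "P s" "\<And>i s. P s \<Longrightarrow> i < N \<Longrightarrow>
    view (sem N p (set_nv x i s)) = F i (view s) \<and> P (sem N p (set_nv x i s))"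
  obtains s' where "sem N (For x p) s = set_nv x N s'" "view s' = fold F [0..<N] (view s)" "P s'"
proof (rule sem_For_invariant[of "\<lambda>n t. view t = fold F [0..<n] (view s) \<and> P t" s N p x])
  fix i t assume "i < N" "view t = fold F [0..<i] (view s) \<and> P t"
  then show "view (sem N p (set_nv x i t)) = fold F [0..<Suc i] (view s) \<and> P (sem N p (set_nv x i t))"
    using assms(2)[of t i] by simp
qed (use assms(1) that in auto)

lemma fold_upt_nth: "fold (\<lambda>i. F (w ! i)) [0..<length w] s = fold F w s"
proof -
  have "fold (\<lambda>i. F (w ! i)) [0..<length w] s = fold F (map ((!) w) [0..<length w]) s"
    by (simp add: fold_map comp_def)
  then show ?thesis by (simp add: map_nth)
qed

definition input_ar :: "nat list \<Rightarrow> nat \<Rightarrow> nat" where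
  "input_ar w j = (if j < length w then w ! j else 0)"

lemma mods_scan_char [simp]: "mods scan_char = {kind_ar, val_ar, wire_nv, top_nv}"
  by (auto simp: scan_char_def new_item_def)

lemma mods_eval_prog [simp]: "mods eval_prog = {kind_ar, val_ar, wire_nv, top_nv, pos_nv}"
  by (auto simp: eval_prog_def)

lemma scan_view_eval_prog:
  assumes "ar s in_ar = input_ar w" "N = length w"
  shows "scan_view (sem N eval_prog s) =
    fold (scan (ar s asg_ar)) w (0, 1, ar s kind_ar, ar s val_ar)"
proof -
  let ?s = "set_nv wire_nv 1 (set_nv top_nv 0 s)"
  let ?P = "\<lambda>s' :: store. ar s' in_ar = input_ar w \<and> ar s' asg_ar = ar s asg_ar"
  let ?F = "\<lambda>i. scan (ar s asg_ar) (w ! i)"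
  obtain s' where s': "sem N (For pos_nv scan_char) ?s = set_nv pos_nv N s'"
    "scan_view s' = fold ?F [0..<N] (scan_view ?s)"
  proof (rule sem_For_fold[of ?P ?s N scan_view scan_char pos_nv ?F])
    show "?P ?s" using assms by simp
    fix i and t :: store assume t: "?P t" "i < N"
    then have "ar t in_ar i = w ! i" using assms(2) by (simp add: input_ar_def)
    then show "scan_view (sem N scan_char (set_nv pos_nv i t)) = ?F i (scan_view t) \<and>
        ?P (sem N scan_char (set_nv pos_nv i t))"
      using t by (simp add: scan_view_scan_char ar_frame) (simp add: scan_view_def)
  qed blast
  have "sem N eval_prog s = set_nv pos_nv N s'"
    using s'(1) by (simp add: eval_prog_def)
  then have "scan_view (sem N eval_prog s) = scan_view s'" by (simp add: scan_view_def)
  also have "\<dots> = fold (scan (ar s asg_ar)) w (scan_view ?s)"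
    unfolding s'(2) assms(2) by (rule fold_upt_nth)
  finally show ?thesis by (simp add: scan_view_def)
qed

section \<open>Scanning an encoding computes the trace\<close>

abbreviation (input) bit :: "bool \<Rightarrow> nat" where
  "bit b \<equiv> if b then 2 else 1"

text \<open>The arrays are not cleared between evaluations: a scan writes over the cells from
  \<open>1\<close> on and leaves old contents elsewhere.\<close>

definition overlay :: "(nat \<Rightarrow> nat) \<Rightarrow> nat list \<Rightarrow> nat \<Rightarrow> nat" where
  "overlay A L j = (if 0 < j \<and> j \<le> length L then L ! (j - 1) else A j)"

lemma overlay_snoc: "(overlay A L)(Suc (length L) := x) = overlay A (L @ [x])"
  by (auto simp: overlay_def fun_eq_iff nth_append)

lemma overlay_update: "(overlay A (L @ [x]))(Suc (length L) := y) = overlay A (L @ [y])"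
  by (auto simp: overlay_def fun_eq_iff nth_append)

lemma overlay_Nil [simp]: "overlay A [] = A"
  by (auto simp: overlay_def)

lemma overlay_Suc: "j < length L \<Longrightarrow> overlay A L (Suc j) = L ! j"
  by (simp add: overlay_def)

definition scanned :: "(nat \<Rightarrow> nat) \<Rightarrow> (nat \<Rightarrow> nat) \<Rightarrow> nat list \<Rightarrow> bool list \<Rightarrow> scan_state" where
  "scanned K V ks vs = (length ks, 1, overlay K ks, overlay V (map bit vs))"

lemma fold_scan_ones:
  "K g \<in> {3, 4, 6} \<Longrightarrow> fold (scan X) (replicate j 1) (g, w, K, V) = (g, w + j, K, V)"
  by (induction j arbitrary: w) auto

text \<open>The operand counter starts at \<open>1\<close>, so after \<open>j\<close> ones it points
  to item \<open>j + 1\<close>, which is wire \<open>j\<close>; the terminator folds that value into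
  the last item.\<close>

lemma fold_scan_operand:
  assumes "length vs = length ks" "j < length vs" "op \<in> {3, 4, 6}"
  shows "fold (scan X) (enc_nat j) (scanned K V (ks @ [op]) (vs @ [v])) =
    scanned K V (ks @ [op]) (vs @ [if op = 4 then v \<or> vs ! j else v \<and> vs ! j])"
proof -
  let ?K = "overlay K (ks @ [op])" and ?V = "overlay V (map bit (vs @ [v]))"
  let ?g = "Suc (length ks)"
  have K: "?K ?g = op" by (simp add: overlay_def nth_append)
  have V: "?V (Suc j) = bit (vs ! j)" using assms(2) by (simp add: overlay_Suc nth_append)
  have upd: "?V(?g := x) = overlay V (map bit vs @ [x])" for x
    using overlay_update[of V "map bit vs" "bit v" x] assms(1) by simp
  have "fold (scan X) (replicate j 1) (?g, 1, ?K, ?V) = (?g, 1 + j, ?K, ?V)"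
    using assms(3) K by (intro fold_scan_ones) simp
  then have "fold (scan X) (enc_nat j) (?g, 1, ?K, ?V) = scan X 2 (?g, 1 + j, ?K, ?V)"
    unfolding enc_nat_def by simp
  also have "\<dots> = (?g, 1, ?K, overlay V (map bit vs @ [bit (if op = 4 then v \<or> vs ! j else v \<and> vs ! j)]))"
    using assms(3) K V upd by auto
  finally show ?thesis by (simp add: scanned_def)
qed

lemma scan_opcode:
  assumes "length vs = length ks" "op \<in> {3, 4, 6}"
  shows "scan X op (scanned K V ks vs) = scanned K V (ks @ [op]) (vs @ [op \<noteq> 4])"
  using assms overlay_snoc[of K ks op] overlay_snoc[of V "map bit vs"] by (auto simp: scanned_def)

lemma fold_scan_gate:
  assumes "length vs = length ks" "monotone_gate g" "\<forall>w\<in>gate_wires g. w < length vs"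
  shows "fold (scan X) (enc_gate g) (scanned K V ks vs) =
    scanned K V (ks @ [opcode g]) (vs @ [gate_value vs g])"
  using assms by (cases g) (simp_all add: scan_opcode fold_scan_operand del: scan.simps)

lemma fold_scan_gates:
  assumes "length vs = length ks" "\<forall>g\<in>set gs. monotone_gate g"
    "\<forall>k<length gs. \<forall>w\<in>gate_wires (gs ! k). w < length vs + k"
  shows "fold (scan X) (concat (map enc_gate gs)) (scanned K V ks vs) =
    scanned K V (ks @ map opcode gs) (foldl (\<lambda>vs g. vs @ [gate_value vs g]) vs gs)"
  using assms
proof (induction gs arbitrary: ks vs)
  case (Cons g gs)
  have "\<forall>k<length gs. \<forall>w\<in>gate_wires (gs ! k). w < length (vs @ [gate_value vs g]) + k"
  proof (intro allI impI ballI)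
    fix k w assume "k < length gs" "w \<in> gate_wires (gs ! k)"
    then show "w < length (vs @ [gate_value vs g]) + k"
      using Cons.prems(3)[rule_format, of "Suc k" w] by simp
  qed
  moreover have "\<forall>w\<in>gate_wires g. w < length vs" using Cons.prems(3)[rule_format, of 0] by simp
  ultimately show ?case using Cons.prems Cons.IH[of "vs @ [gate_value vs g]" "ks @ [opcode g]"]
    by (simp add: fold_scan_gate)
qed simp

text \<open>\<open>us\<close> holds the outputs scanned so far; they lengthen the list of items, but
  operands refer only to the wires \<open>vs\<close>.\<close>

lemma fold_scan_outputs:
  assumes "length (vs @ us) = length ks" "\<forall>w\<in>set os. w < length vs"
  shows "fold (scan X) (concat (map (\<lambda>w. 6 # enc_nat w) os)) (scanned K V ks (vs @ us)) =
    scanned K V (ks @ replicate (length os) 6) (vs @ us @ map ((!) vs) os)"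
  using assms
proof (induction os arbitrary: ks us)
  case (Cons w os)
  have "fold (scan X) (6 # enc_nat w) (scanned K V ks (vs @ us)) =
      scanned K V (ks @ [6]) ((vs @ us) @ [vs ! w])"
    using Cons.prems
    by (simp add: scan_opcode fold_scan_operand nth_append del: scan.simps append_assoc)
  then show ?case using Cons.prems Cons.IH[of "us @ [vs ! w]" "ks @ [6]"]
    by (simp add: replicate_append_same)
qed simp

text \<open>Cell \<open>0\<close> must not look like a gate or an output, or the first
  \<open>1\<close> would be taken for part of an operand.\<close>

lemma fold_scan_inputs:
  assumes "K 0 = 0"
  shows "fold (scan X) (replicate n 1) (0, 1, K, V) =
    scanned K V (replicate n 7) (map (\<lambda>j. X (Suc j) = 2) [0..<n])"
proof (induction n)
  case (Suc n)
  have "overlay K (replicate n 7) n \<notin> {3, 4, 6}"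
    using assms by (auto simp: overlay_def)
  moreover have "replicate n 7 @ [7 :: nat] = replicate (Suc n) 7"
    by (simp add: replicate_append_same)
  ultimately show ?case using Suc overlay_snoc[of K "replicate n 7" 7]
      overlay_snoc[of V "map bit (map (\<lambda>j. X (Suc j) = 2) [0..<n])"]
    by (simp add: scanned_def replicate_append_same[symmetric] comp_def del: replicate_Suc)
qed (simp add: scanned_def)

lemma fold_scan_circuit:
  assumes "wf_circuit C" "\<forall>g\<in>set (gates C). monotone_gate g" "K 0 = 0"
  shows "fold (scan X) (enc_circuit C) (0, 1, K, V) =
    scanned K V (kinds C) (trace C (assignment C X))"
proof -
  let ?n = "num_inputs C"
  let ?x = "assignment C X"
  have "scan X 2 (scanned K V (replicate ?n 7) ?x) = scanned K V (replicate ?n 7) ?x"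
  proof -
    have "overlay K (replicate ?n 7) ?n \<notin> {3, 4, 6}" using assms(3) by (auto simp: overlay_def)
    then show ?thesis by (simp add: scanned_def)
  qed
  then have 1: "fold (scan X) (enc_nat ?n) (0, 1, K, V) = scanned K V (replicate ?n 7) ?x"
    using fold_scan_inputs[of K X ?n V] assms(3) by (simp add: enc_nat_def assignment_def)
  have 2: "fold (scan X) (concat (map enc_gate (gates C))) (scanned K V (replicate ?n 7) ?x) =
      scanned K V (replicate ?n 7 @ map opcode (gates C)) (wire_values C ?x)"
    unfolding wire_values_def using assms by (intro fold_scan_gates) (auto simp: wf_circuit_def)
  have 3: "fold (scan X) (concat (map (\<lambda>w. 6 # enc_nat w) (outputs C)))
      (scanned K V (replicate ?n 7 @ map opcode (gates C)) (wire_values C ?x @ [])) =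
      scanned K V ((replicate ?n 7 @ map opcode (gates C)) @ replicate (num_outputs C) 6)
        (wire_values C ?x @ [] @ map ((!) (wire_values C ?x)) (outputs C))"
    using assms(1) by (intro fold_scan_outputs) (auto simp: wf_circuit_def length_wire_values)
  show ?thesis
    using 1 2 3 by (simp add: enc_circuit_def kinds_def trace_def eval_circuit_def)
qed

definition ready :: "circuit \<Rightarrow> store \<Rightarrow> bool" where
  "ready C s \<longleftrightarrow> ar s in_ar = input_ar (enc_circuit C) \<and> ar s kind_ar = kind C"

lemma overlay_kinds:
  assumes "\<And>j. kind C j = 0 \<Longrightarrow> K j = 0"
  shows "overlay K (kinds C) = kind C"
proof
  fix j
  have "opcode g \<noteq> 0" for g by (cases g) auto
  then have "kinds C ! (j - 1) \<noteq> 0" if "0 < j" "j \<le> length (kinds C)"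
    using that by (auto simp: kinds_def nth_append)
  then show "overlay K (kinds C) j = kind C j"
    using assms[of j] by (auto simp: overlay_def kind_def)
qed

locale monotone_circuit =
  fixes C :: circuit
  assumes wf: "wf_circuit C" and monotone: "\<forall>g\<in>set (gates C). monotone_gate g"
begin

abbreviation "N \<equiv> size_enc C"

text \<open>The premise on kinds holds for blank tapes and again after every evaluation, so the
  program can be rerun with other assignments.\<close>

lemma eval_prog:
  assumes "ar s in_ar = input_ar (enc_circuit C)" "\<And>j. kind C j = 0 \<Longrightarrow> ar s kind_ar j = 0"
  shows "ready C (sem N eval_prog s)"
    "kind C i \<noteq> 0 \<Longrightarrow> ar (sem N eval_prog s) val_ar i = bit (val C (ar s asg_ar) i)"
proof -
  let ?x = "assignment C (ar s asg_ar)"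
  have "kind C 0 = 0" by (simp add: kind_def)
  then have "scan_view (sem N eval_prog s) =
      scanned (ar s kind_ar) (ar s val_ar) (kinds C) (trace C ?x)"
    using scan_view_eval_prog[OF assms(1) refl] fold_scan_circuit[OF wf monotone] assms(2)[of 0] by simp
  then have v: "ar (sem N eval_prog s) kind_ar = overlay (ar s kind_ar) (kinds C)"
    "ar (sem N eval_prog s) val_ar = overlay (ar s val_ar) (map bit (trace C ?x))"
    by (simp_all add: scan_view_def scanned_def)
  show "ready C (sem N eval_prog s)"
    using v(1) overlay_kinds[of C "ar s kind_ar"] assms by (simp add: ready_def ar_frame)
  assume "kind C i \<noteq> 0"
  then have "0 < i" "i \<le> length (kinds C)" by (auto simp: kind_def split: if_splits)
  then show "ar (sem N eval_prog s) val_ar i = bit (val C (ar s asg_ar) i)"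
    using v(2) by (simp add: overlay_def length_kinds length_trace val_def)
qed

end

section \<open>The forcing algorithm as a loop program\<close>

text \<open>Programs write constant symbols only, so copying a cell takes a case distinction.
  Afterwards it only matters which entries equal \<open>2\<close>.\<close>

definition fill_prog :: "nat \<Rightarrow> prog" where
  "fill_prog d = For fill_nv (Ite (Cell res_ar fill_nv 0) (Write asg_ar fill_nv d)
     (Ite (Cell res_ar fill_nv 2) (Write asg_ar fill_nv 2) (Write asg_ar fill_nv 1)))"

definition probe_prog :: "nat \<Rightarrow> nat \<Rightarrow> prog" where
  "probe_prog d e = fill_prog d ;; Write asg_ar a_nv e ;; eval_prog"

definition when_unfixed :: "nat \<Rightarrow> prog \<Rightarrow> prog" where
  "when_unfixed x p = Ite (Cell kind_ar x 7) (Ite (Cell res_ar x 0) p Skip) Skip"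

definition when_unset :: "nat \<Rightarrow> prog \<Rightarrow> prog" where
  "when_unset x p = Ite (Cell kind_ar x 6) (Ite (Cell res_ar x 0) p Skip) Skip"

definition force_prog :: prog where
  "force_prog = when_unset i_nv (when_unfixed a_nv
     (probe_prog 2 1 ;; Ite (Cell val_ar i_nv 1) (Write res_ar i_nv 2 ;; Write res_ar a_nv 2)
       (probe_prog 1 2 ;; Ite (Cell val_ar i_nv 2) (Write res_ar i_nv 1 ;; Write res_ar a_nv 1)
         Skip)))"

text \<open>The first evaluation is run for the kinds, which all later tests read; the last loop
  records in \<open>flag_ar\<close> whether an undetermined input is left.\<close>

definition forced_prog :: prog where
  "forced_prog = eval_prog ;; For round_nv (For i_nv (For a_nv force_prog)) ;;
     For a_nv (when_unfixed a_nv (Write flag_ar zero_nv 1))"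

lemma mods_fill_prog [simp]: "mods (fill_prog d) = {asg_ar, fill_nv}"
  by (auto simp: fill_prog_def)

lemma mods_probe_prog [simp]:
  "mods (probe_prog d e) = {asg_ar, fill_nv, kind_ar, val_ar, wire_nv, top_nv, pos_nv}"
  by (auto simp: probe_prog_def)

lemma mods_when [simp]: "mods (when_unfixed x p) = mods p" "mods (when_unset x p) = mods p"
  by (auto simp: when_unfixed_def when_unset_def)

lemma mods_force_prog [simp]: "mods force_prog =
    {asg_ar, fill_nv, kind_ar, val_ar, wire_nv, top_nv, pos_nv, res_ar}"
  by (auto simp: force_prog_def)

lemma ready_frame: "ready C s \<Longrightarrow> {in_ar, kind_ar} \<inter> mods p = {} \<Longrightarrow> ready C (sem N p s)"
  by (simp add: ready_def ar_frame)

lemma ready_set_nv [simp]: "ready C (set_nv x i s) = ready C s"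
  by (simp add: ready_def)

lemma ready_set_ar [simp]: "A \<noteq> in_ar \<Longrightarrow> A \<noteq> kind_ar \<Longrightarrow> ready C (set_ar A i c s) = ready C s"
  by (simp add: ready_def)

lemma sem_when_unfixed: "ready C s \<Longrightarrow> sem N (when_unfixed x p) s =
    (if unfixed C (ar s res_ar) (nv s x) then sem N p s else s)"
  and sem_when_unset: "ready C s \<Longrightarrow> sem N (when_unset x p) s =
    (if unset C (ar s res_ar) (nv s x) then sem N p s else s)"
  by (simp_all add: when_unfixed_def when_unset_def unfixed_def unset_def ready_def)

lemma fill_prog:
  assumes "j < N"
  shows "ar (sem N (fill_prog d) s) asg_ar j = 2 \<longleftrightarrow> fill d (ar s res_ar) j = 2"
proof (rule sem_For_invariant[of "\<lambda>n (t :: store). ar t res_ar = ar s res_ar \<and>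
    (\<forall>j<n. ar t asg_ar j = 2 \<longleftrightarrow> fill d (ar s res_ar) j = 2)" s N _ fill_nv])
  fix n and t :: store assume "ar t res_ar = ar s res_ar \<and>
    (\<forall>j<n. ar t asg_ar j = 2 \<longleftrightarrow> fill d (ar s res_ar) j = 2)"
  then show "ar (sem N (Ite (Cell res_ar fill_nv 0) (Write asg_ar fill_nv d)
     (Ite (Cell res_ar fill_nv 2) (Write asg_ar fill_nv 2) (Write asg_ar fill_nv 1)))
       (set_nv fill_nv n t)) res_ar = ar s res_ar \<and>
    (\<forall>j<Suc n. ar (sem N (Ite (Cell res_ar fill_nv 0) (Write asg_ar fill_nv d)
     (Ite (Cell res_ar fill_nv 2) (Write asg_ar fill_nv 2) (Write asg_ar fill_nv 1)))
       (set_nv fill_nv n t)) asg_ar j = 2 \<longleftrightarrow> fill d (ar s res_ar) j = 2)"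
    by (auto simp: fill_def less_Suc_eq)
qed (use assms in \<open>auto simp: fill_prog_def\<close>)

context monotone_circuit
begin

lemma ready_eval_prog: "ready C s \<Longrightarrow> ready C (sem N eval_prog s)"
  by (rule eval_prog) (auto simp: ready_def)

lemma val_eval_prog:
  assumes "ready C s" "\<And>j. kind C j = 7 \<Longrightarrow> ar s asg_ar j = 2 \<longleftrightarrow> X j = 2" "kind C i \<noteq> 0"
  shows "ar (sem N eval_prog s) val_ar i = bit (val C X i)"
  using eval_prog(2)[of s i] assms val_cong[of C "ar s asg_ar" X i] by (simp add: ready_def)

lemma ready_probe_prog: "ready C s \<Longrightarrow> ready C (sem N (probe_prog d e) s)"
  by (auto simp: probe_prog_def intro!: ready_eval_prog ready_frame)

lemma val_probe_prog:
  assumes "ready C s" "kind C i \<noteq> 0"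
  shows "ar (sem N (probe_prog d e) s) val_ar i =
    bit (val C ((fill d (ar s res_ar))(nv s a_nv := e)) i)"
  unfolding probe_prog_def sem.simps(5)
proof (rule val_eval_prog)
  show "ready C (sem N (Write asg_ar a_nv e) (sem N (fill_prog d) s))"
    using assms(1) by (simp add: ready_frame)
  fix j assume "kind C j = 7"
  then have "j < N" using kind_less_size by simp
  from fill_prog[OF this, of d s]
  show "ar (sem N (Write asg_ar a_nv e) (sem N (fill_prog d) s)) asg_ar j = 2 \<longleftrightarrow>
      ((fill d (ar s res_ar))(nv s a_nv := e)) j = 2"
    by (simp add: nv_frame)
qed (rule assms)

lemma force_prog:
  assumes "ready C s"
  shows "ar (sem N force_prog s) res_ar = force C (nv s i_nv) (nv s a_nv) (ar s res_ar) \<and>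
    ready C (sem N force_prog s)"
proof (cases "unset C (ar s res_ar) (nv s i_nv) \<and> unfixed C (ar s res_ar) (nv s a_nv)")
  case True
  then have i: "kind C (nv s i_nv) \<noteq> 0" by (simp add: unset_def)
  let ?s1 = "sem N (probe_prog 2 1) s"
  let ?s2 = "sem N (probe_prog 1 2) ?s1"
  have r1: "ready C ?s1" using assms by (rule ready_probe_prog)
  have r2: "ready C ?s2" using r1 by (rule ready_probe_prog)
  have f: "nv ?s1 i_nv = nv s i_nv" "nv ?s1 a_nv = nv s a_nv" "ar ?s1 res_ar = ar s res_ar"
    "nv ?s2 i_nv = nv s i_nv" "nv ?s2 a_nv = nv s a_nv" "ar ?s2 res_ar = ar s res_ar"
    by (simp_all add: nv_frame ar_frame)
  have v: "ar ?s1 val_ar (nv s i_nv) = bit (val C ((fill 2 (ar s res_ar))(nv s a_nv := 1)) (nv s i_nv))"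
    "ar ?s2 val_ar (nv s i_nv) = bit (val C ((fill 1 (ar s res_ar))(nv s a_nv := 2)) (nv s i_nv))"
    using val_probe_prog[OF assms i, of 2 1] val_probe_prog[OF r1 i, of 1 2]
    by (simp_all only: f)
  show ?thesis using assms True f v r1 r2
    by (auto simp: force_prog_def sem_when_unset sem_when_unfixed force_def)
next
  case False
  then have "sem N force_prog s = s"
    using assms by (auto simp: force_prog_def sem_when_unset sem_when_unfixed)
  then show ?thesis using assms False by (auto simp: force_def)
qed

lemma force_prog_loop:
  assumes "ready C s"
  shows "ar (sem N (For a_nv force_prog) s) res_ar = fold (force C (nv s i_nv)) [0..<N] (ar s res_ar)"
    "ready C (sem N (For a_nv force_prog) s)"
proof -
  obtain s' where s': "sem N (For a_nv force_prog) s = set_nv a_nv N s'"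
    "ar s' res_ar = fold (force C (nv s i_nv)) [0..<N] (ar s res_ar)"
    "ready C s' \<and> nv s' i_nv = nv s i_nv"
  proof (rule sem_For_fold[of "\<lambda>t. ready C t \<and> nv t i_nv = nv s i_nv" s N "\<lambda>t. ar t res_ar"
        force_prog a_nv "force C (nv s i_nv)"])
    fix a t assume "ready C t \<and> nv t i_nv = nv s i_nv"
    then show "ar (sem N force_prog (set_nv a_nv a t)) res_ar = force C (nv s i_nv) a (ar t res_ar) \<and>
        ready C (sem N force_prog (set_nv a_nv a t)) \<and>
        nv (sem N force_prog (set_nv a_nv a t)) i_nv = nv s i_nv"
      using force_prog[of "set_nv a_nv a t"] by (simp add: nv_frame)
  qed (use assms in auto)
  show "ar (sem N (For a_nv force_prog) s) res_ar = fold (force C (nv s i_nv)) [0..<N] (ar s res_ar)"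
    "ready C (sem N (For a_nv force_prog) s)"
    unfolding s'(1) using s' by simp_all
qed

lemma force_round_prog:
  assumes "ready C s"
  shows "ar (sem N (For i_nv (For a_nv force_prog)) s) res_ar = force_round C (ar s res_ar)"
    "ready C (sem N (For i_nv (For a_nv force_prog)) s)"
proof -
  obtain s' where s': "sem N (For i_nv (For a_nv force_prog)) s = set_nv i_nv N s'"
    "ar s' res_ar = fold (\<lambda>i. fold (force C i) [0..<N]) [0..<N] (ar s res_ar)" "ready C s'"
  proof (rule sem_For_fold[of "ready C" s N "\<lambda>t. ar t res_ar"
        "For a_nv force_prog" i_nv "\<lambda>i. fold (force C i) [0..<N]"])
    fix i t assume "ready C t"
    then show "ar (sem N (For a_nv force_prog) (set_nv i_nv i t)) res_ar =
        fold (force C i) [0..<N] (ar t res_ar) \<and>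
        ready C (sem N (For a_nv force_prog) (set_nv i_nv i t))"
      using force_prog_loop[of "set_nv i_nv i t"] by (simp del: sem.simps)
  qed (use assms in auto)
  show "ar (sem N (For i_nv (For a_nv force_prog)) s) res_ar = force_round C (ar s res_ar)"
    "ready C (sem N (For i_nv (For a_nv force_prog)) s)"
    unfolding s'(1) using s' by (simp_all add: force_round_def)
qed

lemma fold_const: "fold (\<lambda>i. f) [0..<n] x = (f ^^ n) x"
  by (induction n) auto

lemma force_rounds_prog:
  assumes "ready C s"
  shows "ar (sem N (For round_nv (For i_nv (For a_nv force_prog))) s) res_ar =
      (force_round C ^^ N) (ar s res_ar)"
    "ready C (sem N (For round_nv (For i_nv (For a_nv force_prog))) s)"
proof -
  obtain s' where s': "sem N (For round_nv (For i_nv (For a_nv force_prog))) s = set_nv round_nv N s'"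
    "ar s' res_ar = fold (\<lambda>i. force_round C) [0..<N] (ar s res_ar)" "ready C s'"
  proof (rule sem_For_fold[of "ready C" s N "\<lambda>t. ar t res_ar"
        "For i_nv (For a_nv force_prog)" round_nv "\<lambda>i. force_round C"])
    fix i t assume "ready C t"
    then show "ar (sem N (For i_nv (For a_nv force_prog)) (set_nv round_nv i t)) res_ar =
        force_round C (ar t res_ar) \<and>
        ready C (sem N (For i_nv (For a_nv force_prog)) (set_nv round_nv i t))"
      using force_round_prog[of "set_nv round_nv i t"] by (simp del: sem.simps)
  qed (use assms in auto)
  show "ar (sem N (For round_nv (For i_nv (For a_nv force_prog))) s) res_ar =
      (force_round C ^^ N) (ar s res_ar)"
    "ready C (sem N (For round_nv (For i_nv (For a_nv force_prog))) s)"
    unfolding s'(1) using s' by (simp_all add: fold_const)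
qed

end

definition solved :: "circuit \<Rightarrow> store \<Rightarrow> bool" where
  "solved C s \<longleftrightarrow> ready C s \<and> ar s res_ar = forced C \<and>
     (ar s flag_ar 0 = 1 \<longleftrightarrow> has_unfixed C) \<and> nv s zero_nv = 0"

lemma solved_frame:
  "solved C s \<Longrightarrow> {in_ar, kind_ar, res_ar, flag_ar, zero_nv} \<inter> mods p = {} \<Longrightarrow> solved C (sem N p s)"
  by (simp add: solved_def ar_frame nv_frame ready_def)

lemma solved_ready: "solved C s \<Longrightarrow> ready C s"
  by (simp add: solved_def)

lemma solved_set_nv [simp]: "x \<noteq> zero_nv \<Longrightarrow> solved C (set_nv x i s) = solved C s"
  by (simp add: solved_def)

lemma mods_forced_prog [simp]: "mods forced_prog =
    {asg_ar, fill_nv, kind_ar, val_ar, wire_nv, top_nv, pos_nv, res_ar, round_nv, i_nv, a_nv, flag_ar}"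
  by (auto simp: forced_prog_def)

context monotone_circuit
begin

lemma solved_forced_prog:
  assumes "ar s in_ar = input_ar (enc_circuit C)" "\<forall>A\<in>{kind_ar, res_ar, flag_ar}. ar s A = (\<lambda>j. 0)"
    "nv s zero_nv = 0"
  shows "solved C (sem N forced_prog s)"
proof -
  let ?s1 = "sem N eval_prog s"
  let ?s2 = "sem N (For round_nv (For i_nv (For a_nv force_prog))) ?s1"
  have r1: "ready C ?s1" using assms by (intro eval_prog) auto
  have r2: "ready C ?s2" using r1 by (rule force_rounds_prog)
  have R: "ar ?s2 res_ar = forced C"
    unfolding force_rounds_prog(1)[OF r1] using assms(2) by (simp add: ar_frame forced_def)
  have z: "nv ?s2 zero_nv = 0" using assms(3) by (simp add: nv_frame del: sem.simps)
  have f: "ar ?s2 flag_ar = (\<lambda>j. 0)" using assms(2) by (simp add: ar_frame del: sem.simps)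
  obtain s' where s': "sem N (For a_nv (when_unfixed a_nv (Write flag_ar zero_nv 1))) ?s2 = set_nv a_nv N s'"
    "ready C s' \<and> ar s' res_ar = forced C \<and> nv s' zero_nv = 0 \<and>
      (ar s' flag_ar 0 = 1 \<longleftrightarrow> (\<exists>a<N. unfixed C (forced C) a))"
  proof (rule sem_For_invariant[of "\<lambda>n t. ready C t \<and> ar t res_ar = forced C \<and> nv t zero_nv = 0 \<and>
      (ar t flag_ar 0 = 1 \<longleftrightarrow> (\<exists>a<n. unfixed C (forced C) a))" ?s2 N
      "when_unfixed a_nv (Write flag_ar zero_nv 1)" a_nv])
    fix n t assume "ready C t \<and> ar t res_ar = forced C \<and> nv t zero_nv = 0 \<and>
      (ar t flag_ar 0 = 1 \<longleftrightarrow> (\<exists>a<n. unfixed C (forced C) a))"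
    then show "ready C (sem N (when_unfixed a_nv (Write flag_ar zero_nv 1)) (set_nv a_nv n t)) \<and>
        ar (sem N (when_unfixed a_nv (Write flag_ar zero_nv 1)) (set_nv a_nv n t)) res_ar = forced C \<and>
        nv (sem N (when_unfixed a_nv (Write flag_ar zero_nv 1)) (set_nv a_nv n t)) zero_nv = 0 \<and>
        (ar (sem N (when_unfixed a_nv (Write flag_ar zero_nv 1)) (set_nv a_nv n t)) flag_ar 0 = 1 \<longleftrightarrow>
          (\<exists>a<Suc n. unfixed C (forced C) a))"
      by (cases "unfixed C (forced C) n") (auto simp: sem_when_unfixed less_Suc_eq)
  qed (use r2 R z f in auto)
  have "sem N forced_prog s = set_nv a_nv N s'"
    unfolding forced_prog_def sem.simps(5) s'(1) ..
  then show ?thesis using s'(2) by (simp add: solved_def has_unfixed_def)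
qed

end

declare One_nat_def [simp del]

section \<open>Writing the outputs\<close>

definition written :: "store \<Rightarrow> nat list \<Rightarrow> bool" where
  "written s ws \<longleftrightarrow> nv s out_nv = length ws \<and> ar s out_ar = input_ar ws"

definition emit :: "nat \<Rightarrow> prog" where
  "emit c = Write out_ar out_nv c ;; Inc out_nv"

primrec emit_word :: "nat list \<Rightarrow> prog" where
  "emit_word [] = Skip"
| "emit_word (c # cs) = emit c ;; emit_word cs"

lemma mods_emit [simp]: "mods (emit c) = {out_ar, out_nv}"
  by (auto simp: emit_def)

lemma written_emit: "written s ws \<Longrightarrow> written (sem N (emit c) s) (ws @ [c])"
  by (auto simp: written_def emit_def input_ar_def fun_eq_iff nth_append)

lemma written_emit_word: "written s ws \<Longrightarrow> written (sem N (emit_word cs) s) (ws @ cs)"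
proof (induction cs arbitrary: s ws)
  case (Cons c cs)
  then show ?case using Cons.IH[OF written_emit[OF Cons.prems, of N c]] by simp
qed simp

lemma written_frame: "written s ws \<Longrightarrow> {out_nv, out_ar} \<inter> mods p = {} \<Longrightarrow> written (sem N p s) ws"
  by (simp add: written_def nv_frame ar_frame)

lemma written_set_nv [simp]: "x \<noteq> out_nv \<Longrightarrow> written (set_nv x i s) ws = written s ws"
  by (simp add: written_def)

lemma written_set_ar [simp]: "A \<noteq> out_ar \<Longrightarrow> written (set_ar A i c s) ws = written s ws"
  by (simp add: written_def)

lemma written_For:
  assumes "Q 0 s" "written s ws"
    and "\<And>i t us. i < N \<Longrightarrow> Q i t \<Longrightarrow> written t us \<Longrightarrow>
      Q (Suc i) (sem N p (set_nv x i t)) \<and> written (sem N p (set_nv x i t)) (us @ F i)"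
  obtains s' where "sem N (For x p) s = set_nv x N s'" "Q N s'"
    "written s' (ws @ concat (map F [0..<N]))"
proof (rule sem_For_invariant[of "\<lambda>n t. Q n t \<and> written t (ws @ concat (map F [0..<n]))" s N p x])
  fix i t assume "i < N" "Q i t \<and> written t (ws @ concat (map F [0..<i]))"
  then show "Q (Suc i) (sem N p (set_nv x i t)) \<and>
      written (sem N p (set_nv x i t)) (ws @ concat (map F [0..<Suc i]))"
    using assms(3)[of i t "ws @ concat (map F [0..<i])"] by simp
qed (use assms(1,2) that in auto)

lemma concat_map_if: "concat (map (\<lambda>x. if P x then f x else []) xs) = concat (map f (filter P xs))"
  by (induction xs) auto

lemma filter_below: "a \<le> N \<Longrightarrow> filter (\<lambda>b. b < a \<and> P b) [0..<N] = filter P [0..<(a :: nat)]"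
proof -
  assume "a \<le> N"
  then have "[0..<N] = [0..<a] @ [a..<N]" using upt_add_eq_append[of 0 a "N - a"] by simp
  then show ?thesis by (auto intro: filter_cong)
qed

section \<open>Programs printing the majority circuit and the lifted string\<close>

definition emit_inputs :: prog where
  "emit_inputs = For b_nv (when_unfixed b_nv (emit 1))"

text \<open>Ranks are never stored: in unary, printing a \<open>1\<close> for each smaller candidate
  prints the rank, and two such sequences in a row print a sum.\<close>

definition emit_inputs_below :: prog where
  "emit_inputs_below = For b_nv (Ite (Less b_nv a_nv) (when_unfixed b_nv (emit 1)) Skip)"

definition emit_outputs_below :: prog where
  "emit_outputs_below = For b_nv (Ite (Less b_nv i_nv) (when_unset b_nv (emit 1)) Skip)"

definition relevance_prog :: prog where
  "relevance_prog = fill_prog 1 ;; Write asg_ar a_nv 2 ;; Write asg_ar b_nv 2 ;; eval_prog ;;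
     Ite (Cell val_ar i_nv 2) (Write mark_ar zero_nv 1) Skip"

text \<open>\<open>mark_ar\<close> realises the existential quantifier in \<open>relevant\<close>:
  it is cleared for each \<open>a\<close> and set by any witness \<open>b\<close>.\<close>

definition gate_input_prog :: prog where
  "gate_input_prog = when_unfixed a_nv
     (Write mark_ar zero_nv 0 ;; For b_nv (when_unfixed b_nv relevance_prog) ;;
      Ite (Cell mark_ar zero_nv 1) (emit_inputs_below ;; emit 2) Skip)"

definition emit_gates :: prog where
  "emit_gates = For i_nv (when_unset i_nv (emit 5 ;; For a_nv gate_input_prog))"

definition emit_outputs :: prog where
  "emit_outputs =
     For i_nv (when_unset i_nv (emit 6 ;; emit_inputs ;; emit_outputs_below ;; emit 2))"

definition reduce_prog :: prog where
  "reduce_prog = forced_prog ;; Ite (Cell flag_ar zero_nv 1)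
     (emit_inputs ;; emit 2 ;; emit_gates ;; emit_outputs)
     (emit_word (enc_circuit (Circuit 3 [Maj 0 1 2] [3, 3, 3, 3])))"

text \<open>The solution is read sequentially: \<open>sol_nv\<close> moves on exactly at the
  unprescribed outputs, so it equals their rank.\<close>

definition lift_bit_prog :: prog where
  "lift_bit_prog = Ite (Cell kind_ar i_nv 6)
     (Ite (Cell res_ar i_nv 1) (emit 1) (Ite (Cell res_ar i_nv 2) (emit 2)
        (Ite (Cell flag_ar zero_nv 1)
           (Ite (Cell sol_ar sol_nv 2) (emit 2) (emit 1) ;; Inc sol_nv)
           (Ite (Cell val_ar i_nv 2) (emit 1) (emit 2))))) Skip"

definition lift_prog :: prog where
  "lift_prog = forced_prog ;; fill_prog 1 ;; eval_prog ;; For i_nv lift_bit_prog"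

lemma mods_emits [simp]:
  "mods emit_inputs = {out_ar, out_nv, b_nv}"
  "mods emit_inputs_below = {out_ar, out_nv, b_nv}"
  "mods emit_outputs_below = {out_ar, out_nv, b_nv}"
  by (auto simp: emit_inputs_def emit_inputs_below_def emit_outputs_below_def)

lemma mods_relevance_prog [simp]: "mods relevance_prog =
    {asg_ar, fill_nv, kind_ar, val_ar, wire_nv, top_nv, pos_nv, mark_ar}"
  by (auto simp: relevance_prog_def)

section \<open>Correctness of the printing programs\<close>

context monotone_circuit
begin

text \<open>Common core of the loops that print ranks; the preserved counters \<open>a_nv\<close>
  and \<open>i_nv\<close> are the thresholds in the bounded ones.\<close>

lemma written_count:
  assumes s: "solved C s" "written s ws" and p: "mods p \<subseteq> {out_ar, out_nv}"
    and emits: "\<And>b t us. b < N \<Longrightarrow> solved C t \<Longrightarrow> nv t a_nv = nv s a_nv \<Longrightarrow> nv t i_nv = nv s i_nv \<Longrightarrow>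
      nv t b_nv = b \<Longrightarrow> written t us \<Longrightarrow> written (sem N p t) (us @ (if P b then [1] else []))"
  shows "written (sem N (For b_nv p) s) (ws @ replicate (length (filter P [0..<N])) 1)"
proof -
  obtain s' where s': "sem N (For b_nv p) s = set_nv b_nv N s'"
    "written s' (ws @ concat (map (\<lambda>b. if P b then [1] else []) [0..<N]))"
  proof (rule written_For[of "\<lambda>n t. solved C t \<and> nv t a_nv = nv s a_nv \<and> nv t i_nv = nv s i_nv"
        s ws N p b_nv "\<lambda>b. if P b then [1] else []"])
    fix b t us
    assume t: "b < N" "solved C t \<and> nv t a_nv = nv s a_nv \<and> nv t i_nv = nv s i_nv" "written t us"
    have "solved C (sem N p (set_nv b_nv b t))" using t p by (intro solved_frame) auto
    moreover have "nv (sem N p (set_nv b_nv b t)) a_nv = nv s a_nv"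
      "nv (sem N p (set_nv b_nv b t)) i_nv = nv s i_nv"
    proof -
      have "a_nv \<notin> mods p" "i_nv \<notin> mods p" using p by auto
      then show "nv (sem N p (set_nv b_nv b t)) a_nv = nv s a_nv"
        "nv (sem N p (set_nv b_nv b t)) i_nv = nv s i_nv"
        using t by (simp_all add: nv_frame)
    qed
    ultimately show "(solved C (sem N p (set_nv b_nv b t)) \<and>
        nv (sem N p (set_nv b_nv b t)) a_nv = nv s a_nv \<and>
        nv (sem N p (set_nv b_nv b t)) i_nv = nv s i_nv) \<and>
        written (sem N p (set_nv b_nv b t)) (us @ (if P b then [1] else []))"
      using t emits[of b "set_nv b_nv b t" us] by simp
  qed (use s in auto)
  then show ?thesis by (simp add: concat_map_if map_replicate_const)
qed

lemma written_emit_inputs: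
  assumes "solved C s" "written s ws"
  shows "written (sem N emit_inputs s) (ws @ replicate (input_rank C N) 1)"
  unfolding emit_inputs_def input_rank_def using assms
  by (intro written_count) (auto simp: sem_when_unfixed[of C] solved_ready written_emit solved_def simp del: sem.simps)

lemma written_emit_inputs_below:
  assumes "solved C s" "written s ws" "nv s a_nv \<le> N"
  shows "written (sem N emit_inputs_below s) (ws @ replicate (input_rank C (nv s a_nv)) 1)"
  unfolding emit_inputs_below_def input_rank_def filter_below[OF assms(3), symmetric] using assms(1,2)
  by (intro written_count) (auto simp: sem_when_unfixed[of C] solved_def written_emit)

lemma written_emit_outputs_below:
  assumes "solved C s" "written s ws" "nv s i_nv \<le> N"
  shows "written (sem N emit_outputs_below s) (ws @ replicate (output_rank C (nv s i_nv)) 1)"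
  unfolding emit_outputs_below_def output_rank_def filter_below[OF assms(3), symmetric] using assms(1,2)
  by (intro written_count) (auto simp: sem_when_unset[of C] solved_def written_emit)

lemma solved_eval_prog: "solved C s \<Longrightarrow> solved C (sem N eval_prog s)"
  by (simp add: solved_def ready_eval_prog ar_frame nv_frame)

lemma relevance_prog:
  assumes s: "solved C s" and i: "kind C (nv s i_nv) = 6"
  shows "solved C (sem N relevance_prog s)"
    "ar (sem N relevance_prog s) mark_ar 0 =
      (if val C ((fill 1 (forced C))(nv s a_nv := 2, nv s b_nv := 2)) (nv s i_nv) then 1
       else ar s mark_ar 0)"
proof -
  let ?s1 = "sem N (fill_prog 1) s"
  let ?s2 = "set_ar asg_ar (nv s b_nv) 2 (set_ar asg_ar (nv s a_nv) 2 ?s1)"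
  let ?s3 = "sem N eval_prog ?s2"
  have s1: "solved C ?s1" using s by (intro solved_frame) auto
  then have s2: "solved C ?s2" by (simp add: solved_def)
  then have s3: "solved C ?s3" by (rule solved_eval_prog)
  have f1: "nv ?s1 x = nv s x" if "x \<noteq> fill_nv" "x \<noteq> asg_ar" for x using that by (simp add: nv_frame)
  have f3: "nv ?s3 i_nv = nv s i_nv" "ar ?s3 mark_ar = ar s mark_ar" "nv ?s3 zero_nv = nv s zero_nv"
    by (simp_all add: nv_frame ar_frame)
  have "ar ?s3 val_ar (nv s i_nv) =
      bit (val C ((fill 1 (forced C))(nv s a_nv := 2, nv s b_nv := 2)) (nv s i_nv))"
  proof (rule val_eval_prog)
    fix j assume "kind C j = 7"
    then have "j < N" using kind_less_size by simp
    from fill_prog[OF this, of 1 s]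
    show "ar ?s2 asg_ar j = 2 \<longleftrightarrow> ((fill 1 (forced C))(nv s a_nv := 2, nv s b_nv := 2)) j = 2"
      using s by (simp add: solved_def)
  qed (use s2 i in \<open>auto simp: solved_ready\<close>)
  moreover have "sem N relevance_prog s = sem N (Ite (Cell val_ar i_nv 2) (Write mark_ar zero_nv 1) Skip) ?s3"
    by (simp add: relevance_prog_def f1)
  moreover have "nv s zero_nv = 0" using s by (simp add: solved_def)
  ultimately show "solved C (sem N relevance_prog s)"
    "ar (sem N relevance_prog s) mark_ar 0 =
      (if val C ((fill 1 (forced C))(nv s a_nv := 2, nv s b_nv := 2)) (nv s i_nv) then 1
       else ar s mark_ar 0)"
    using s3 f3 by (auto simp: solved_def)
qed

lemma mark_loop:
  assumes s: "solved C s" and i: "kind C (nv s i_nv) = 6" and a: "unfixed C (forced C) (nv s a_nv)"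
    and w: "written s ws"
  defines "p \<equiv> Write mark_ar zero_nv 0 ;; For b_nv (when_unfixed b_nv relevance_prog)"
  shows "solved C (sem N p s)" "written (sem N p s) ws"
    "ar (sem N p s) mark_ar 0 = 1 \<longleftrightarrow> relevant C (nv s i_nv) (nv s a_nv)"
    "nv (sem N p s) a_nv = nv s a_nv" "nv (sem N p s) zero_nv = 0"
proof -
  let ?q = "when_unfixed b_nv relevance_prog"
  let ?s0 = "set_ar mark_ar 0 0 s"
  let ?P = "\<lambda>b. unfixed C (forced C) b \<and>
    val C ((fill 1 (forced C))(nv s a_nv := 2, b := 2)) (nv s i_nv)"
  have z: "nv s zero_nv = 0" using s by (simp add: solved_def)
  obtain s' where s': "sem N (For b_nv ?q) ?s0 = set_nv b_nv N s'"
    "solved C s' \<and> written s' ws \<and> nv s' a_nv = nv s a_nv \<and> nv s' i_nv = nv s i_nv \<and>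
     (ar s' mark_ar 0 = 1 \<longleftrightarrow> (\<exists>b<N. ?P b))"
  proof (rule sem_For_invariant[of "\<lambda>n t. solved C t \<and> written t ws \<and> nv t a_nv = nv s a_nv \<and>
      nv t i_nv = nv s i_nv \<and> (ar t mark_ar 0 = 1 \<longleftrightarrow> (\<exists>b<n. ?P b))" ?s0 N ?q b_nv])
    fix n t assume t: "solved C t \<and> written t ws \<and> nv t a_nv = nv s a_nv \<and>
      nv t i_nv = nv s i_nv \<and> (ar t mark_ar 0 = 1 \<longleftrightarrow> (\<exists>b<n. ?P b))"
    let ?t = "set_nv b_nv n t"
    have "sem N ?q ?t = (if unfixed C (forced C) n then sem N relevance_prog ?t else ?t)"
      using t by (simp add: sem_when_unfixed[of C] solved_def)
    moreover have "written (sem N relevance_prog ?t) ws" using t by (intro written_frame) auto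
    moreover have "nv (sem N relevance_prog ?t) a_nv = nv s a_nv"
      "nv (sem N relevance_prog ?t) i_nv = nv s i_nv" using t by (simp_all add: nv_frame)
    moreover have "solved C (sem N relevance_prog ?t)"
      "ar (sem N relevance_prog ?t) mark_ar 0 =
        (if val C ((fill 1 (forced C))(nv s a_nv := 2, n := 2)) (nv s i_nv) then 1 else ar t mark_ar 0)"
      using relevance_prog[of ?t] t i by auto
    ultimately show "solved C (sem N ?q ?t) \<and> written (sem N ?q ?t) ws \<and>
        nv (sem N ?q ?t) a_nv = nv s a_nv \<and> nv (sem N ?q ?t) i_nv = nv s i_nv \<and>
        (ar (sem N ?q ?t) mark_ar 0 = 1 \<longleftrightarrow> (\<exists>b<Suc n. ?P b))"
      using t by (cases "unfixed C (forced C) n") (auto simp: less_Suc_eq)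
  qed (use s w in \<open>auto simp: solved_def\<close>)
  have "sem N p s = set_nv b_nv N s'"
    using s'(1) z by (simp add: p_def del: sem.simps(7))
  then show "solved C (sem N p s)" "written (sem N p s) ws"
    "ar (sem N p s) mark_ar 0 = 1 \<longleftrightarrow> relevant C (nv s i_nv) (nv s a_nv)"
    "nv (sem N p s) a_nv = nv s a_nv" "nv (sem N p s) zero_nv = 0"
    using s'(2) a by (auto simp: relevant_def solved_def)
qed

lemma gate_input_prog:
  assumes s: "solved C s" and i: "kind C (nv s i_nv) = 6" and w: "written s ws" and a: "nv s a_nv < N"
  shows "solved C (sem N gate_input_prog s) \<and> written (sem N gate_input_prog s)
    (ws @ (if relevant C (nv s i_nv) (nv s a_nv) then enc_nat (input_rank C (nv s a_nv)) else []))"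
proof (cases "unfixed C (forced C) (nv s a_nv)")
  case True
  let ?p = "Write mark_ar zero_nv 0 ;; For b_nv (when_unfixed b_nv relevance_prog)"
  define s1 where "s1 = sem N ?p s"
  let ?s2 = "sem N emit_inputs_below s1"
  note m = mark_loop[OF s i True w, folded s1_def]
  have "sem N gate_input_prog s =
      sem N (Ite (Cell mark_ar zero_nv 1) (emit_inputs_below ;; emit 2) Skip) s1"
    using True s by (simp add: s1_def gate_input_prog_def sem_when_unfixed[of C] solved_def del: sem.simps(7))
  then have "sem N gate_input_prog s =
      (if relevant C (nv s i_nv) (nv s a_nv) then sem N (emit 2) ?s2 else s1)"
    using m(3,5) by simp
  moreover have "solved C (sem N (emit 2) ?s2)"
    using m(1) by (intro solved_frame) auto
  moreover have "written ?s2 (ws @ replicate (input_rank C (nv s a_nv)) 1)"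
    using written_emit_inputs_below[OF m(1,2)] m(4) a by simp
  then have "written (sem N (emit 2) ?s2) (ws @ enc_nat (input_rank C (nv s a_nv)))"
    using written_emit[of ?s2 _ N 2] by (fastforce simp: enc_nat_def)
  ultimately show ?thesis using m(1,2) by simp
next
  case False
  then have "sem N gate_input_prog s = s"
    using s by (simp add: gate_input_prog_def sem_when_unfixed[of C] solved_def)
  then show ?thesis using False s w by (simp add: relevant_def)
qed

lemma mods_gate_input_prog [simp]: "mods gate_input_prog =
    {asg_ar, fill_nv, kind_ar, val_ar, wire_nv, top_nv, pos_nv, mark_ar, b_nv, out_ar, out_nv}"
  by (auto simp: gate_input_prog_def)

text \<open>Printing an operand for every relevant input in increasing order is correct because
  there are exactly three of them.\<close>

lemma enc_maj_gate:
  assumes "monotone_instance C" "unset C (forced C) i" "has_unfixed C"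
  shows "enc_gate (maj_gate C i) = 5 # concat (map (\<lambda>a. if relevant C i a then
    enc_nat (input_rank C a) else []) [0..<N])"
proof -
  obtain a b c where "filter (relevant C i) [0..<N] = [a, b, c]"
    by (rule monotone_instance.maj_gate_spec[OF assms])
  then show ?thesis by (simp add: concat_map_if maj_gate_def)
qed

lemma written_emit_gates:
  assumes inst: "monotone_instance C" and ex: "has_unfixed C" and s: "solved C s" "written s ws"
  shows "solved C (sem N emit_gates s)" "written (sem N emit_gates s)
    (ws @ concat (map enc_gate (map (maj_gate C) (filter (unset C (forced C)) [0..<N]))))"
proof -
  let ?F = "\<lambda>i. if unset C (forced C) i then enc_gate (maj_gate C i) else []"
  let ?p = "when_unset i_nv (emit 5 ;; For a_nv gate_input_prog)"
  obtain s' where s': "sem N emit_gates s = set_nv i_nv N s'" "solved C s'"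
    "written s' (ws @ concat (map ?F [0..<N]))"
    unfolding emit_gates_def
  proof (rule written_For[of "\<lambda>n. solved C" s ws N ?p i_nv ?F])
    fix i t us assume i: "i < N" and t: "solved C t" "written t us"
    let ?r = "set_nv i_nv i t"
    let ?t = "sem N (emit 5) ?r"
    have t': "solved C ?t" "written ?t (us @ [5])" "nv ?t i_nv = i"
      using t by (auto intro!: solved_frame written_emit simp: nv_frame)
    have p: "sem N ?p ?r =
        (if unset C (forced C) i then sem N (For a_nv gate_input_prog) ?t else ?r)"
      using t(1) by (simp add: sem_when_unset[of C] solved_def del: sem.simps(7))
    show "solved C (sem N ?p ?r) \<and> written (sem N ?p ?r) (us @ ?F i)"
    proof (cases "unset C (forced C) i")
      case True
      then have k: "kind C i = 6" by (simp add: unset_def)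
      let ?G = "\<lambda>a. if relevant C i a then enc_nat (input_rank C a) else []"
      obtain t'' where t'': "sem N (For a_nv gate_input_prog) ?t = set_nv a_nv N t''"
        "solved C t'' \<and> nv t'' i_nv = i" "written t'' ((us @ [5]) @ concat (map ?G [0..<N]))"
      proof (rule written_For[of "\<lambda>n t. solved C t \<and> nv t i_nv = i" ?t "us @ [5]" N
            gate_input_prog a_nv ?G])
        fix a t us assume "a < N" "solved C t \<and> nv t i_nv = i" "written t us"
        then show "(solved C (sem N gate_input_prog (set_nv a_nv a t)) \<and>
            nv (sem N gate_input_prog (set_nv a_nv a t)) i_nv = i) \<and>
            written (sem N gate_input_prog (set_nv a_nv a t)) (us @ ?G a)"
          using gate_input_prog[of "set_nv a_nv a t" us] k
          by (cases "relevant C i a") (simp_all add: nv_frame)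
      qed (use t' in auto)
      then show ?thesis using p True enc_maj_gate[OF inst True ex] by simp
    qed (use p t in simp)
  qed (use s in auto)
  then show "solved C (sem N emit_gates s)" "written (sem N emit_gates s)
      (ws @ concat (map enc_gate (map (maj_gate C) (filter (unset C (forced C)) [0..<N]))))"
    by (simp_all add: concat_map_if comp_def)
qed

lemma written_emit_outputs:
  assumes s: "solved C s" "written s ws"
  shows "written (sem N emit_outputs s)
    (ws @ concat (map (\<lambda>w. 6 # enc_nat w) (map (\<lambda>i. input_rank C N + output_rank C i)
       (filter (unset C (forced C)) [0..<N]))))"
proof -
  let ?F = "\<lambda>i. if unset C (forced C) i then 6 # enc_nat (input_rank C N + output_rank C i) else []"
  let ?p = "when_unset i_nv (emit 6 ;; emit_inputs ;; emit_outputs_below ;; emit 2)"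
  obtain s' where s': "sem N emit_outputs s = set_nv i_nv N s'" "solved C s'"
    "written s' (ws @ concat (map ?F [0..<N]))"
    unfolding emit_outputs_def
  proof (rule written_For[of "\<lambda>n. solved C" s ws N ?p i_nv ?F])
    fix i t us assume i: "i < N" and t: "solved C t" "written t us"
    let ?t0 = "set_nv i_nv i t"
    let ?t1 = "sem N (emit 6) ?t0"
    let ?t2 = "sem N emit_inputs ?t1"
    let ?t3 = "sem N emit_outputs_below ?t2"
    let ?t4 = "sem N (emit 2) ?t3"
    have t1: "solved C ?t1" "written ?t1 (us @ [6])" "nv ?t1 i_nv = i"
      using t by (auto intro!: solved_frame written_emit simp: nv_frame)
    have t2: "solved C ?t2" "written ?t2 ((us @ [6]) @ replicate (input_rank C N) 1)" "nv ?t2 i_nv = i"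
      using t1 by (auto intro!: solved_frame[of C ?t1] written_emit_inputs simp: nv_frame simp del: append_assoc)
    have t3: "solved C ?t3" "written ?t3 (((us @ [6]) @ replicate (input_rank C N) 1) @
        replicate (output_rank C i) 1)"
      using t2 i written_emit_outputs_below[OF t2(1,2)]
      by (auto intro!: solved_frame[of C ?t2] simp del: append_assoc)
    have t4: "solved C ?t4" using t3(1) by (auto intro!: solved_frame)
    have "written ?t4 (us @ 6 # enc_nat (input_rank C N + output_rank C i))"
      using written_emit[OF t3(2), of N 2] by (simp add: enc_nat_def replicate_add)
    moreover have "sem N ?p ?t0 = (if unset C (forced C) i then ?t4 else ?t0)"
      using t(1) by (simp add: sem_when_unset[of C] solved_def)
    ultimately show "solved C (sem N ?p ?t0) \<and> written (sem N ?p ?t0) (us @ ?F i)"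
      using t t4 by simp
  qed (use s in auto)
  then show ?thesis by (simp add: concat_map_if comp_def)
qed

section \<open>Both programs on their actual input words\<close>

lemma input_store_ar:
  "ar (input_store ws) A = (if A < length ws then input_ar (ws ! A) else (\<lambda>j. 0))"
  by (auto simp: input_store_def input_ar_def)

lemma input_store_nv [simp]: "nv (input_store ws) x = 0"
  by (simp add: input_store_def)

lemma written_input_store: "length ws \<le> out_ar \<Longrightarrow> written (input_store ws) []"
  by (auto simp: written_def input_store_ar input_ar_def)

lemma solved_input_store:
  assumes "0 < length ws" "length ws \<le> 2" "ws ! 0 = enc_circuit C"
  shows "solved C (sem N forced_prog (input_store ws))" "written (sem N forced_prog (input_store ws)) []"
proof -
  show "solved C (sem N forced_prog (input_store ws))"
    using assms by (intro solved_forced_prog) (auto simp: input_store_ar)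
  show "written (sem N forced_prog (input_store ws)) []"
    using assms by (intro written_frame written_input_store) auto
qed

lemma written_reduce_prog:
  assumes inst: "monotone_instance C"
  shows "written (sem N reduce_prog (input_store [enc_circuit C])) (enc_circuit (reduced C))"
proof -
  let ?s = "sem N forced_prog (input_store [enc_circuit C])"
  have s: "solved C ?s" "written ?s []" using solved_input_store[of "[enc_circuit C]"] by auto
  have flag: "ar ?s flag_ar (nv ?s zero_nv) = 1 \<longleftrightarrow> has_unfixed C"
    using s(1) by (simp add: solved_def)
  show ?thesis
  proof (cases "has_unfixed C")
    case True
    let ?s1 = "sem N (emit 2) (sem N emit_inputs ?s)"
    have w1: "written ?s1 (enc_nat (input_rank C N))"
      using written_emit[OF written_emit_inputs[OF s], of N 2] by (simp add: enc_nat_def)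
    have "solved C ?s1" using s by (auto intro!: solved_frame)
    note g = written_emit_gates[OF inst True this w1]
    note o = written_emit_outputs[OF g]
    have "sem N reduce_prog (input_store [enc_circuit C]) =
        sem N emit_outputs (sem N emit_gates ?s1)"
      using flag True by (simp add: reduce_prog_def)
    then show ?thesis using o True by (simp add: reduced_def enc_circuit_def)
  next
    case False
    let ?c = "enc_circuit (Circuit 3 [Maj 0 1 2] [3, 3, 3, 3])"
    have "sem N reduce_prog (input_store [enc_circuit C]) = sem N (emit_word ?c) ?s"
      using flag False by (simp add: reduce_prog_def)
    then show ?thesis using written_emit_word[OF s(2), of N ?c] False by (simp add: reduced_def)
  qed
qed

lemma output_rank_Suc:
  "output_rank C (Suc i) = (if unset C (forced C) i then Suc (output_rank C i) else output_rank C i)"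
  by (simp add: output_rank_def)

lemma written_lift_prog:
  assumes y: "length y = num_outputs (reduced C)"
  shows "written (sem N lift_prog (input_store [enc_circuit C, enc_bits y])) (enc_bits (lift C y))"
proof -
  let ?s0 = "sem N forced_prog (input_store [enc_circuit C, enc_bits y])"
  let ?s1 = "sem N (fill_prog 1) ?s0"
  let ?s2 = "sem N eval_prog ?s1"
  have s0: "solved C ?s0" "written ?s0 []"
    using solved_input_store[of "[enc_circuit C, enc_bits y]"] by auto
  have s1: "solved C ?s1" "written ?s1 []" using s0 by (auto intro!: solved_frame written_frame)
  have s2: "solved C ?s2" "written ?s2 []"
    using s1 by (auto intro!: solved_eval_prog written_frame)
  have v2: "ar ?s2 val_ar i = bit (val C (fill 1 (forced C)) i)" if "kind C i \<noteq> 0" for i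
  proof (rule val_eval_prog[OF solved_ready[OF s1(1)] _ that])
    fix j assume "kind C j = 7"
    then have "j < N" using kind_less_size by simp
    from fill_prog[OF this, of 1 ?s0]
    show "ar ?s1 asg_ar j = 2 \<longleftrightarrow> fill 1 (forced C) j = 2"
      using s0(1) by (simp add: solved_def)
  qed
  have y2: "ar ?s2 sol_ar = input_ar (enc_bits y)" "nv ?s2 sol_nv = 0"
    by (simp_all add: ar_frame nv_frame input_store_ar)
  have le2: "forced C i \<le> 2" for i
    using restriction_inv_forced[OF wf] by (simp add: restriction_inv_def)
  let ?F = "\<lambda>i. if kind C i = 6 then [bit (lift_bit C y i)] else []"
  \<comment> \<open>Besides the arrays that are only read, the invariant fixes the reading position
    in the solution: the rank of the item reached.\<close>
  let ?Q = "\<lambda>n t. solved C t \<and> ar t sol_ar = input_ar (enc_bits y) \<and>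
    ar t val_ar = ar ?s2 val_ar \<and> (has_unfixed C \<longrightarrow> nv t sol_nv = output_rank C n)"
  obtain s' where s': "sem N (For i_nv lift_bit_prog) ?s2 = set_nv i_nv N s'"
    "?Q N s'" "written s' ([] @ concat (map ?F [0..<N]))"
  proof (rule written_For[of ?Q ?s2 "[]" N lift_bit_prog i_nv ?F])
    fix i t us assume i: "i < N" and t: "?Q i t" "written t us"
    let ?t = "set_nv i_nv i t"
    have t': "ar t kind_ar = kind C" "ar t res_ar = forced C" "nv t zero_nv = 0"
      "ar t flag_ar 0 = 1 \<longleftrightarrow> has_unfixed C"
      using t(1) by (auto simp: solved_def ready_def)
    have sol: "solved C (sem N lift_bit_prog ?t)" "ar (sem N lift_bit_prog ?t) sol_ar = ar t sol_ar"
      "ar (sem N lift_bit_prog ?t) val_ar = ar t val_ar"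
      using t(1) by (auto intro!: solved_frame simp: ar_frame lift_bit_prog_def)
    have e: "nv (sem N (emit c) u) x = nv u x" if "x \<noteq> out_nv" "x \<noteq> out_ar" for c u x
      using that by (simp add: nv_frame)
    have w: "written (sem N (emit c) ?t) (us @ [c])" for c
      using t(2) by (auto intro: written_emit)
    have yi: "ar t sol_ar (output_rank C i) = bit (y ! output_rank C i)"
      if "unset C (forced C) i" "has_unfixed C"
    proof -
      have "output_rank C i < length (filter (unset C (forced C)) [0..<N])"
        unfolding output_rank_def using that(1) i by (rule filter_nth_rank(2))
      then have "output_rank C i < length y" using y that(2) by (simp add: reduced_def)
      then show ?thesis using t(1) by (simp add: input_ar_def enc_bits_def)
    qed
    have "(has_unfixed C \<longrightarrow> nv (sem N lift_bit_prog ?t) sol_nv = output_rank C (Suc i)) \<and>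
        written (sem N lift_bit_prog ?t) (us @ ?F i)"
    proof (cases "kind C i = 6 \<and> forced C i = 0")
      case True
      then have u: "unset C (forced C) i" by (simp add: unset_def)
      have vi: "ar t val_ar i = bit (val C (fill 1 (forced C)) i)" using t(1) v2[of i] True by simp
      show ?thesis
      proof (cases "has_unfixed C")
        case hu: True
        then have "sem N lift_bit_prog ?t =
            sem N (Inc sol_nv) (sem N (emit (bit (y ! output_rank C i))) ?t)"
          using True t' t(1) yi[OF u hu] by (simp add: lift_bit_prog_def)
        then show ?thesis using hu u True t(1) e w by (simp add: output_rank_Suc lift_bit_def)
      next
        case False
        then have "sem N lift_bit_prog ?t = sem N (emit (bit (\<not> val C (fill 1 (forced C)) i))) ?t"
          using True t' vi by (simp add: lift_bit_prog_def)
        then show ?thesis using False True w[of "bit (\<not> val C (fill 1 (forced C)) i)"]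
          by (simp add: lift_bit_def)
      qed
    next
      case False
      then have nu: "\<not> unset C (forced C) i" by (simp add: unset_def)
      have "sem N lift_bit_prog ?t = (if kind C i = 6 then sem N (emit (bit (lift_bit C y i))) ?t else ?t)"
        using False t' le2[of i] by (auto simp: lift_bit_prog_def lift_bit_def le_Suc_eq numeral_2_eq_2)
      then show ?thesis using nu t w e by (simp add: output_rank_Suc)
    qed
    then show "?Q (Suc i) (sem N lift_bit_prog ?t) \<and> written (sem N lift_bit_prog ?t) (us @ ?F i)"
      using sol t(1) by auto
  qed (use s2 y2 in \<open>auto simp: output_rank_def\<close>)
  have "concat (map ?F [0..<N]) = enc_bits (lift C y)"
    by (simp add: concat_map_if enc_bits_def lift_def comp_def)
  moreover have "sem N lift_prog (input_store [enc_circuit C, enc_bits y]) = set_nv i_nv N s'"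
    using s'(1) by (simp add: lift_prog_def)
  ultimately show ?thesis using s'(3) by simp
qed

end

section \<open>The reduction\<close>

lemma prog_ok_emit_word: "\<forall>c\<in>set cs. c < 8 \<Longrightarrow> prog_ok nv_tapes 20 8 (emit_word cs)"
  by (induction cs) (auto simp: emit_def)

text \<open>Eight symbols: the blank, the symbols \<open>1\<close> to \<open>6\<close> of the
  encodings and the kind \<open>7\<close>.\<close>

lemma prog_ok_programs: "prog_ok nv_tapes 20 8 eval_prog" "prog_ok nv_tapes 20 8 forced_prog"
    "d < 8 \<Longrightarrow> prog_ok nv_tapes 20 8 (fill_prog d)" "prog_ok nv_tapes 20 8 emit_inputs"
    "prog_ok nv_tapes 20 8 emit_gates" "prog_ok nv_tapes 20 8 emit_outputs"
proof -
  show e: "prog_ok nv_tapes 20 8 eval_prog"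
    by (simp add: eval_prog_def scan_char_def new_item_def)
  show f: "prog_ok nv_tapes 20 8 (fill_prog d)" if "d < 8" for d
    using that by (simp add: fill_prog_def)
  show "prog_ok nv_tapes 20 8 forced_prog"
    by (simp add: forced_prog_def e f force_prog_def when_unset_def when_unfixed_def probe_prog_def)
  show i: "prog_ok nv_tapes 20 8 emit_inputs"
    by (simp add: emit_inputs_def when_unfixed_def emit_def)
  show "prog_ok nv_tapes 20 8 emit_gates"
    by (simp add: emit_gates_def gate_input_prog_def e f i emit_inputs_below_def relevance_prog_def
        when_unset_def when_unfixed_def emit_def)
  show "prog_ok nv_tapes 20 8 emit_outputs"
    by (simp add: emit_outputs_def i emit_outputs_below_def when_unset_def emit_def)
qed

lemma enc_nat_symbols: "s \<in> set (enc_nat n) \<Longrightarrow> s = 1 \<or> s = 2"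
  by (auto simp: enc_nat_def)

lemma enc_circuit_symbols: "s \<in> set (enc_circuit C) \<Longrightarrow> 0 < s \<and> s < 8"
proof -
  have "0 < s \<and> s < 8" if "s \<in> set (enc_gate g)" for s g
    using that by (cases g) (auto dest: enc_nat_symbols)
  then show "s \<in> set (enc_circuit C) \<Longrightarrow> 0 < s \<and> s < 8"
    by (auto simp: enc_circuit_def dest!: enc_nat_symbols split: if_splits)
qed

lemma enc_bits_symbols: "s \<in> set (enc_bits y) \<Longrightarrow> 0 < s \<and> s < 8"
  by (auto simp: enc_bits_def split: if_splits)

lemma prog_ok_reduce_prog: "prog_ok nv_tapes 20 8 reduce_prog"
  unfolding reduce_prog_def
  by (simp add: prog_ok_programs prog_ok_emit_word enc_circuit_symbols) (simp add: emit_def)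

lemma prog_ok_lift_prog: "prog_ok nv_tapes 20 8 lift_prog"
  by (simp add: lift_prog_def prog_ok_programs lift_bit_prog_def emit_def)

lemma word_at_written: "written s w \<Longrightarrow> word_at (ar s out_ar) w"
  by (simp add: written_def word_at_def input_ar_def)

theorem mainTheorem12:
  fixes d :: nat
  shows "poly_time_reducible (avoid (monotone_NC0_3 d)) (avoid maj3_circuits)"
proof -
  let ?D = "instances (avoid (monotone_NC0_3 d))"
  have gate: "monotone_circuit C" and inst: "monotone_instance C" if "C \<in> ?D" for C
    using that by (auto simp: avoid_def monotone_NC0_3_def monotone_circuit_def monotone_instance_def)
  have "poly_time_on ?D (\<lambda>C. [enc_circuit C]) enc_circuit reduced"
  proof (rule poly_time_on_prog[OF prog_ok_reduce_prog])
    fix C assume C: "C \<in> ?D"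
    show "0 \<notin> set (enc_circuit (reduced C)) \<and>
        word_at (ar (sem (length (hd [enc_circuit C])) reduce_prog (input_store [enc_circuit C])) (20 - 1))
          (enc_circuit (reduced C))"
      using word_at_written[OF monotone_circuit.written_reduce_prog[OF gate[OF C] inst[OF C]]]
        enc_circuit_symbols[of 0 "reduced C"] by auto
  qed (auto dest: enc_circuit_symbols)
  moreover have "poly_time_on {(C, y). C \<in> ?D \<and> y \<in> solutions (avoid maj3_circuits) (reduced C)}
      (\<lambda>(C, y). [enc_circuit C, enc_bits y]) enc_bits (\<lambda>(C, y). lift C y)"
    (is "poly_time_on ?E ?enc _ _")
  proof (rule poly_time_on_prog[OF prog_ok_lift_prog])
    fix z assume z: "z \<in> ?E"
    obtain C y where Cy: "z = (C, y)" by (cases z)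
    then have C: "C \<in> ?D" and y: "length y = num_outputs (reduced C)"
      using z by (auto simp: avoid_def)
    show "0 \<notin> set (enc_bits (case z of (C, y) \<Rightarrow> lift C y)) \<and>
        word_at (ar (sem (length (hd (?enc z))) lift_prog (input_store (?enc z))) (20 - 1))
          (enc_bits (case z of (C, y) \<Rightarrow> lift C y))"
      using word_at_written[OF monotone_circuit.written_lift_prog[OF gate[OF C] y]]
        enc_bits_symbols[of 0 "lift C y"] Cy by auto
  qed (auto dest: enc_circuit_symbols enc_bits_symbols simp: less_Suc_eq)
  moreover have "reduced C \<in> instances (avoid maj3_circuits)" if "C \<in> ?D" for C
    using monotone_instance.reduced_instance[OF inst[OF that]] by (simp add: avoid_def)
  moreover have "lift C y \<in> solutions (avoid (monotone_NC0_3 d)) C"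
    if "C \<in> ?D" "y \<in> solutions (avoid maj3_circuits) (reduced C)" for C y
    using monotone_instance.lift_solution[OF inst[OF that(1)], of y] that(2) by (auto simp: avoid_def)
  ultimately show ?thesis
    unfolding poly_time_reducible_def
    by (intro exI[of _ reduced] exI[of _ "\<lambda>(C, y). lift C y"]) (simp add: avoid_def)
qed

end
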